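(* Let $A=B^{\otimes\mathbb{Z}}$ for a given UHF-algebra $B$, and let $\alpha\colon A \to A$ be the tensor shift automorphism induced by the map $i\mapsto i+1$ on the index set $\mathbb{Z}$. Then either $B\cong\mathbb{M}_k(\mathbb{C})$ for some $k\in\mathbb{N}$, in which case $\mathrm{ht}_{\mathrm{dr}}(\alpha) = \mathrm{ht}_{\mathrm{nuc}}(\alpha) = \mathrm{ht}(\alpha) = \log k$, or $B$ is infinite dimensional and $\mathrm{ht}_{\mathrm{dr}}(\alpha) = \mathrm{ht}_{\mathrm{nuc}}(\alpha) = \mathrm{ht}(\alpha) = \infty$.
   Context: Full matrix algebras $\mathbb{M}_k(\mathbb{C})$ are counted as UHF-algebras, and $\mathbb{N}=\{1,2,\dots\}$. 'cp' means completely positive, 'cpc' completely positive contractive. The rank of a finite-dimensional $\mathrm{C}^*$-algebra is the dimension of a maximal abelian subalgebra. A cp map $\phi$ is order zero if $\phi(a)\phi(b)=0$ whenever $a,b\ge0$ and $ab=0$. Let $A$ be a nuclear $\mathrm{C}^*$-algebra and $\alpha\colon A\to A$ a $^*$-homomorphism; below $\mathcal{F}$ ranges over finite subsets of $A$ and $\varepsilon>0$. (1) Brown--Voiculescu entropy. $\mathrm{rcp}(\mathcal{F},\varepsilon)$ is the infimum of $\mathrm{rank}(F)$ over triples $(F,\psi,\varphi)$ with $F$ finite dimensional, $\psi\colon A\to F$ and $\varphi\colon F\to A$ cpc, and $\|\varphi(\psi(a))-a\|\le\varepsilon$ for $a\in\mathcal{F}$; $\mathrm{ht}(\alpha)=\sup_{\mathcal{F}}\sup_{\varepsilon>0}\limsup_{n\to\infty}\frac1n\log\mathrm{rcp}(\mathcal{F}\cup\alpha(\mathcal{F})\cup\dots\cup\alpha^{n-1}(\mathcal{F}),\varepsilon)$.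 (2) Coloured entropies. A $(d,\mathcal{F},\varepsilon)$-decomposable system for $A$ is a triple $(F,\psi,\varphi)$ with $F=F^{(0)}\oplus\dots\oplus F^{(d)}$ a finite-dimensional $\mathrm{C}^*$-algebra, $\psi\colon A\to F$ cpc, $\varphi\colon F\to A$ linear whose restriction to each $F^{(i)}$ is cpc order zero, and $\|\varphi(\psi(a))-a\|\le\varepsilon$ for $a\in\mathcal{F}$; it is contractive if $\varphi$ is contractive. The nuclear dimension $\dim_{\mathrm{nuc}}(A)$ (respectively decomposition rank $\mathrm{dr}(A)$) is the least $d\in\{0,1,2,\dots\}$ such that (contractive) $(d,\mathcal{F},\varepsilon)$-decomposable systems exist for all $\mathcal{F},\varepsilon$, and is $\infty$ if there is no such $d$. Let $r_{\mathrm{nuc}}(d,\mathcal{F},\varepsilon)$ (respectively $r_{\mathrm{dr}}(d,\mathcal{F},\varepsilon)$) be the infimum of $\mathrm{rank}(F)$ over all (contractive) $(d,\mathcal{F},\varepsilon)$-decomposable systems. If $d=\dim_{\mathrm{nuc}}(A)<\infty$, put $\mathrm{ht}_{\mathrm{nuc}}(\alpha)=\sup_{\mathcal{F}}\sup_{\varepsilon>0}\limsup_{n\to\infty}\frac1n\log r_{\mathrm{nuc}}(d,\mathcal{F}\cup\dots\cup\alpha^{n-1}(\mathcal{F}),\varepsilon)$, and $\mathrm{ht}_{\mathrm{nuc}}(\alpha)=\infty$ if $\dim_{\mathrm{nuc}}(A)=\infty$. Define $\mathrm{ht}_{\mathrm{dr}}(\alpha)$ in the same way with $d=\mathrm{dr}(A)$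 and $r_{\mathrm{dr}}$, and $\mathrm{ht}_{\mathrm{dr}}(\alpha)=\infty$ if $\mathrm{dr}(A)=\infty$. *)

theory Defs
  imports
    "HOL-Analysis.Analysis"
    "Jordan_Normal_Form.Schur_Decomposition"
    "Jordan_Normal_Form.VS_Connect"
begin

hide_const (open) Finite_Cartesian_Product.vec

section \<open>C*-algebras\<close>

text \<open>The multiplicative identity field \<open>one\<close> inherited from \<^typ>\<open>('k, 'a) module\<close> carries
  information only for unital algebras; no definition for general algebras refers to it.\<close>

record 'a cstar_alg = "(complex, 'a) module" +
  star :: "'a \<Rightarrow> 'a"
  nrm :: "'a \<Rightarrow> real"

abbreviation complex_field :: "complex ring" where
  "complex_field \<equiv> class_ring"

text \<open>The case distinction only makes the distance total, as the locale \<open>Metric_space\<close> requires;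
  it plays no role on the carrier.\<close>

definition cstar_dist :: "'a cstar_alg \<Rightarrow> 'a \<Rightarrow> 'a \<Rightarrow> real" where
  "cstar_dist A x y =
    (if x \<in> carrier A \<and> y \<in> carrier A then nrm A (x \<ominus>\<^bsub>A\<^esub> y) else 0)"

definition cstar_topology :: "'a cstar_alg \<Rightarrow> 'a topology" where
  "cstar_topology A = Metric_space.mtopology (carrier A) (cstar_dist A)"

locale cstar_algebra = vectorspace complex_field A for A :: "'a cstar_alg" (structure) +
  assumes mult_closed: "\<lbrakk>x \<in> carrier A; y \<in> carrier A\<rbrakk> \<Longrightarrow> x \<otimes> y \<in> carrier A"
    and mult_assoc:
      "\<lbrakk>x \<in> carrier A; y \<in> carrier A; z \<in> carrier A\<rbrakk> \<Longrightarrow> (x \<otimes> y) \<otimes> z = x \<otimes> (y \<otimes> z)"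
    and mult_add_left:
      "\<lbrakk>x \<in> carrier A; y \<in> carrier A; z \<in> carrier A\<rbrakk> \<Longrightarrow> (x \<oplus> y) \<otimes> z = x \<otimes> z \<oplus> y \<otimes> z"
    and mult_add_right:
      "\<lbrakk>x \<in> carrier A; y \<in> carrier A; z \<in> carrier A\<rbrakk> \<Longrightarrow> x \<otimes> (y \<oplus> z) = x \<otimes> y \<oplus> x \<otimes> z"
    and smult_mult_left:
      "\<lbrakk>x \<in> carrier A; y \<in> carrier A\<rbrakk> \<Longrightarrow> (c \<odot> x) \<otimes> y = c \<odot> (x \<otimes> y)"
    and smult_mult_right:
      "\<lbrakk>x \<in> carrier A; y \<in> carrier A\<rbrakk> \<Longrightarrow> x \<otimes> (c \<odot> y) = c \<odot> (x \<otimes> y)"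
    and star_closed: "x \<in> carrier A \<Longrightarrow> star A x \<in> carrier A"
    and star_star: "x \<in> carrier A \<Longrightarrow> star A (star A x) = x"
    and star_add:
      "\<lbrakk>x \<in> carrier A; y \<in> carrier A\<rbrakk> \<Longrightarrow> star A (x \<oplus> y) = star A x \<oplus> star A y"
    and star_smult: "x \<in> carrier A \<Longrightarrow> star A (c \<odot> x) = cnj c \<odot> star A x"
    and star_mult:
      "\<lbrakk>x \<in> carrier A; y \<in> carrier A\<rbrakk> \<Longrightarrow> star A (x \<otimes> y) = star A y \<otimes> star A x"
    and nrm_nonneg: "x \<in> carrier A \<Longrightarrow> 0 \<le> nrm A x"
    and nrm_eq_0_iff: "x \<in> carrier A \<Longrightarrow> nrm A x = 0 \<longleftrightarrow> x = \<zero>"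
    and nrm_triangle:
      "\<lbrakk>x \<in> carrier A; y \<in> carrier A\<rbrakk> \<Longrightarrow> nrm A (x \<oplus> y) \<le> nrm A x + nrm A y"
    and nrm_smult: "x \<in> carrier A \<Longrightarrow> nrm A (c \<odot> x) = cmod c * nrm A x"
    and nrm_mult:
      "\<lbrakk>x \<in> carrier A; y \<in> carrier A\<rbrakk> \<Longrightarrow> nrm A (x \<otimes> y) \<le> nrm A x * nrm A y"
    and cstar_identity: "x \<in> carrier A \<Longrightarrow> nrm A (star A x \<otimes> x) = (nrm A x)\<^sup>2"
    and complete: "Metric_space.mcomplete (carrier A) (cstar_dist A)"

definition cstar_unital :: "'a cstar_alg \<Rightarrow> bool" where
  "cstar_unital A \<longleftrightarrow> cstar_algebra A \<and> \<one>\<^bsub>A\<^esub> \<in> carrier A \<and>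
    (\<forall>x\<in>carrier A. \<one>\<^bsub>A\<^esub> \<otimes>\<^bsub>A\<^esub> x = x \<and> x \<otimes>\<^bsub>A\<^esub> \<one>\<^bsub>A\<^esub> = x)"

definition cstar_subalgebra :: "'a set \<Rightarrow> 'a cstar_alg \<Rightarrow> bool" where
  "cstar_subalgebra S A \<longleftrightarrow> S \<subseteq> carrier A \<and> cstar_algebra (A\<lparr>carrier := S\<rparr>)"

definition star_hom :: "'a cstar_alg \<Rightarrow> 'b cstar_alg \<Rightarrow> ('a \<Rightarrow> 'b) \<Rightarrow> bool" where
  "star_hom A B f \<longleftrightarrow> f \<in> module_hom complex_field A B \<and>
    (\<forall>x\<in>carrier A. \<forall>y\<in>carrier A. f (x \<otimes>\<^bsub>A\<^esub> y) = f x \<otimes>\<^bsub>B\<^esub> f y) \<and>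
    (\<forall>x\<in>carrier A. f (star A x) = star B (f x))"

definition star_iso :: "'a cstar_alg \<Rightarrow> 'b cstar_alg \<Rightarrow> ('a \<Rightarrow> 'b) \<Rightarrow> bool" where
  "star_iso A B f \<longleftrightarrow> star_hom A B f \<and> bij_betw f (carrier A) (carrier B)"

definition cstar_isomorphic :: "'a cstar_alg \<Rightarrow> 'b cstar_alg \<Rightarrow> bool" where
  "cstar_isomorphic A B \<longleftrightarrow> (\<exists>f. star_iso A B f)"

definition finite_dimensional :: "'a cstar_alg \<Rightarrow> bool" where
  "finite_dimensional A \<longleftrightarrow> vectorspace.fin_dim complex_field A"


section \<open>Full matrix algebras and UHF-algebras\<close>

definition op_norm :: "nat \<Rightarrow> complex mat \<Rightarrow> real" where
  "op_norm k X = Sup {sqrt (Re ((X *\<^sub>v v) \<bullet>c (X *\<^sub>v v))) | v.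
     v \<in> carrier_vec k \<and> Re (v \<bullet>c v) \<le> 1}"

definition matrix_algebra :: "nat \<Rightarrow> complex mat cstar_alg" where
  "matrix_algebra k =
    \<lparr>carrier = carrier_mat k k, mult = (*), one = 1\<^sub>m k, zero = 0\<^sub>m k k, add = (+),
     smult = (\<cdot>\<^sub>m), star = mat_adjoint, nrm = op_norm k\<rparr>"

text \<open>Constant sequences are allowed, so full matrix algebras are UHF.\<close>

definition uhf_algebra :: "'b cstar_alg \<Rightarrow> bool" where
  "uhf_algebra B \<longleftrightarrow> cstar_unital B \<and>
    (\<exists>S k. incseq S \<and>
      (\<forall>n::nat. cstar_subalgebra (S n) B \<and> \<one>\<^bsub>B\<^esub> \<in> S n \<and> 1 \<le> k n \<and>
        cstar_isomorphic (B\<lparr>carrier := S n\<rparr>) (matrix_algebra (k n))) \<and>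
      cstar_topology B closure_of (\<Union>n. S n) = carrier B)"


section \<open>Infinite tensor powers\<close>

definition state :: "'b cstar_alg \<Rightarrow> ('b \<Rightarrow> complex) \<Rightarrow> bool" where
  "state B f \<longleftrightarrow>
    (\<forall>x\<in>carrier B. \<forall>y\<in>carrier B. f (x \<oplus>\<^bsub>B\<^esub> y) = f x + f y) \<and>
    (\<forall>c. \<forall>x\<in>carrier B. f (c \<odot>\<^bsub>B\<^esub> x) = c * f x) \<and>
    (\<forall>x\<in>carrier B. f (star B x \<otimes>\<^bsub>B\<^esub> x) \<in> \<real>\<^sub>\<ge>\<^sub>0) \<and>
    f \<one>\<^bsub>B\<^esub> = 1"

text \<open>For a finite set \<open>I\<close> of tensor positions, a list \<open>[u\<^sub>1, \<dots>, u\<^sub>n]\<close> of families of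
  elements of \<open>B\<close> represents the element \<open>\<Sum>\<^sub>j \<Otimes>\<^sub>i u\<^sub>j i\<close> (\<open>i \<in> I\<close>) of the
  algebraic tensor power of \<open>B\<close> over \<open>I\<close>.\<close>

definition tensors :: "'b cstar_alg \<Rightarrow> int set \<Rightarrow> (int \<Rightarrow> 'b) list set" where
  "tensors B I = {x. \<forall>u\<in>set x. \<forall>i\<in>I. u i \<in> carrier B}"

definition tensor_mult ::
  "'b cstar_alg \<Rightarrow> (int \<Rightarrow> 'b) list \<Rightarrow> (int \<Rightarrow> 'b) list \<Rightarrow> (int \<Rightarrow> 'b) list" where
  "tensor_mult B x y = [(\<lambda>i. u i \<otimes>\<^bsub>B\<^esub> v i). u \<leftarrow> x, v \<leftarrow> y]"

text \<open>The value of the product functional \<open>\<Otimes>\<^sub>i f i\<close> at \<open>z* z\<close>.\<close>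

definition product_state_sq ::
  "'b cstar_alg \<Rightarrow> int set \<Rightarrow> (int \<Rightarrow> 'b \<Rightarrow> complex) \<Rightarrow> (int \<Rightarrow> 'b) list \<Rightarrow> complex" where
  "product_state_sq B I f z =
    (\<Sum>u\<leftarrow>z. \<Sum>v\<leftarrow>z. \<Prod>i\<in>I. f i (star B (u i) \<otimes>\<^bsub>B\<^esub> v i))"

text \<open>The minimal (spatial) C*-norm on the algebraic tensor power: the supremum of the norms in
  the GNS representations of product states.\<close>

definition spatial_norm :: "'b cstar_alg \<Rightarrow> int set \<Rightarrow> (int \<Rightarrow> 'b) list \<Rightarrow> real" where
  "spatial_norm B I x =
    Sup {sqrt (Re (product_state_sq B I f (tensor_mult B x y))) | f y.
      (\<forall>i\<in>I. state B (f i)) \<and> y \<in> tensors B I \<and> product_state_sq B I f y = 1}"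

text \<open>The image of a tensor in \<open>A\<close> under the maps \<open>\<iota> i\<close>, which embed \<open>B\<close> at position \<open>i\<close> and
  have commuting ranges.\<close>

definition tensor_eval ::
  "'a cstar_alg \<Rightarrow> (int \<Rightarrow> 'b \<Rightarrow> 'a) \<Rightarrow> int set \<Rightarrow> (int \<Rightarrow> 'b) list \<Rightarrow> 'a" where
  "tensor_eval A \<iota> I x =
    foldr (\<lambda>u s. foldr (\<lambda>i p. \<iota> i (u i) \<otimes>\<^bsub>A\<^esub> p) (sorted_list_of_set I) \<one>\<^bsub>A\<^esub> \<oplus>\<^bsub>A\<^esub> s) x \<zero>\<^bsub>A\<^esub>"

text \<open>\<open>A\<close>, together with the embeddings \<open>\<iota>\<close>, is the C*-algebraic inductive limit of the spatial
  tensor powers of \<open>B\<close> over the finite subsets of the integers.\<close>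

definition infinite_tensor_power ::
  "'b cstar_alg \<Rightarrow> 'a cstar_alg \<Rightarrow> (int \<Rightarrow> 'b \<Rightarrow> 'a) \<Rightarrow> bool" where
  "infinite_tensor_power B A \<iota> \<longleftrightarrow> cstar_unital B \<and> cstar_unital A \<and>
    (\<forall>i. star_hom B A (\<iota> i) \<and> \<iota> i \<one>\<^bsub>B\<^esub> = \<one>\<^bsub>A\<^esub>) \<and>
    (\<forall>i j. i \<noteq> j \<longrightarrow> (\<forall>x\<in>carrier B. \<forall>y\<in>carrier B.
       \<iota> i x \<otimes>\<^bsub>A\<^esub> \<iota> j y = \<iota> j y \<otimes>\<^bsub>A\<^esub> \<iota> i x)) \<and>
    (\<forall>I. finite I \<longrightarrow> (\<forall>x\<in>tensors B I. nrm A (tensor_eval A \<iota> I x) = spatial_norm B I x)) \<and>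
    cstar_topology A closure_of (\<Union>I\<in>Collect finite. tensor_eval A \<iota> I ` tensors B I) = carrier A"

definition tensor_shift ::
  "'b cstar_alg \<Rightarrow> 'a cstar_alg \<Rightarrow> (int \<Rightarrow> 'b \<Rightarrow> 'a) \<Rightarrow> ('a \<Rightarrow> 'a) \<Rightarrow> bool" where
  "tensor_shift B A \<iota> \<alpha> \<longleftrightarrow> star_iso A A \<alpha> \<and> (\<forall>i. \<forall>b\<in>carrier B. \<alpha> (\<iota> i b) = \<iota> (i + 1) b)"


section \<open>Completely positive maps\<close>

definition cstar_pos :: "'a cstar_alg \<Rightarrow> 'a \<Rightarrow> bool" where
  "cstar_pos A x \<longleftrightarrow> (\<exists>y\<in>carrier A. x = star A y \<otimes>\<^bsub>A\<^esub> y)"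

text \<open>Positivity in the \<open>n \<times> n\<close> matrices over \<open>A\<close>; only entries with indices below \<open>n\<close> matter.\<close>

definition mat_pos :: "'a cstar_alg \<Rightarrow> nat \<Rightarrow> (nat \<Rightarrow> nat \<Rightarrow> 'a) \<Rightarrow> bool" where
  "mat_pos A n x \<longleftrightarrow> (\<exists>y. (\<forall>i<n. \<forall>j<n. y i j \<in> carrier A) \<and>
    (\<forall>i<n. \<forall>j<n. x i j = (\<Oplus>\<^bsub>A\<^esub>l\<in>{..<n}. star A (y l i) \<otimes>\<^bsub>A\<^esub> y l j)))"

definition completely_positive :: "'a cstar_alg \<Rightarrow> 'b cstar_alg \<Rightarrow> ('a \<Rightarrow> 'b) \<Rightarrow> bool" where
  "completely_positive A B \<phi> \<longleftrightarrow> \<phi> \<in> module_hom complex_field A B \<and>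
    (\<forall>n x. mat_pos A n x \<longrightarrow> mat_pos B n (\<lambda>i j. \<phi> (x i j)))"

definition contractive :: "'a cstar_alg \<Rightarrow> 'b cstar_alg \<Rightarrow> ('a \<Rightarrow> 'b) \<Rightarrow> bool" where
  "contractive A B \<phi> \<longleftrightarrow> (\<forall>x\<in>carrier A. nrm B (\<phi> x) \<le> nrm A x)"

definition cpc :: "'a cstar_alg \<Rightarrow> 'b cstar_alg \<Rightarrow> ('a \<Rightarrow> 'b) \<Rightarrow> bool" where
  "cpc A B \<phi> \<longleftrightarrow> completely_positive A B \<phi> \<and> contractive A B \<phi>"

definition order_zero :: "'a cstar_alg \<Rightarrow> 'b cstar_alg \<Rightarrow> ('a \<Rightarrow> 'b) \<Rightarrow> bool" where
  "order_zero A B \<phi> \<longleftrightarrow> (\<forall>a\<in>carrier A. \<forall>b\<in>carrier A.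
    cstar_pos A a \<and> cstar_pos A b \<and> a \<otimes>\<^bsub>A\<^esub> b = \<zero>\<^bsub>A\<^esub> \<longrightarrow> \<phi> a \<otimes>\<^bsub>B\<^esub> \<phi> b = \<zero>\<^bsub>B\<^esub>)"


section \<open>Rank and approximating systems\<close>

definition abelian_subalgebra :: "'a set \<Rightarrow> 'a cstar_alg \<Rightarrow> bool" where
  "abelian_subalgebra D F \<longleftrightarrow>
    cstar_subalgebra D F \<and> (\<forall>x\<in>D. \<forall>y\<in>D. x \<otimes>\<^bsub>F\<^esub> y = y \<otimes>\<^bsub>F\<^esub> x)"

definition maximal_abelian :: "'a set \<Rightarrow> 'a cstar_alg \<Rightarrow> bool" where
  "maximal_abelian D F \<longleftrightarrow>
    abelian_subalgebra D F \<and> (\<forall>D'. abelian_subalgebra D' F \<and> D \<subseteq> D' \<longrightarrow> D' = D)"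

text \<open>In a finite-dimensional C*-algebra all maximal abelian subalgebras have the same dimension.\<close>

definition cstar_rank :: "'a cstar_alg \<Rightarrow> nat" where
  "cstar_rank F = vectorspace.dim complex_field (F\<lparr>carrier := (SOME D. maximal_abelian D F)\<rparr>)"

text \<open>The internal direct sum \<open>F = J 0 \<oplus> \<dots> \<oplus> J d\<close> of C*-algebras; summands may be zero.\<close>

definition direct_sum_decomp :: "'a cstar_alg \<Rightarrow> nat \<Rightarrow> (nat \<Rightarrow> 'a set) \<Rightarrow> bool" where
  "direct_sum_decomp F d J \<longleftrightarrow>
    (\<forall>i\<le>d. cstar_subalgebra (J i) F) \<and>
    (\<forall>i\<le>d. \<forall>j\<le>d. i \<noteq> j \<longrightarrow> (\<forall>x\<in>J i. \<forall>y\<in>J j. x \<otimes>\<^bsub>F\<^esub> y = \<zero>\<^bsub>F\<^esub>)) \<and>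
    (\<forall>x\<in>carrier F. \<exists>!f. f \<in> (\<Pi>\<^sub>E i\<in>{..d}. J i) \<and> x = (\<Oplus>\<^bsub>F\<^esub>i\<in>{..d}. f i))"

text \<open>In the definitions below the elements of the finite-dimensional algebra \<open>F\<close> are taken from
  a fixed type of the cardinality of the continuum. The algebra operations of \<open>F\<close> are unrelated to
  matrix operations, so every finite-dimensional C*-algebra occurs up to isomorphism.\<close>

type_synonym findim_alg = "complex mat cstar_alg"

definition cpc_approximation ::
  "'a cstar_alg \<Rightarrow> 'a set \<Rightarrow> real \<Rightarrow> findim_alg \<Rightarrow>
    ('a \<Rightarrow> complex mat) \<Rightarrow> (complex mat \<Rightarrow> 'a) \<Rightarrow> bool" where
  "cpc_approximation A \<F> \<epsilon> F \<psi> \<phi> \<longleftrightarrow>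
    cstar_algebra F \<and> finite_dimensional F \<and> cpc A F \<psi> \<and> cpc F A \<phi> \<and>
    (\<forall>a\<in>\<F>. nrm A (\<phi> (\<psi> a) \<ominus>\<^bsub>A\<^esub> a) \<le> \<epsilon>)"

definition decomposable_system ::
  "'a cstar_alg \<Rightarrow> nat \<Rightarrow> 'a set \<Rightarrow> real \<Rightarrow> findim_alg \<Rightarrow> (nat \<Rightarrow> complex mat set) \<Rightarrow>
    ('a \<Rightarrow> complex mat) \<Rightarrow> (complex mat \<Rightarrow> 'a) \<Rightarrow> bool" where
  "decomposable_system A d \<F> \<epsilon> F J \<psi> \<phi> \<longleftrightarrow>
    cstar_algebra F \<and> finite_dimensional F \<and> direct_sum_decomp F d J \<and>
    cpc A F \<psi> \<and> \<phi> \<in> module_hom complex_field F A \<and>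
    (\<forall>i\<le>d. cpc (F\<lparr>carrier := J i\<rparr>) A \<phi> \<and> order_zero (F\<lparr>carrier := J i\<rparr>) A \<phi>) \<and>
    (\<forall>a\<in>\<F>. nrm A (\<phi> (\<psi> a) \<ominus>\<^bsub>A\<^esub> a) \<le> \<epsilon>)"

definition rcp :: "'a cstar_alg \<Rightarrow> 'a set \<Rightarrow> real \<Rightarrow> enat" where
  "rcp A \<F> \<epsilon> = Inf {enat (cstar_rank F) | F \<psi> \<phi>. cpc_approximation A \<F> \<epsilon> F \<psi> \<phi>}"

definition r_nuc :: "'a cstar_alg \<Rightarrow> nat \<Rightarrow> 'a set \<Rightarrow> real \<Rightarrow> enat" where
  "r_nuc A d \<F> \<epsilon> =
    Inf {enat (cstar_rank F) | F J \<psi> \<phi>. decomposable_system A d \<F> \<epsilon> F J \<psi> \<phi>}"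

definition r_dr :: "'a cstar_alg \<Rightarrow> nat \<Rightarrow> 'a set \<Rightarrow> real \<Rightarrow> enat" where
  "r_dr A d \<F> \<epsilon> =
    Inf {enat (cstar_rank F) | F J \<psi> \<phi>.
      decomposable_system A d \<F> \<epsilon> F J \<psi> \<phi> \<and> contractive F A \<phi>}"

definition dim_nuc :: "'a cstar_alg \<Rightarrow> enat" where
  "dim_nuc A = Inf {enat d | d. \<forall>\<F> \<epsilon>. finite \<F> \<and> \<F> \<subseteq> carrier A \<and> 0 < \<epsilon> \<longrightarrow>
    (\<exists>F J \<psi> \<phi>. decomposable_system A d \<F> \<epsilon> F J \<psi> \<phi>)}"

definition decomposition_rank :: "'a cstar_alg \<Rightarrow> enat" where
  "decomposition_rank A = Inf {enat d | d. \<forall>\<F> \<epsilon>. finite \<F> \<and> \<F> \<subseteq> carrier A \<and> 0 < \<epsilon> \<longrightarrow>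
    (\<exists>F J \<psi> \<phi>. decomposable_system A d \<F> \<epsilon> F J \<psi> \<phi> \<and> contractive F A \<phi>)}"


section \<open>Entropies\<close>

fun log_enat :: "enat \<Rightarrow> ereal" where
  "log_enat (enat m) = (if m = 0 then -\<infinity> else ereal (ln (real m)))"
| "log_enat \<infinity> = \<infinity>"

definition orbit_union :: "('a \<Rightarrow> 'a) \<Rightarrow> 'a set \<Rightarrow> nat \<Rightarrow> 'a set" where
  "orbit_union \<alpha> \<F> n = (\<Union>i<n. (\<alpha> ^^ i) ` \<F>)"

definition growth_entropy ::
  "('a set \<Rightarrow> real \<Rightarrow> enat) \<Rightarrow> 'a cstar_alg \<Rightarrow> ('a \<Rightarrow> 'a) \<Rightarrow> ereal" where
  "growth_entropy r A \<alpha> =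
    (SUP \<F>\<in>{\<F>. finite \<F> \<and> \<F> \<subseteq> carrier A}. SUP \<epsilon>\<in>{0<..}.
      limsup (\<lambda>n. log_enat (r (orbit_union \<alpha> \<F> n) \<epsilon>) / ereal (real n)))"

definition ht :: "'a cstar_alg \<Rightarrow> ('a \<Rightarrow> 'a) \<Rightarrow> ereal" where
  "ht A \<alpha> = growth_entropy (rcp A) A \<alpha>"

definition ht_nuc :: "'a cstar_alg \<Rightarrow> ('a \<Rightarrow> 'a) \<Rightarrow> ereal" where
  "ht_nuc A \<alpha> =
    (case dim_nuc A of enat d \<Rightarrow> growth_entropy (r_nuc A d) A \<alpha> | \<infinity> \<Rightarrow> \<infinity>)"

definition ht_dr :: "'a cstar_alg \<Rightarrow> ('a \<Rightarrow> 'a) \<Rightarrow> ereal" where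
  "ht_dr A \<alpha> =
    (case decomposition_rank A of enat d \<Rightarrow> growth_entropy (r_dr A d) A \<alpha> | \<infinity> \<Rightarrow> \<infinity>)"

end

theory Submission
  imports Defs "HOL-Real_Asymp.Real_Asymp"
begin

text \<open>Since \<open>B\<close> is UHF, \<open>A\<close> is the closure of an increasing sequence of matrix subalgebras, the tensor
  products of matrix subalgebras of \<open>B\<close> over finite sets of positions. Their normalised traces extend
  to a tracial state of \<open>A\<close>, and the trace-preserving expectations onto matrix subalgebras are
  completely positive contractions. They yield systems with \<open>d = 0\<close>, so nuclear dimension and
  decomposition rank vanish, all three entropies are ordered, and for \<open>B = M\<^sub>k\<close> they are at most
  \<open>log k\<close>.

  For the lower bound take the \<open>k\<^sup>n\<close> minimal diagonal projections \<open>p\<^sub>v\<close>, indexed by words \<open>v\<close> of length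
  \<open>n\<close>, of a matrix subalgebra of size \<open>k\<close> tensored over \<open>n\<close> positions, and let \<open>\<omega>\<^sub>w\<close> be the state at
  the word \<open>w\<close>. If \<open>\<phi> \<psi>\<close> almost fixes the single-letter projections, the weights \<open>\<omega>\<^sub>w (\<phi> (\<psi> p\<^sub>v))\<close>
  concentrate on words \<open>v\<close> that are close to \<open>w\<close> in the Hamming distance, whereas their sum over
  \<open>v\<close> is bounded through \<open>\<Sum>\<^sub>v \<parallel>\<psi> p\<^sub>v\<parallel> \<le> rank F\<close>. Hence \<open>rank F\<close> is at least \<open>k\<^sup>n\<close> up to a factor of
  small exponential growth.\<close>

section \<open>Calculus in C*-algebras\<close>

text \<open>The maps \<open>\<psi>\<close> and \<open>\<phi>\<close> are controlled on single
  letters only, and errors may accumulate over the n positions, so no single weight can be shown to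
  be close to 1. What survives is an average: about \<open>k * \<epsilon> * n\<close> wrong letters
  at most. This dictates the test function x^d with d the Hamming distance: its sum over all words
  factorises to (1 + (k - 1) x)^n, and convexity bounds its mean from below by x^(2 k \<epsilon> n)
  / 2. With x = \<epsilon> the loss per position tends to 0, because \<epsilon> ln \<epsilon> does.
  The argument asks of both maps only that they are completely positive contractions, so one bound
  for \<open>ht\<close> serves all three entropies. The other obstacle is that positivity means a
  factorisation y* y, without functional calculus. One square root, that of 1 - x for self-adjoint x
  of norm below 1, bounds positive functionals; norms are then recovered from the trace inner
  product. Contractivity of expectations and of unital endomorphisms both come from there.\<close>

context cstar_algebra
begin

lemma cs_smult_closed [simp, intro]: "x \<in> carrier A \<Longrightarrow> c \<odot> x \<in> carrier A"
  using smult_closed[of c x] by simp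

lemma cs_add_closed [simp, intro]:
  "\<lbrakk>x \<in> carrier A; y \<in> carrier A\<rbrakk> \<Longrightarrow> x \<oplus> y \<in> carrier A"
  by (rule M.add.m_closed)

lemma cs_zero_closed [simp, intro]: "\<zero> \<in> carrier A"
  by (rule M.zero_closed)

declare mult_closed [simp, intro] star_closed [simp, intro]

lemma cs_smult_add: "\<lbrakk>x \<in> carrier A; y \<in> carrier A\<rbrakk> \<Longrightarrow> c \<odot> (x \<oplus> y) = c \<odot> x \<oplus> c \<odot> y"
  using smult_r_distr[of c x y] by simp

lemma cs_add_smult: "x \<in> carrier A \<Longrightarrow> (c + d) \<odot> x = c \<odot> x \<oplus> d \<odot> x"
  using smult_l_distr[of c d x] by simp

lemma cs_smult_smult [simp]: "x \<in> carrier A \<Longrightarrow> c \<odot> (d \<odot> x) = (c * d) \<odot> x"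
  using smult_assoc1[of c d x] by simp

lemma cs_smult_one [simp]: "x \<in> carrier A \<Longrightarrow> 1 \<odot> x = x"
  using smult_one[of x] by simp

lemma cs_smult_zero [simp]: "c \<odot> \<zero> = \<zero>"
  using smult_r_null[of c] by simp

lemma cs_zero_smult [simp]: "x \<in> carrier A \<Longrightarrow> 0 \<odot> x = \<zero>"
  using smult_l_null[of x] by simp

lemma cs_minus_one: "x \<in> carrier A \<Longrightarrow> \<ominus> x = (-1) \<odot> x"
  using smult_l_minus[of 1 x] by (simp add: class_ring_simps)

lemma cs_minus: "\<lbrakk>x \<in> carrier A; y \<in> carrier A\<rbrakk> \<Longrightarrow> x \<ominus> y = x \<oplus> (-1) \<odot> y"
  by (simp add: a_minus_def cs_minus_one)

lemma cs_inv_closed [simp, intro]: "x \<in> carrier A \<Longrightarrow> \<ominus> x \<in> carrier A"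
  by (rule M.a_inv_closed)

lemma cs_minus_closed [simp, intro]:
  "\<lbrakk>x \<in> carrier A; y \<in> carrier A\<rbrakk> \<Longrightarrow> x \<ominus> y \<in> carrier A"
  by (rule M.minus_closed)

lemmas cs_ac = M.a_assoc M.a_comm M.a_lcomm

lemma cs_smult_eq_0: "\<lbrakk>c \<odot> x = \<zero>; x \<in> carrier A\<rbrakk> \<Longrightarrow> c = 0 \<or> x = \<zero>"
  by (metis cs_smult_smult cs_smult_one cs_smult_zero left_inverse)

lemma cs_smult_cancel: "\<lbrakk>c \<odot> x = d \<odot> x; x \<in> carrier A; x \<noteq> \<zero>\<rbrakk> \<Longrightarrow> c = d"
proof -
  assume a: "c \<odot> x = d \<odot> x" "x \<in> carrier A" "x \<noteq> \<zero>"
  have "(c - d) \<odot> x = c \<odot> x \<oplus> (- d) \<odot> x"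
    using cs_add_smult[of x c "-d"] a by simp
  also have "\<dots> = d \<odot> x \<oplus> (- d) \<odot> x"
    by (simp add: a)
  also have "\<dots> = \<zero>"
    using cs_add_smult[of x d "-d"] a by simp
  finally show "c = d"
    using cs_smult_eq_0 a by force
qed

lemma cs_mult_zero [simp]: "x \<in> carrier A \<Longrightarrow> x \<otimes> \<zero> = \<zero>"
  using smult_mult_right[of x x 0] by simp

lemma cs_zero_mult [simp]: "x \<in> carrier A \<Longrightarrow> \<zero> \<otimes> x = \<zero>"
  using smult_mult_left[of x x 0] by simp

lemma star_zero [simp]: "star A \<zero> = \<zero>"
  using star_smult[of \<zero> 0] by simp

lemma cs_minus_mult:
  "\<lbrakk>x \<in> carrier A; y \<in> carrier A; z \<in> carrier A\<rbrakk> \<Longrightarrow> (x \<ominus> y) \<otimes> z = x \<otimes> z \<ominus> y \<otimes> z"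
  by (simp add: cs_minus mult_add_left smult_mult_left)

lemma cs_mult_minus:
  "\<lbrakk>x \<in> carrier A; y \<in> carrier A; z \<in> carrier A\<rbrakk> \<Longrightarrow> z \<otimes> (x \<ominus> y) = z \<otimes> x \<ominus> z \<otimes> y"
  by (simp add: cs_minus mult_add_right smult_mult_right)

lemma star_minus:
  "\<lbrakk>x \<in> carrier A; y \<in> carrier A\<rbrakk> \<Longrightarrow> star A (x \<ominus> y) = star A x \<ominus> star A y"
  by (simp add: cs_minus star_add star_smult)

lemma cs_minus_self [simp]: "x \<in> carrier A \<Longrightarrow> x \<ominus> x = \<zero>"
  by (simp add: a_minus_def M.r_neg)

lemma cs_add_minus_cancel [simp]:
  "\<lbrakk>x \<in> carrier A; y \<in> carrier A\<rbrakk> \<Longrightarrow> y \<oplus> (x \<ominus> y) = x"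
  by (metis M.add.inv_closed M.add.m_assoc M.add.m_comm M.l_neg M.r_zero a_minus_def)

lemma cs_minus_eq_0: "\<lbrakk>x \<ominus> y = \<zero>; x \<in> carrier A; y \<in> carrier A\<rbrakk> \<Longrightarrow> x = y"
  by (metis cs_add_minus_cancel M.r_zero)

lemma cs_minus_add_minus:
  assumes "x \<in> carrier A" "y \<in> carrier A" "z \<in> carrier A"
  shows "(x \<ominus> y) \<oplus> (y \<ominus> z) = x \<ominus> z"
proof -
  have "(x \<ominus> y) \<oplus> (y \<ominus> z) = x \<oplus> ((\<ominus> y \<oplus> y) \<oplus> \<ominus> z)"
    using assms by (simp add: a_minus_def M.a_assoc)
  thus ?thesis
    using assms by (simp add: M.l_neg a_minus_def)
qed

lemma cs_add_minus_add:
  assumes "x \<in> carrier A" "y \<in> carrier A" "z \<in> carrier A" "w \<in> carrier A"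
  shows "(x \<oplus> y) \<ominus> (z \<oplus> w) = (x \<ominus> z) \<oplus> (y \<ominus> w)"
  using assms by (simp add: cs_minus cs_smult_add cs_ac)

lemma cs_smult_minus:
  "\<lbrakk>x \<in> carrier A; y \<in> carrier A\<rbrakk> \<Longrightarrow> c \<odot> (x \<ominus> y) = c \<odot> x \<ominus> c \<odot> y"
  by (simp add: cs_minus cs_smult_add)

lemma cs_finsum_closed: "(\<And>i. i \<in> I \<Longrightarrow> f i \<in> carrier A) \<Longrightarrow> (\<Oplus>i\<in>I. f i) \<in> carrier A"
  by (rule M.finsum_closed) auto

lemma cs_finsum_insert:
  "\<lbrakk>finite I; j \<notin> I; \<And>i. i \<in> I \<Longrightarrow> f i \<in> carrier A; f j \<in> carrier A\<rbrakk>
    \<Longrightarrow> (\<Oplus>i\<in>insert j I. f i) = f j \<oplus> (\<Oplus>i\<in>I. f i)"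
  by (rule M.finsum_insert) auto

lemma cs_finsum_cong:
  "\<lbrakk>\<And>i. i \<in> I \<Longrightarrow> f i = g i; \<And>i. i \<in> I \<Longrightarrow> g i \<in> carrier A\<rbrakk>
    \<Longrightarrow> (\<Oplus>i\<in>I. f i) = (\<Oplus>i\<in>I. g i)"
  by (rule M.finsum_cong') auto

lemma cs_finsum_zero: "(\<And>i. i \<in> I \<Longrightarrow> f i = \<zero>) \<Longrightarrow> (\<Oplus>i\<in>I. f i) = \<zero>"
proof -
  assume "\<And>i. i \<in> I \<Longrightarrow> f i = \<zero>"
  hence "(\<Oplus>i\<in>I. f i) = (\<Oplus>i\<in>I. \<zero>)"
    by (intro cs_finsum_cong) auto
  thus ?thesis
    by (simp add: M.finsum_zero)
qed

lemma cs_finsum_single: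
  assumes "finite I" "j \<in> I" "f j \<in> carrier A" "\<And>i. \<lbrakk>i \<in> I; i \<noteq> j\<rbrakk> \<Longrightarrow> f i = \<zero>"
  shows "(\<Oplus>i\<in>I. f i) = f j"
proof -
  have I: "I = insert j (I - {j})" "finite (I - {j})" "j \<notin> I - {j}"
    using assms by auto
  have "(\<Oplus>i\<in>I. f i) = f j \<oplus> (\<Oplus>i\<in>I - {j}. f i)"
    by (subst I(1), rule cs_finsum_insert) (use assms in auto)
  also have "(\<Oplus>i\<in>I - {j}. f i) = \<zero>"
    using assms by (intro cs_finsum_zero) auto
  finally show ?thesis
    using assms by simp
qed

lemma additive_finsum:
  assumes "finite I" "\<And>i. i \<in> I \<Longrightarrow> f i \<in> carrier A"
    and "g \<zero> = (0 :: 'z :: comm_monoid_add)"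
    and "\<And>x y. \<lbrakk>x \<in> carrier A; y \<in> carrier A\<rbrakk> \<Longrightarrow> g (x \<oplus> y) = g x + g y"
  shows "g (\<Oplus>i\<in>I. f i) = (\<Sum>i\<in>I. g (f i))"
  using assms(1,2)
proof (induction I rule: finite_induct)
  case (insert j I)
  have "(\<Oplus>i\<in>insert j I. f i) = f j \<oplus> (\<Oplus>i\<in>I. f i)"
    using insert by (intro cs_finsum_insert) auto
  thus ?case
    using insert assms by (simp add: cs_finsum_closed)
qed (simp add: assms)

text \<open>Asking for additivity alone lets one induction serve left and right multiplication, the
  conjugate-linear star and maps into another algebra.\<close>

lemma finsum_additive:
  assumes "cstar_algebra B" "finite I" "\<And>i. i \<in> I \<Longrightarrow> f i \<in> carrier A"
    and "\<And>x. x \<in> carrier A \<Longrightarrow> g x \<in> carrier B"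
    and "g \<zero> = \<zero>\<^bsub>B\<^esub>"
    and "\<And>x y. \<lbrakk>x \<in> carrier A; y \<in> carrier A\<rbrakk> \<Longrightarrow> g (x \<oplus> y) = g x \<oplus>\<^bsub>B\<^esub> g y"
  shows "g (\<Oplus>i\<in>I. f i) = (\<Oplus>\<^bsub>B\<^esub>i\<in>I. g (f i))"
proof -
  interpret B: cstar_algebra B by fact
  show ?thesis
    using assms(2,3)
  proof (induction I rule: finite_induct)
    case (insert j I)
    have "(\<Oplus>i\<in>insert j I. f i) = f j \<oplus> (\<Oplus>i\<in>I. f i)"
      using insert by (intro cs_finsum_insert) auto
    moreover have "(\<Oplus>\<^bsub>B\<^esub>i\<in>insert j I. g (f i)) = g (f j) \<oplus>\<^bsub>B\<^esub> (\<Oplus>\<^bsub>B\<^esub>i\<in>I. g (f i))"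
      using insert assms by (intro B.cs_finsum_insert) auto
    ultimately show ?case
      using insert assms by (simp add: cs_finsum_closed)
  qed (simp add: assms)
qed

lemma mult_finsum:
  assumes "finite I" "\<And>i. i \<in> I \<Longrightarrow> f i \<in> carrier A" "x \<in> carrier A"
  shows "x \<otimes> (\<Oplus>i\<in>I. f i) = (\<Oplus>i\<in>I. x \<otimes> f i)"
  using assms by (intro finsum_additive[OF cstar_algebra_axioms]) (auto simp: mult_add_right)

lemma finsum_mult:
  assumes "finite I" "\<And>i. i \<in> I \<Longrightarrow> f i \<in> carrier A" "x \<in> carrier A"
  shows "(\<Oplus>i\<in>I. f i) \<otimes> x = (\<Oplus>i\<in>I. f i \<otimes> x)"
  using assms
  by (intro finsum_additive[OF cstar_algebra_axioms, where g = "\<lambda>y. y \<otimes> x"]) (auto simp: mult_add_left)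

lemma star_finsum:
  assumes "finite I" "\<And>i. i \<in> I \<Longrightarrow> f i \<in> carrier A"
  shows "star A (\<Oplus>i\<in>I. f i) = (\<Oplus>i\<in>I. star A (f i))"
  using assms by (intro finsum_additive[OF cstar_algebra_axioms]) (auto simp: star_add)

lemma nrm_zero [simp]: "nrm A \<zero> = 0"
  by (simp add: nrm_eq_0_iff)

lemma nrm_finsum:
  assumes "finite I" "\<And>i. i \<in> I \<Longrightarrow> f i \<in> carrier A"
  shows "nrm A (\<Oplus>i\<in>I. f i) \<le> (\<Sum>i\<in>I. nrm A (f i))"
  using assms
proof (induction I rule: finite_induct)
  case (insert j I)
  have "(\<Oplus>i\<in>insert j I. f i) = f j \<oplus> (\<Oplus>i\<in>I. f i)"
    using insert by (intro cs_finsum_insert) auto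
  also have "nrm A \<dots> \<le> nrm A (f j) + nrm A (\<Oplus>i\<in>I. f i)"
    using insert by (intro nrm_triangle cs_finsum_closed) auto
  finally show ?case
    using insert by simp
qed simp

lemma nrm_star [simp]: "x \<in> carrier A \<Longrightarrow> nrm A (star A x) = nrm A x"
proof -
  have *: "nrm A y \<le> nrm A (star A y)" if "y \<in> carrier A" for y
  proof (cases "nrm A y = 0")
    case False
    have "(nrm A y)\<^sup>2 \<le> nrm A (star A y) * nrm A y"
      using cstar_identity[of y] nrm_mult[of "star A y" y] that by simp
    thus ?thesis
      using False nrm_nonneg[of y] that by (simp add: power2_eq_square)
  qed (use that nrm_nonneg[of "star A y"] in simp)
  assume "x \<in> carrier A"
  thus ?thesis
    using *[of x] *[of "star A x"] by (simp add: star_star)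
qed

lemma nrm_mult_star: "x \<in> carrier A \<Longrightarrow> nrm A (x \<otimes> star A x) = (nrm A x)\<^sup>2"
  using cstar_identity[of "star A x"] by (simp add: star_star)

lemma star_mult_self_eq_0: "\<lbrakk>x \<in> carrier A; star A x \<otimes> x = \<zero>\<rbrakk> \<Longrightarrow> x = \<zero>"
  using cstar_identity[of x] by (simp add: nrm_eq_0_iff)

lemma nrm_minus_commute:
  assumes "x \<in> carrier A" "y \<in> carrier A"
  shows "nrm A (x \<ominus> y) = nrm A (y \<ominus> x)"
proof -
  have "x \<ominus> y = (-1) \<odot> (y \<ominus> x)"
    using assms by (simp add: cs_minus cs_smult_add cs_ac)
  thus ?thesis
    using assms by (simp add: nrm_smult)
qed

lemma nrm_minus_triangle:
  assumes "x \<in> carrier A" "y \<in> carrier A" "z \<in> carrier A"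
  shows "nrm A (x \<ominus> z) \<le> nrm A (x \<ominus> y) + nrm A (y \<ominus> z)"
  using nrm_triangle[of "x \<ominus> y" "y \<ominus> z"] assms by (simp add: cs_minus_add_minus)

lemma nrm_le_minus:
  assumes "x \<in> carrier A" "y \<in> carrier A"
  shows "nrm A x \<le> nrm A y + nrm A (x \<ominus> y)"
  using nrm_triangle[of y "x \<ominus> y"] assms by simp

lemma nrm_minus_le:
  assumes "x \<in> carrier A" "y \<in> carrier A"
  shows "nrm A (x \<ominus> y) \<le> nrm A x + nrm A y"
  using nrm_triangle[of x "(-1) \<odot> y"] assms by (simp add: cs_minus nrm_smult)

lemma mult_minus_mult:
  assumes "x \<in> carrier A" "y \<in> carrier A" "x' \<in> carrier A" "y' \<in> carrier A"
  shows "x \<otimes> y \<ominus> x' \<otimes> y' = (x \<ominus> x') \<otimes> y \<oplus> x' \<otimes> (y \<ominus> y')"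
  using assms by (simp add: cs_minus_mult cs_mult_minus cs_minus_add_minus)

lemma nrm_mult_minus_mult:
  assumes "x \<in> carrier A" "y \<in> carrier A" "x' \<in> carrier A" "y' \<in> carrier A"
  shows "nrm A (x \<otimes> y \<ominus> x' \<otimes> y') \<le> nrm A (x \<ominus> x') * nrm A y + nrm A x' * nrm A (y \<ominus> y')"
proof -
  have "nrm A (x \<otimes> y \<ominus> x' \<otimes> y')
      \<le> nrm A ((x \<ominus> x') \<otimes> y) + nrm A (x' \<otimes> (y \<ominus> y'))"
    using assms by (simp add: mult_minus_mult nrm_triangle)
  also have "\<dots> \<le> nrm A (x \<ominus> x') * nrm A y + nrm A x' * nrm A (y \<ominus> y')"
    using assms by (intro add_mono nrm_mult) auto
  finally show ?thesis .
qed

section \<open>The metric, limits and norms of powers\<close>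

sublocale metric: Metric_space "carrier A" "cstar_dist A"
proof
  fix x y show "0 \<le> cstar_dist A x y" "cstar_dist A x y = cstar_dist A y x"
    by (auto simp: cstar_dist_def nrm_nonneg nrm_minus_commute)
next
  fix x y assume "x \<in> carrier A" "y \<in> carrier A"
  thus "cstar_dist A x y = 0 \<longleftrightarrow> x = y"
    using cs_minus_eq_0 by (auto simp: cstar_dist_def nrm_eq_0_iff)
next
  fix x y z assume "x \<in> carrier A" "y \<in> carrier A" "z \<in> carrier A"
  thus "cstar_dist A x z \<le> cstar_dist A x y + cstar_dist A y z"
    by (simp add: cstar_dist_def nrm_minus_triangle)
qed

text \<open>Completeness is restated through norms of differences, so that later limit arguments
  avoid the metric topology.\<close>

lemma Cauchy_limit:
  assumes "\<And>n. f n \<in> carrier A"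
    and "\<And>e. e > 0 \<Longrightarrow> \<exists>N. \<forall>m\<ge>N. \<forall>n\<ge>N. nrm A (f m \<ominus> f n) < e"
  obtains x where "x \<in> carrier A" "(\<lambda>n. nrm A (f n \<ominus> x)) \<longlonglongrightarrow> 0"
proof -
  have "metric.MCauchy f"
    unfolding metric.MCauchy_def using assms
    by (auto simp: cstar_dist_def)
  then obtain x where x: "limitin metric.mtopology f x sequentially"
    using complete by (auto simp: metric.mcomplete_def)
  hence "x \<in> carrier A" "((\<lambda>n. cstar_dist A (f n) x) \<longlonglongrightarrow> 0)"
    by (auto simp: metric.limitin_metric_dist_null)
  moreover from this have "cstar_dist A (f n) x = nrm A (f n \<ominus> x)" for n
    using assms by (simp add: cstar_dist_def)
  ultimately show ?thesis
    using that by simp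
qed

lemma limit_unique:
  assumes "\<And>n. f n \<in> carrier A" "x \<in> carrier A" "y \<in> carrier A"
    and "(\<lambda>n. nrm A (f n \<ominus> x)) \<longlonglongrightarrow> 0" "(\<lambda>n. nrm A (f n \<ominus> y)) \<longlonglongrightarrow> 0"
  shows "x = y"
proof -
  have "(\<lambda>n. nrm A (f n \<ominus> x) + nrm A (f n \<ominus> y)) \<longlonglongrightarrow> 0 + 0"
    by (intro tendsto_add assms)
  moreover have "nrm A (x \<ominus> y) \<le> nrm A (f n \<ominus> x) + nrm A (f n \<ominus> y)" for n
    using nrm_minus_triangle[of x "f n" y] nrm_minus_commute[of x "f n"] assms by simp
  ultimately have "nrm A (x \<ominus> y) \<le> 0"
    by (intro LIMSEQ_le_const) auto
  hence "nrm A (x \<ominus> y) = 0"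
    using assms nrm_nonneg[of "x \<ominus> y"] by simp
  thus ?thesis
    using assms by (auto intro!: cs_minus_eq_0[OF nrm_eq_0_iff[THEN iffD1]])
qed

lemma cs_closure_iff:
  "x \<in> cstar_topology A closure_of S \<longleftrightarrow>
    x \<in> carrier A \<and> (\<forall>e>0. \<exists>y\<in>S. y \<in> carrier A \<and> nrm A (x \<ominus> y) < e)"
proof -
  have "y \<in> metric.mball x r \<longleftrightarrow> x \<in> carrier A \<and> y \<in> carrier A \<and> nrm A (x \<ominus> y) < r" for y r
    by (auto simp: cstar_dist_def metric.in_mball)
  thus ?thesis
    unfolding cstar_topology_def metric.metric_closure_of by blast
qed

text \<open>For self-adjoint \<open>h\<close> the C*-identity gives \<open>\<parallel>h\<^sup>m\<parallel> = \<parallel>h\<parallel>\<^sup>m\<close> with \<open>m = 2\<^sup>n\<close>; the norm of \<open>h\<close>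
  is therefore determined by the growth of these powers.\<close>

primrec dyadic_pow :: "'a \<Rightarrow> nat \<Rightarrow> 'a" where
  "dyadic_pow h 0 = h"
| "dyadic_pow h (Suc n) = dyadic_pow h n \<otimes> dyadic_pow h n"

lemma dyadic_pow_closed [simp, intro]: "h \<in> carrier A \<Longrightarrow> dyadic_pow h n \<in> carrier A"
  by (induction n) auto

lemma dyadic_pow_star:
  "\<lbrakk>h \<in> carrier A; star A h = h\<rbrakk> \<Longrightarrow> star A (dyadic_pow h n) = dyadic_pow h n"
  by (induction n) (auto simp: star_mult)

lemma nrm_dyadic_pow:
  "\<lbrakk>h \<in> carrier A; star A h = h\<rbrakk> \<Longrightarrow> nrm A (dyadic_pow h n) = nrm A h ^ (2 ^ n)"
proof (induction n)
  case (Suc n)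
  have "nrm A (dyadic_pow h n \<otimes> dyadic_pow h n)
      = nrm A (star A (dyadic_pow h n) \<otimes> dyadic_pow h n)"
    using Suc by (simp add: dyadic_pow_star)
  also have "\<dots> = (nrm A (dyadic_pow h n))\<^sup>2"
    using Suc by (intro cstar_identity) auto
  finally show ?case
    using Suc by (simp add: power_mult[symmetric] mult.commute)
qed simp

end

text \<open>If y < x, then (y / x)^(2^n) tends to 0 and no constant \<open>C\<close> can compensate.
  This is how a dimension-dependent constant is removed from a comparison of norms.\<close>

lemma le_if_dyadic_powers_le:
  fixes x y C :: real
  assumes "0 \<le> x" "0 \<le> y" and le: "\<And>n::nat. x ^ (2 ^ n) \<le> C * y ^ (2 ^ n)"
  shows "x \<le> y"
proof (rule ccontr)
  assume "\<not> x \<le> y"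
  hence xy: "y < x" by simp
  have x0: "x > 0" using xy assms by simp
  define r where "r = y / x"
  have r: "0 \<le> r" "r < 1"
    using xy x0 assms by (auto simp: r_def)
  have bound: "1 \<le> C * r ^ (2 ^ n)" for n :: nat
    using le[of n] x0 by (simp add: r_def power_divide field_simps)
  have "strict_mono (\<lambda>n::nat. (2::nat) ^ n)"
    by (intro strict_monoI power_strict_increasing) auto
  hence "(\<lambda>n. r ^ (2 ^ n)) \<longlonglongrightarrow> 0"
    using LIMSEQ_subseq_LIMSEQ[OF LIMSEQ_realpow_zero[OF r]] by (simp add: comp_def)
  hence "(\<lambda>n. C * r ^ (2 ^ n)) \<longlonglongrightarrow> C * 0"
    by (intro tendsto_intros)
  hence "1 \<le> C * (0::real)"
    using bound by (intro LIMSEQ_le_const) auto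
  thus False by simp
qed

section \<open>Subalgebras\<close>

context cstar_algebra
begin

lemma subspace_vectorspace:
  assumes "S \<subseteq> carrier A" "\<zero> \<in> S"
    and add: "\<And>x y. \<lbrakk>x \<in> S; y \<in> S\<rbrakk> \<Longrightarrow> x \<oplus> y \<in> S"
    and smult: "\<And>c x. x \<in> S \<Longrightarrow> c \<odot> x \<in> S"
  shows "vectorspace complex_field (A\<lparr>carrier := S\<rparr>)"
proof -
  have S: "x \<in> carrier A" if "x \<in> S" for x
    using assms that by auto
  show ?thesis
  proof (rule vs_criteria, goal_cases)
    case 1
    show ?case by (rule class_field)
  next
    case 4
    have "x \<oplus> (-1) \<odot> x = \<zero>" if "x \<in> S" for x
      using cs_minus[of x x] S that by simp
    thus ?case using smult by force
  next
    case 6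
    show ?case using S by (auto intro: M.a_comm)
  qed (simp_all add: add smult S M.a_assoc cs_smult_add cs_add_smult \<open>\<zero> \<in> S\<close>)
qed

lemma cstar_subalgebraI:
  assumes "S \<subseteq> carrier A" "\<zero> \<in> S"
    and add: "\<And>x y. \<lbrakk>x \<in> S; y \<in> S\<rbrakk> \<Longrightarrow> x \<oplus> y \<in> S"
    and smult: "\<And>c x. x \<in> S \<Longrightarrow> c \<odot> x \<in> S"
    and mult: "\<And>x y. \<lbrakk>x \<in> S; y \<in> S\<rbrakk> \<Longrightarrow> x \<otimes> y \<in> S"
    and star: "\<And>x. x \<in> S \<Longrightarrow> star A x \<in> S"
    and lim: "\<And>f x. \<lbrakk>\<And>n. f n \<in> S; x \<in> carrier A; (\<lambda>n. nrm A (f n \<ominus> x)) \<longlonglongrightarrow> 0\<rbrakk> \<Longrightarrow> x \<in> S"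
  shows "cstar_subalgebra S A"
proof -
  let ?S = "A\<lparr>carrier := S\<rparr>"
  have S [simp, intro]: "x \<in> carrier A" if "x \<in> S" for x
    using assms that by auto
  interpret S: vectorspace complex_field ?S
    using assms by (intro subspace_vectorspace)
  \<comment> \<open>The additive inverse is taken relative to the carrier, so the two subtractions
    agree only after both are written with the scalar -1.\<close>
  have minus: "x \<ominus>\<^bsub>?S\<^esub> y = x \<ominus> y" if "x \<in> S" "y \<in> S" for x y
  proof -
    have "\<ominus>\<^bsub>?S\<^esub> y = (-1) \<odot> y"
      using S.smult_l_minus[of 1 y] S.smult_one[of y] that by (simp add: class_ring_simps)
    thus ?thesis
      using that by (simp add: a_minus_def cs_minus_one)
  qed
  have dist: "cstar_dist ?S x y = nrm A (x \<ominus> y)" if "x \<in> S" "y \<in> S" for x y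
    using that by (simp add: cstar_dist_def minus)
  have M: "Metric_space S (cstar_dist ?S)"
    by unfold_locales
      (use S in \<open>auto simp: dist cstar_dist_def nrm_nonneg minus nrm_minus_commute nrm_minus_triangle
         nrm_eq_0_iff dest: cs_minus_eq_0\<close>)
  have "Metric_space.mcomplete S (cstar_dist ?S)"
    unfolding Metric_space.mcomplete_def[OF M]
  proof (intro allI impI)
    fix f assume "Metric_space.MCauchy S (cstar_dist ?S) f"
    hence f: "\<And>n. f n \<in> S"
      and c: "\<And>e. e > 0 \<Longrightarrow> \<exists>N. \<forall>m n. N \<le> m \<longrightarrow> N \<le> n \<longrightarrow> cstar_dist ?S (f m) (f n) < e"
      unfolding Metric_space.MCauchy_def[OF M] by auto
    have "\<exists>N. \<forall>m\<ge>N. \<forall>n\<ge>N. nrm A (f m \<ominus> f n) < e" if "e > 0" for e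
      using c[OF that] f by (simp add: dist)
    then obtain x where x: "x \<in> carrier A" "(\<lambda>n. nrm A (f n \<ominus> x)) \<longlonglongrightarrow> 0"
      using Cauchy_limit[of f] f S by blast
    hence "x \<in> S"
      using lim f by blast
    hence "limitin (Metric_space.mtopology S (cstar_dist ?S)) f x sequentially"
      using x f by (simp add: Metric_space.limitin_metric_dist_null[OF M] dist)
    thus "\<exists>x. limitin (Metric_space.mtopology S (cstar_dist ?S)) f x sequentially" ..
  qed
  hence c: "Metric_space.mcomplete (carrier ?S) (cstar_dist ?S)"
    by simp
  have "cstar_algebra_axioms ?S"
    by (rule cstar_algebra_axioms.intro; (rule c)?;
      simp add: mult star mult_assoc mult_add_left mult_add_right smult_mult_left
        smult_mult_right star_star star_add star_smult star_mult nrm_nonneg nrm_eq_0_iff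
        nrm_triangle nrm_smult nrm_mult cstar_identity)
  thus ?thesis
    using assms(1) S.vectorspace_axioms by (simp add: cstar_subalgebra_def cstar_algebra_def)
qed

lemma cstar_subalgebraD:
  assumes "cstar_subalgebra S A"
  shows "S \<subseteq> carrier A" "\<zero> \<in> S"
    and "\<And>x y. \<lbrakk>x \<in> S; y \<in> S\<rbrakk> \<Longrightarrow> x \<oplus> y \<in> S"
    and "\<And>c x. x \<in> S \<Longrightarrow> c \<odot> x \<in> S"
    and "\<And>x y. \<lbrakk>x \<in> S; y \<in> S\<rbrakk> \<Longrightarrow> x \<otimes> y \<in> S"
    and "\<And>x. x \<in> S \<Longrightarrow> star A x \<in> S"
    and "\<And>x y. \<lbrakk>x \<in> S; y \<in> S\<rbrakk> \<Longrightarrow> x \<ominus> y \<in> S"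
    and "\<And>f x. \<lbrakk>\<And>n. f n \<in> S; x \<in> carrier A; (\<lambda>n. nrm A (f n \<ominus> x)) \<longlonglongrightarrow> 0\<rbrakk> \<Longrightarrow> x \<in> S"
proof -
  let ?S = "A\<lparr>carrier := S\<rparr>"
  interpret S: cstar_algebra ?S
    using assms by (simp add: cstar_subalgebra_def)
  show sub: "S \<subseteq> carrier A"
    using assms by (simp add: cstar_subalgebra_def)
  show "\<zero> \<in> S" using S.cs_zero_closed by simp
  show add: "x \<oplus> y \<in> S" if "x \<in> S" "y \<in> S" for x y using S.cs_add_closed that by simp
  show smult: "c \<odot> x \<in> S" if "x \<in> S" for c x using S.cs_smult_closed that by simp
  show "x \<otimes> y \<in> S" if "x \<in> S" "y \<in> S" for x y using S.mult_closed that by simp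
  show "star A x \<in> S" if "x \<in> S" for x using S.star_closed that by simp
  show "x \<ominus> y \<in> S" if "x \<in> S" "y \<in> S" for x y
    using add[OF that(1) smult[OF that(2), of "-1"]] cs_minus[of x y] that sub by (simp add: subset_iff)
  have minus: "x \<ominus>\<^bsub>?S\<^esub> y = x \<ominus> y" if "x \<in> S" "y \<in> S" for x y
    using S.cs_minus[of x y] cs_minus[OF subsetD[OF sub that(1)] subsetD[OF sub that(2)]] that
    by simp
  fix f x assume f: "\<And>n. f n \<in> S" and x: "x \<in> carrier A" "(\<lambda>n. nrm A (f n \<ominus> x)) \<longlonglongrightarrow> 0"
  have fA: "f n \<in> carrier A" for n using f sub by auto
  have "\<exists>N. \<forall>m\<ge>N. \<forall>n\<ge>N. nrm ?S (f m \<ominus>\<^bsub>?S\<^esub> f n) < e" if "e > 0" for e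
  proof -
    have "\<forall>\<^sub>F n in sequentially. nrm A (f n \<ominus> x) < e / 2"
      using x(2) that by (intro order_tendstoD(2)[of _ 0]) auto
    then obtain N where N: "\<And>n. n \<ge> N \<Longrightarrow> nrm A (f n \<ominus> x) < e / 2"
      by (auto simp: eventually_sequentially)
    have "nrm A (f m \<ominus> f n) < e" if "m \<ge> N" "n \<ge> N" for m n
      using nrm_minus_triangle[of "f m" x "f n"] N[OF that(1)] N[OF that(2)] fA x
        nrm_minus_commute[of "f n" x] by simp
    thus ?thesis
      using f by (auto simp: minus)
  qed
  then obtain y where y: "y \<in> S" "(\<lambda>n. nrm A (f n \<ominus> y)) \<longlonglongrightarrow> 0"
    using S.Cauchy_limit[of f] f by (auto simp: minus) blast
  have "x = y"
    by (rule limit_unique[of f]) (use fA x y sub in auto)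
  thus "x \<in> S" using y by simp
qed

text \<open>\<open>finsum\<close> refers to the carrier, so passing to a subalgebra changes the
  term, though not its value.\<close>

lemma finsum_subalgebra:
  assumes "cstar_subalgebra S A" "finite I" "\<And>i. i \<in> I \<Longrightarrow> f i \<in> S"
  shows "(\<Oplus>\<^bsub>A\<lparr>carrier := S\<rparr>\<^esub>i\<in>I. f i) = (\<Oplus>i\<in>I. f i)"
proof -
  interpret S: cstar_algebra "A\<lparr>carrier := S\<rparr>"
    using assms by (simp add: cstar_subalgebra_def)
  note sub = cstar_subalgebraD(1)[OF assms(1)]
  show ?thesis
    by (rule S.finsum_additive[where g = "\<lambda>x. x", OF cstar_algebra_axioms])
      (use assms sub in auto)
qed

end

section \<open>Square roots and positive functionals\<close>

locale unital_cstar_algebra = cstar_algebra +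
  assumes one_closed [simp, intro]: "\<one> \<in> carrier A"
    and one_mult [simp]: "x \<in> carrier A \<Longrightarrow> \<one> \<otimes> x = x"
    and mult_one [simp]: "x \<in> carrier A \<Longrightarrow> x \<otimes> \<one> = x"

lemma unital_cstar_algebra_iff: "unital_cstar_algebra A \<longleftrightarrow> cstar_unital A"
  by (auto simp: unital_cstar_algebra_def unital_cstar_algebra_axioms_def cstar_unital_def)

definition linear_functional :: "'a cstar_alg \<Rightarrow> ('a \<Rightarrow> complex) \<Rightarrow> bool" where
  "linear_functional A f \<longleftrightarrow>
    (\<forall>x\<in>carrier A. \<forall>y\<in>carrier A. f (x \<oplus>\<^bsub>A\<^esub> y) = f x + f y) \<and>
    (\<forall>c. \<forall>x\<in>carrier A. f (c \<odot>\<^bsub>A\<^esub> x) = c * f x)"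

context cstar_algebra
begin

lemma linear_functionalD:
  assumes "linear_functional A f"
  shows "\<And>x y. \<lbrakk>x \<in> carrier A; y \<in> carrier A\<rbrakk> \<Longrightarrow> f (x \<oplus> y) = f x + f y"
    and "\<And>c x. x \<in> carrier A \<Longrightarrow> f (c \<odot> x) = c * f x"
    and "f \<zero> = 0"
    and "\<And>x y. \<lbrakk>x \<in> carrier A; y \<in> carrier A\<rbrakk> \<Longrightarrow> f (x \<ominus> y) = f x - f y"
    and "\<And>I g. \<lbrakk>finite I; \<And>i. i \<in> I \<Longrightarrow> g i \<in> carrier A\<rbrakk>
      \<Longrightarrow> f (\<Oplus>i\<in>I. g i) = (\<Sum>i\<in>I. f (g i))"
proof -
  show add: "f (x \<oplus> y) = f x + f y" if "x \<in> carrier A" "y \<in> carrier A" for x y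
    using assms that by (simp add: linear_functional_def)
  show smult: "f (c \<odot> x) = c * f x" if "x \<in> carrier A" for c x
    using assms that by (simp add: linear_functional_def)
  show z: "f \<zero> = 0" using smult[of \<zero> 0] by simp
  show "f (x \<ominus> y) = f x - f y" if "x \<in> carrier A" "y \<in> carrier A" for x y
    using that by (simp add: cs_minus add smult)
  show "f (\<Oplus>i\<in>I. g i) = (\<Sum>i\<in>I. f (g i))"
    if "finite I" "\<And>i. i \<in> I \<Longrightarrow> g i \<in> carrier A" for I g
    by (rule additive_finsum) (use that z add in auto)
qed

end

context unital_cstar_algebra
begin

lemma star_one [simp]: "star A \<one> = \<one>"
  by (metis mult_one one_closed one_mult star_closed star_mult star_star)

lemma nrm_one:
  assumes "\<one> \<noteq> \<zero>"
  shows "nrm A \<one> = 1"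
proof -
  have "(nrm A \<one>)\<^sup>2 = nrm A \<one>"
    using cstar_identity[of \<one>] by simp
  moreover have "nrm A \<one> \<noteq> 0"
    using assms by (simp add: nrm_eq_0_iff)
  ultimately show ?thesis by (simp add: power2_eq_square)
qed

text \<open>With \<open>z = (x + z\<^sup>2) / 2\<close>, the fixed point of a contraction, \<open>(1 - z)\<^sup>2 = 1 - x\<close>.\<close>

lemma sqrt_one_minus:
  assumes x: "x \<in> carrier A" "star A x = x" "nrm A x < 1"
  obtains y where "y \<in> carrier A" "star A y = y" "y \<otimes> y = \<one> \<ominus> x"
proof -
  \<comment> \<open>The smaller root of r = (||x|| + r^2) / 2: the ball of radius r is invariant
    under \<open>T\<close>, and r is also a Lipschitz constant there.\<close>
  define r where "r = 1 - sqrt (1 - nrm A x)"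
  have r: "0 \<le> r" "r < 1" "(nrm A x + r\<^sup>2) / 2 = r"
    using x nrm_nonneg[of x] by (auto simp: r_def power2_diff field_simps)
  define T where "T = (\<lambda>z. (1/2) \<odot> (x \<oplus> z \<otimes> z))"
  define z where "z = (\<lambda>n. (T ^^ n) \<zero>)"
  have T [simp, intro]: "T y \<in> carrier A" if "y \<in> carrier A" for y
    using that x by (simp add: T_def)
  have star_T: "star A (T y) = T y" if "y \<in> carrier A" "star A y = y" for y
    using that x by (simp add: T_def star_smult star_add star_mult)
  have nrm_T: "nrm A (T y) \<le> r" if "y \<in> carrier A" "nrm A y \<le> r" for y
  proof -
    have "nrm A (x \<oplus> y \<otimes> y) \<le> nrm A x + nrm A y * nrm A y"
      using nrm_triangle[of x "y \<otimes> y"] nrm_mult[of y y] that x by simp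
    also have "nrm A y * nrm A y \<le> r\<^sup>2"
      using that nrm_nonneg[of y] by (auto simp: power2_eq_square intro!: mult_mono)
    finally show ?thesis
      using that x r by (simp add: T_def nrm_smult)
  qed
  have T_diff: "nrm A (T u \<ominus> T v) \<le> r * nrm A (u \<ominus> v)"
    if uv: "u \<in> carrier A" "v \<in> carrier A" "nrm A u \<le> r" "nrm A v \<le> r" for u v
  proof -
    have "T u \<ominus> T v = (1/2) \<odot> (u \<otimes> u \<ominus> v \<otimes> v)"
      using uv x unfolding T_def
      by (subst cs_smult_minus[symmetric]) (auto simp: cs_add_minus_add)
    hence "nrm A (T u \<ominus> T v) = nrm A (u \<otimes> u \<ominus> v \<otimes> v) / 2"
      using uv by (simp add: nrm_smult)
    also have "nrm A (u \<otimes> u \<ominus> v \<otimes> v) \<le> nrm A (u \<ominus> v) * nrm A u + nrm A v * nrm A (u \<ominus> v)"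
      using uv by (intro nrm_mult_minus_mult)
    also have "\<dots> \<le> nrm A (u \<ominus> v) * r + r * nrm A (u \<ominus> v)"
      using uv by (intro add_mono mult_mono) (auto simp: r nrm_nonneg)
    finally show ?thesis by simp
  qed
  have z_Suc: "z (Suc n) = T (z n)" for n by (simp add: z_def)
  have z [simp, intro]: "z n \<in> carrier A" for n
    by (induction n) (auto simp: z_Suc, simp add: z_def)
  have star_z: "star A (z n) = z n" for n
    by (induction n) (auto simp: z_Suc star_T, simp add: z_def)
  have nrm_z: "nrm A (z n) \<le> r" for n
    by (induction n) (auto simp: z_Suc nrm_T, simp add: z_def r)
  \<comment> \<open>Two points of the ball are at distance at most 2r < 2, and each application of
    \<open>T\<close> contributes a factor r.\<close>
  have z_diff: "nrm A (z (m + k) \<ominus> z m) \<le> r ^ m * 2" for m k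
  proof (induction m)
    case 0
    have "nrm A (z k \<ominus> z 0) \<le> nrm A (z k) + nrm A (z 0)"
      by (intro nrm_minus_le) auto
    thus ?case using nrm_z[of k] nrm_z[of 0] r by simp
  next
    case (Suc m)
    have "nrm A (z (Suc m + k) \<ominus> z (Suc m)) \<le> r * nrm A (z (m + k) \<ominus> z m)"
      by (simp add: z_Suc T_diff nrm_z)
    also have "\<dots> \<le> r * (r ^ m * 2)"
      using Suc r by (intro mult_left_mono) auto
    finally show ?case by (simp add: mult.assoc)
  qed
  have lim0: "(\<lambda>m. r ^ m * 2) \<longlonglongrightarrow> 0 * 2"
    using r by (intro tendsto_mult LIMSEQ_realpow_zero tendsto_const) auto
  have "\<exists>N. \<forall>m\<ge>N. \<forall>n\<ge>N. nrm A (z m \<ominus> z n) < e" if "e > 0" for e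
  proof -
    have "\<forall>\<^sub>F m in sequentially. r ^ m * 2 < e"
      using lim0 that by (intro order_tendstoD(2)[of _ 0]) auto
    then obtain N where N: "\<And>m. m \<ge> N \<Longrightarrow> r ^ m * 2 < e"
      by (auto simp: eventually_sequentially)
    have *: "nrm A (z m \<ominus> z n) < e" if "n \<ge> N" "m \<ge> n" for m n
      using z_diff[of n "m - n"] N[of n] that by simp
    have "nrm A (z m \<ominus> z n) < e" if "m \<ge> N" "n \<ge> N" for m n
      using *[of n m] *[of m n] that nrm_minus_commute[of "z m" "z n"] by (cases "m \<ge> n") auto
    thus ?thesis by blast
  qed
  then obtain w where w: "w \<in> carrier A" "(\<lambda>n. nrm A (z n \<ominus> w)) \<longlonglongrightarrow> 0"
    using Cauchy_limit[of z] z by blast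
  have star_w: "star A w = w"
  proof (rule limit_unique[of z])
    have "nrm A (z n \<ominus> star A w) = nrm A (z n \<ominus> w)" for n
      using nrm_star[of "z n \<ominus> w"] w by (simp add: star_minus star_z)
    thus "(\<lambda>n. nrm A (z n \<ominus> star A w)) \<longlonglongrightarrow> 0" using w by simp
  qed (use w in auto)
  have nrm_w: "nrm A w \<le> r"
  proof -
    have "(\<lambda>n. r + nrm A (z n \<ominus> w)) \<longlonglongrightarrow> r + 0"
      by (intro tendsto_intros w)
    moreover have "nrm A w \<le> r + nrm A (z n \<ominus> w)" for n
      using nrm_le_minus[of w "z n"] nrm_z[of n] nrm_minus_commute[of w "z n"] w by simp
    ultimately show ?thesis
      by (intro LIMSEQ_le_const[of _ r]) auto
  qed
  have fix_w: "w = T w"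
  proof (rule limit_unique[of "\<lambda>n. z (Suc n)"])
    show "(\<lambda>n. nrm A (z (Suc n) \<ominus> w)) \<longlonglongrightarrow> 0"
      using w by (rule_tac LIMSEQ_Suc)
    have "(\<lambda>n. r * nrm A (z n \<ominus> w)) \<longlonglongrightarrow> r * 0"
      by (intro tendsto_intros w)
    thus "(\<lambda>n. nrm A (z (Suc n) \<ominus> T w)) \<longlonglongrightarrow> 0"
      by (rule_tac tendsto_sandwich[OF _ _ tendsto_const, of _ _ _ "\<lambda>n. r * nrm A (z n \<ominus> w)"])
         (auto simp: z_Suc w(1) nrm_z nrm_w T_diff nrm_nonneg)
  qed (use w in auto)
  have "2 \<odot> w = 2 \<odot> T w"
    using fix_w by simp
  hence eq: "2 \<odot> w = x \<oplus> w \<otimes> w"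
    using w x by (simp add: T_def)
  have "(\<one> \<ominus> w) \<otimes> (\<one> \<ominus> w) = (\<one> \<ominus> w) \<ominus> (w \<ominus> w \<otimes> w)"
    using w by (simp add: cs_minus_mult cs_mult_minus)
  also have "\<dots> = \<one> \<oplus> (w \<otimes> w \<oplus> (-1) \<odot> (w \<oplus> w))"
    using w by (simp add: cs_minus cs_smult_add cs_ac)
  also have "w \<oplus> w = x \<oplus> w \<otimes> w"
    using cs_add_smult[of w 1 1] w by (simp add: eq[symmetric])
  also have "\<one> \<oplus> (w \<otimes> w \<oplus> (-1) \<odot> (x \<oplus> w \<otimes> w)) = (\<one> \<ominus> x) \<oplus> (w \<otimes> w \<ominus> w \<otimes> w)"
    using w x by (simp only: cs_minus cs_smult_add cs_ac one_closed mult_closed cs_add_closed cs_smult_closed)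
  also have "\<dots> = \<one> \<ominus> x"
    using w x by simp
  finally show ?thesis
    using w star_w by (intro that[of "\<one> \<ominus> w"]) (auto simp: star_minus)
qed

text \<open>For c > ||a||^2 the element 1 - a* a / c is a square of a self-adjoint element, so f is
  nonnegative on it; then c decreases to ||a||^2. This is the automatic continuity of positive
  functionals.\<close>

lemma positive_functional_bound:
  assumes f: "linear_functional A f" and pos: "\<And>y. y \<in> carrier A \<Longrightarrow> 0 \<le> Re (f (star A y \<otimes> y))"
    and a: "a \<in> carrier A"
  shows "Re (f (star A a \<otimes> a)) \<le> (nrm A a)\<^sup>2 * Re (f \<one>)"
proof -
  have *: "Re (f (star A a \<otimes> a)) \<le> c * Re (f \<one>)" if c: "c > (nrm A a)\<^sup>2" for c
  proof -
    have c0: "c > 0" using c by (meson le_less_trans zero_le_power2)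
    define x where "x = complex_of_real (1 / c) \<odot> (star A a \<otimes> a)"
    have "nrm A x = (nrm A a)\<^sup>2 / c"
      using a c0 by (simp add: x_def nrm_smult cstar_identity norm_divide)
    hence x: "x \<in> carrier A" "star A x = x" "nrm A x < 1"
      using a c c0 by (auto simp: x_def star_smult star_mult star_star)
    obtain y where y: "y \<in> carrier A" "star A y = y" "y \<otimes> y = \<one> \<ominus> x"
      using sqrt_one_minus[OF x] .
    have "0 \<le> Re (f (\<one> \<ominus> x))"
      using pos[of y] y by simp
    also have "f (\<one> \<ominus> x) = f \<one> - f (star A a \<otimes> a) / c"
      using x a by (simp add: linear_functionalD[OF f] x_def)
    finally show ?thesis
      using c0 by (simp add: field_simps)
  qed
  have "(\<lambda>n. ((nrm A a)\<^sup>2 + inverse (real (Suc n))) * Re (f \<one>)) \<longlonglongrightarrow> ((nrm A a)\<^sup>2 + 0) * Re (f \<one>)"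
    by (intro tendsto_intros LIMSEQ_inverse_real_of_nat)
  moreover have "Re (f (star A a \<otimes> a)) \<le> ((nrm A a)\<^sup>2 + inverse (real (Suc n))) * Re (f \<one>)" for n
    by (intro *) simp
  ultimately show ?thesis
    by (intro LIMSEQ_le_const[of _ "(nrm A a)\<^sup>2 * Re (f \<one>)"]) auto
qed

end

section \<open>Matrix units\<close>

text \<open>The index set may have any type, because words will index the units of tensor
  products.\<close>

locale matrix_units = unital_cstar_algebra A for A :: "'a cstar_alg" (structure) +
  fixes W :: "'w set" and e :: "'w \<Rightarrow> 'w \<Rightarrow> 'a"
  assumes finite_W [simp]: "finite W"
    and e_closed [simp, intro]: "\<lbrakk>i \<in> W; j \<in> W\<rbrakk> \<Longrightarrow> e i j \<in> carrier A"
    and star_e: "\<lbrakk>i \<in> W; j \<in> W\<rbrakk> \<Longrightarrow> star A (e i j) = e j i"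
    and e_mult: "\<lbrakk>i \<in> W; j \<in> W; k \<in> W; l \<in> W\<rbrakk>
      \<Longrightarrow> e i j \<otimes> e k l = (if j = k then e i l else \<zero>)"
    and sum_e: "(\<Oplus>i\<in>W. e i i) = \<one>"
    and one_neq_zero: "\<one> \<noteq> \<zero>"
begin

text \<open>By \<open>synth_coord\<close> this is the linear span of the units. Describing it by
  corners reduces closure under the operations to computing corners, without handling linear
  combinations.\<close>

definition mspan :: "'a set" where
  "mspan = {x \<in> carrier A. \<forall>i\<in>W. \<forall>j\<in>W. \<exists>c. e i i \<otimes> x \<otimes> e j j = c \<odot> e i j}"

definition coord :: "'a \<Rightarrow> 'w \<Rightarrow> 'w \<Rightarrow> complex" where
  "coord x i j = (THE c. e i i \<otimes> x \<otimes> e j j = c \<odot> e i j)"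

definition synth :: "('w \<Rightarrow> 'w \<Rightarrow> complex) \<Rightarrow> 'a" where
  "synth X = (\<Oplus>i\<in>W. \<Oplus>j\<in>W. X i j \<odot> e i j)"

lemma W_nonempty [simp]: "W \<noteq> {}"
  using sum_e one_neq_zero by auto

text \<open>Any one vanishing unit kills every diagonal unit, since \<open>e k k\<close> factors
  through it, and hence their sum \<one>.\<close>

lemma e_nonzero:
  assumes "i \<in> W" "j \<in> W"
  shows "e i j \<noteq> \<zero>"
proof
  assume 0: "e i j = \<zero>"
  have "e k k = \<zero>" if k: "k \<in> W" for k
  proof -
    have "e k k = (e k i \<otimes> e i j) \<otimes> e j k"
      using assms k by (simp add: e_mult)
    thus ?thesis using 0 assms k by simp
  qed
  hence "(\<Oplus>i\<in>W. e i i) = \<zero>" by (intro cs_finsum_zero)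
  thus False using sum_e one_neq_zero by simp
qed

lemma nrm_e:
  assumes "i \<in> W" "j \<in> W"
  shows "nrm A (e i j) = 1"
proof -
  have *: "nrm A (e k k) = 1" if k: "k \<in> W" for k
  proof -
    have "(nrm A (e k k))\<^sup>2 = nrm A (e k k)"
      using cstar_identity[of "e k k"] k by (simp add: star_e e_mult)
    thus ?thesis
      using e_nonzero[OF k k] k by (simp add: power2_eq_square nrm_eq_0_iff)
  qed
  have "(nrm A (e i j))\<^sup>2 = nrm A (e j j)"
    using cstar_identity[of "e i j"] assms by (simp add: star_e e_mult)
  thus ?thesis
    using *[of j] assms nrm_nonneg[of "e i j"] by (simp add: power2_eq_1_iff)
qed

lemma mspan_closed: "x \<in> mspan \<Longrightarrow> x \<in> carrier A"
  by (simp add: mspan_def)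

lemma coord_eqI:
  assumes "e i i \<otimes> x \<otimes> e j j = c \<odot> e i j" "i \<in> W" "j \<in> W"
  shows "coord x i j = c"
  unfolding coord_def
proof (rule the_equality)
  fix d assume "e i i \<otimes> x \<otimes> e j j = d \<odot> e i j"
  thus "d = c"
    using assms cs_smult_cancel[of d "e i j" c] e_nonzero[of i j] by simp
qed fact

lemma mspan_coord:
  assumes "x \<in> mspan" "i \<in> W" "j \<in> W"
  shows "e i i \<otimes> x \<otimes> e j j = coord x i j \<odot> e i j"
proof -
  obtain c where c: "e i i \<otimes> x \<otimes> e j j = c \<odot> e i j"
    using assms by (auto simp: mspan_def)
  thus ?thesis
    using coord_eqI[OF c] assms by simp
qed

lemma mspanI:
  assumes "x \<in> carrier A" "\<And>i j. \<lbrakk>i \<in> W; j \<in> W\<rbrakk> \<Longrightarrow> e i i \<otimes> x \<otimes> e j j = X i j \<odot> e i j"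
  shows "x \<in> mspan"
  using assms unfolding mspan_def by auto

lemma expand:
  assumes x: "x \<in> carrier A"
  shows "x = (\<Oplus>i\<in>W. \<Oplus>j\<in>W. e i i \<otimes> x \<otimes> e j j)"
proof -
  have "x = (\<Oplus>i\<in>W. e i i) \<otimes> x"
    using x by (simp add: sum_e)
  also have "\<dots> = (\<Oplus>i\<in>W. e i i \<otimes> x)"
    using x by (intro finsum_mult) auto
  also have "\<dots> = (\<Oplus>i\<in>W. \<Oplus>j\<in>W. e i i \<otimes> x \<otimes> e j j)"
  proof (rule cs_finsum_cong)
    fix i assume i: "i \<in> W"
    have "e i i \<otimes> x = e i i \<otimes> x \<otimes> (\<Oplus>j\<in>W. e j j)"
      using x i by (simp add: sum_e)
    also have "\<dots> = (\<Oplus>j\<in>W. e i i \<otimes> x \<otimes> e j j)"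
      using x i by (intro mult_finsum) auto
    finally show "e i i \<otimes> x = (\<Oplus>j\<in>W. e i i \<otimes> x \<otimes> e j j)" .
    show "(\<Oplus>j\<in>W. e i i \<otimes> x \<otimes> e j j) \<in> carrier A"
      using x i by (intro cs_finsum_closed) auto
  qed
  finally show ?thesis .
qed

lemma synth_closed [simp, intro]: "synth X \<in> carrier A"
  unfolding synth_def by (intro cs_finsum_closed) auto

lemma synth_cut:
  assumes "i \<in> W" "j \<in> W"
  shows "e i i \<otimes> synth X \<otimes> e j j = X i j \<odot> e i j"
proof -
  have "e i i \<otimes> synth X = (\<Oplus>k\<in>W. e i i \<otimes> (\<Oplus>l\<in>W. X k l \<odot> e k l))"
    unfolding synth_def using assms by (intro mult_finsum cs_finsum_closed) auto
  also have "\<dots> = (\<Oplus>k\<in>W. \<Oplus>l\<in>W. e i i \<otimes> (X k l \<odot> e k l))"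
    using assms by (intro cs_finsum_cong mult_finsum cs_finsum_closed) auto
  also have "\<dots> = (\<Oplus>l\<in>W. e i i \<otimes> (X i l \<odot> e i l))"
    using assms by (intro cs_finsum_single cs_finsum_closed cs_finsum_zero)
      (auto simp: smult_mult_right e_mult)
  also have "\<dots> = (\<Oplus>l\<in>W. X i l \<odot> e i l)"
    using assms by (intro cs_finsum_cong) (auto simp: smult_mult_right e_mult)
  also have "\<dots> \<otimes> e j j = (\<Oplus>l\<in>W. X i l \<odot> e i l \<otimes> e j j)"
    using assms by (intro finsum_mult) auto
  also have "\<dots> = X i j \<odot> e i j \<otimes> e j j"
    using assms by (intro cs_finsum_single) (auto simp: smult_mult_left e_mult)
  finally show ?thesis
    using assms by (simp add: smult_mult_left e_mult)
qed

lemma synth_mspan [simp, intro]: "synth X \<in> mspan"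
  by (rule mspanI[OF synth_closed synth_cut])

lemma coord_synth: "\<lbrakk>i \<in> W; j \<in> W\<rbrakk> \<Longrightarrow> coord (synth X) i j = X i j"
  by (rule coord_eqI[OF synth_cut])

lemma synth_coord: "x \<in> mspan \<Longrightarrow> synth (coord x) = x"
proof -
  assume x: "x \<in> mspan"
  have "synth (coord x) = (\<Oplus>i\<in>W. \<Oplus>j\<in>W. e i i \<otimes> x \<otimes> e j j)"
    unfolding synth_def using x mspan_closed[OF x]
    by (intro cs_finsum_cong cs_finsum_closed) (auto simp: mspan_coord)
  thus ?thesis
    using expand[OF mspan_closed[OF x]] by simp
qed

lemma mspan_eqI:
  assumes "x \<in> mspan" "y \<in> mspan" "\<And>i j. \<lbrakk>i \<in> W; j \<in> W\<rbrakk> \<Longrightarrow> coord x i j = coord y i j"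
  shows "x = y"
proof -
  have "synth (coord x) = synth (coord y)"
    unfolding synth_def by (intro cs_finsum_cong cs_finsum_closed) (auto simp: assms)
  thus ?thesis
    using assms by (simp add: synth_coord)
qed

lemma
  assumes "x \<in> mspan" "y \<in> mspan"
  shows mspan_add: "x \<oplus> y \<in> mspan"
    and coord_add: "\<lbrakk>i \<in> W; j \<in> W\<rbrakk> \<Longrightarrow> coord (x \<oplus> y) i j = coord x i j + coord y i j"
proof -
  have c: "e i i \<otimes> (x \<oplus> y) \<otimes> e j j = (coord x i j + coord y i j) \<odot> e i j"
    if "i \<in> W" "j \<in> W" for i j
    using assms[THEN mspan_closed] that mspan_coord[OF assms(1)] mspan_coord[OF assms(2)]
    by (simp add: mult_add_left mult_add_right cs_add_smult)
  show "x \<oplus> y \<in> mspan"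
    using assms[THEN mspan_closed] c by (intro mspanI) auto
  show "coord (x \<oplus> y) i j = coord x i j + coord y i j" if "i \<in> W" "j \<in> W"
    using c that by (intro coord_eqI)
qed

lemma
  assumes "x \<in> mspan"
  shows mspan_smult: "c \<odot> x \<in> mspan"
    and coord_smult: "\<lbrakk>i \<in> W; j \<in> W\<rbrakk> \<Longrightarrow> coord (c \<odot> x) i j = c * coord x i j"
proof -
  have c: "e i i \<otimes> (c \<odot> x) \<otimes> e j j = (c * coord x i j) \<odot> e i j"
    if "i \<in> W" "j \<in> W" for i j
    using mspan_closed[OF assms] that mspan_coord[OF assms]
    by (simp add: smult_mult_left smult_mult_right)
  show "c \<odot> x \<in> mspan"
    using mspan_closed[OF assms] c by (intro mspanI) auto
  show "coord (c \<odot> x) i j = c * coord x i j" if "i \<in> W" "j \<in> W"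
    using c that by (intro coord_eqI)
qed

lemma
  assumes "x \<in> mspan"
  shows mspan_star: "star A x \<in> mspan"
    and coord_star: "\<lbrakk>i \<in> W; j \<in> W\<rbrakk> \<Longrightarrow> coord (star A x) i j = cnj (coord x j i)"
proof -
  have c: "e i i \<otimes> star A x \<otimes> e j j = cnj (coord x j i) \<odot> e i j"
    if "i \<in> W" "j \<in> W" for i j
  proof -
    have "e i i \<otimes> star A x \<otimes> e j j = star A (e j j \<otimes> x \<otimes> e i i)"
      using mspan_closed[OF assms] that by (simp add: star_mult star_e mult_assoc)
    thus ?thesis
      using mspan_closed[OF assms] that mspan_coord[OF assms] by (simp add: star_smult star_e)
  qed
  show "star A x \<in> mspan"
    using mspan_closed[OF assms] c by (intro mspanI) auto
  show "coord (star A x) i j = cnj (coord x j i)" if "i \<in> W" "j \<in> W"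
    using c that by (intro coord_eqI)
qed

lemma cut_mult:
  assumes "x \<in> carrier A" "y \<in> carrier A" "i \<in> W" "j \<in> W"
  shows "e i i \<otimes> (x \<otimes> y) \<otimes> e j j = (\<Oplus>k\<in>W. (e i i \<otimes> x \<otimes> e k k) \<otimes> (e k k \<otimes> y \<otimes> e j j))"
proof -
  have "e i i \<otimes> (x \<otimes> y) \<otimes> e j j = e i i \<otimes> x \<otimes> ((\<Oplus>k\<in>W. e k k) \<otimes> (y \<otimes> e j j))"
    using assms by (simp add: sum_e mult_assoc)
  also have "(\<Oplus>k\<in>W. e k k) \<otimes> (y \<otimes> e j j) = (\<Oplus>k\<in>W. e k k \<otimes> (y \<otimes> e j j))"
    using assms by (intro finsum_mult) auto
  also have "e i i \<otimes> x \<otimes> \<dots> = (\<Oplus>k\<in>W. e i i \<otimes> x \<otimes> (e k k \<otimes> (y \<otimes> e j j)))"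
    using assms by (intro mult_finsum) auto
  also have "\<dots> = (\<Oplus>k\<in>W. (e i i \<otimes> x \<otimes> e k k) \<otimes> (e k k \<otimes> y \<otimes> e j j))"
  proof (rule cs_finsum_cong)
    fix k assume k: "k \<in> W"
    have "e k k \<otimes> (e k k \<otimes> (y \<otimes> e j j)) = e k k \<otimes> (y \<otimes> e j j)"
      using assms k mult_assoc[of "e k k" "e k k" "y \<otimes> e j j"] by (simp add: e_mult)
    thus "e i i \<otimes> x \<otimes> (e k k \<otimes> (y \<otimes> e j j)) = (e i i \<otimes> x \<otimes> e k k) \<otimes> (e k k \<otimes> y \<otimes> e j j)"
      using assms k by (simp add: mult_assoc)
  qed (use assms in auto)
  finally show ?thesis .
qed

lemma
  assumes "x \<in> mspan" "y \<in> mspan"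
  shows mspan_mult: "x \<otimes> y \<in> mspan"
    and coord_mult: "\<lbrakk>i \<in> W; j \<in> W\<rbrakk> \<Longrightarrow> coord (x \<otimes> y) i j = (\<Sum>k\<in>W. coord x i k * coord y k j)"
proof -
  note xy = assms[THEN mspan_closed]
  have c: "e i i \<otimes> (x \<otimes> y) \<otimes> e j j = (\<Sum>k\<in>W. coord x i k * coord y k j) \<odot> e i j"
    if ij: "i \<in> W" "j \<in> W" for i j
  proof -
    have "e i i \<otimes> (x \<otimes> y) \<otimes> e j j = (\<Oplus>k\<in>W. (coord x i k * coord y k j) \<odot> e i j)"
      unfolding cut_mult[OF xy ij]
      using ij assms by (intro cs_finsum_cong)
        (auto simp: mspan_coord smult_mult_left smult_mult_right e_mult mult.commute)
    also have "\<dots> = (\<Sum>k\<in>W. coord x i k * coord y k j) \<odot> e i j"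
    proof -
      have "(\<Oplus>k\<in>I. f k \<odot> e i j) = (\<Sum>k\<in>I. f k) \<odot> e i j" if "finite I"
        for I :: "'w set" and f
        using that
      proof (induction I rule: finite_induct)
        case (insert k I)
        have "(\<Oplus>k\<in>insert k I. f k \<odot> e i j) = f k \<odot> e i j \<oplus> (\<Oplus>k\<in>I. f k \<odot> e i j)"
          using insert ij by (intro cs_finsum_insert) auto
        thus ?case using insert ij by (simp add: cs_add_smult)
      qed (use ij in auto)
      thus ?thesis by simp
    qed
    finally show ?thesis .
  qed
  show "x \<otimes> y \<in> mspan"
    using xy c by (intro mspanI) auto
  show "coord (x \<otimes> y) i j = (\<Sum>k\<in>W. coord x i k * coord y k j)" if "i \<in> W" "j \<in> W"
    using c that by (intro coord_eqI)
qed

lemma e_mspan [intro]: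
  assumes "i \<in> W" "j \<in> W"
  shows "e i j \<in> mspan"
  by (rule mspanI[where X = "\<lambda>k l. if k = i \<and> l = j then 1 else 0"])
    (use assms in \<open>auto simp: e_mult\<close>)

lemma coord_e:
  "\<lbrakk>i \<in> W; j \<in> W; k \<in> W; l \<in> W\<rbrakk> \<Longrightarrow> coord (e i j) k l = (if k = i \<and> l = j then 1 else 0)"
  by (rule coord_eqI) (auto simp: e_mult)

lemma mspan_one [intro]: "\<one> \<in> mspan"
  by (rule mspanI[where X = "\<lambda>k l. if k = l then 1 else 0"]) (auto simp: e_mult)

lemma coord_one: "\<lbrakk>k \<in> W; l \<in> W\<rbrakk> \<Longrightarrow> coord \<one> k l = (if k = l then 1 else 0)"
  by (rule coord_eqI) (auto simp: e_mult)

lemma mspan_minus: "\<lbrakk>x \<in> mspan; y \<in> mspan\<rbrakk> \<Longrightarrow> x \<ominus> y \<in> mspan"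
  by (simp add: cs_minus mspan_closed mspan_add mspan_smult)

lemma coord_minus:
  "\<lbrakk>x \<in> mspan; y \<in> mspan; i \<in> W; j \<in> W\<rbrakk> \<Longrightarrow> coord (x \<ominus> y) i j = coord x i j - coord y i j"
  by (simp add: cs_minus mspan_closed coord_add coord_smult mspan_smult)

lemma coord_le_nrm:
  assumes "x \<in> mspan" "i \<in> W" "j \<in> W"
  shows "cmod (coord x i j) \<le> nrm A x"
proof -
  have "cmod (coord x i j) = nrm A (e i i \<otimes> x \<otimes> e j j)"
    using assms by (simp add: mspan_coord nrm_smult nrm_e)
  also have "\<dots> \<le> nrm A (e i i \<otimes> x) * nrm A (e j j)"
    using assms mspan_closed by (intro nrm_mult) auto
  also have "\<dots> \<le> nrm A (e i i) * nrm A x * nrm A (e j j)"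
    using assms mspan_closed nrm_nonneg by (intro mult_right_mono nrm_mult) auto
  finally show ?thesis
    using assms by (simp add: nrm_e)
qed

lemma nrm_le_coord:
  assumes "x \<in> mspan"
  shows "nrm A x \<le> (\<Sum>i\<in>W. \<Sum>j\<in>W. cmod (coord x i j))"
proof -
  have "nrm A x = nrm A (synth (coord x))"
    using assms by (simp add: synth_coord)
  also have "\<dots> \<le> (\<Sum>i\<in>W. nrm A (\<Oplus>j\<in>W. coord x i j \<odot> e i j))"
    unfolding synth_def by (intro nrm_finsum cs_finsum_closed) auto
  also have "\<dots> \<le> (\<Sum>i\<in>W. \<Sum>j\<in>W. nrm A (coord x i j \<odot> e i j))"
    by (intro sum_mono nrm_finsum) auto
  finally show ?thesis
    by (simp add: nrm_smult nrm_e)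
qed

text \<open>For closedness: by \<open>coord_le_nrm\<close> a norm-convergent sequence has convergent
  coordinates, and by \<open>nrm_le_coord\<close> it converges to the element assembled from the
  coordinate limits.\<close>

lemma mspan_subalgebra: "cstar_subalgebra mspan A"
proof (rule cstar_subalgebraI)
  show "\<zero> \<in> mspan"
    by (rule mspanI[where X = "\<lambda>_ _. 0"]) auto
next
  fix f x assume f: "\<And>n. f n \<in> mspan" and x: "x \<in> carrier A" "(\<lambda>n. nrm A (f n \<ominus> x)) \<longlonglongrightarrow> 0"
  have fA: "f n \<in> carrier A" for n using f mspan_closed by blast
  have conv: "convergent (\<lambda>n. coord (f n) i j)" if ij: "i \<in> W" "j \<in> W" for i j
  proof (rule Cauchy_convergent, rule metric_CauchyI)
    fix r :: real assume "r > 0"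
    hence "\<forall>\<^sub>F n in sequentially. nrm A (f n \<ominus> x) < r / 2"
      using x(2) by (intro order_tendstoD(2)[of _ 0]) auto
    then obtain N where N: "\<And>n. n \<ge> N \<Longrightarrow> nrm A (f n \<ominus> x) < r / 2"
      by (auto simp: eventually_sequentially)
    have "dist (coord (f m) i j) (coord (f n) i j) < r" if "m \<ge> N" "n \<ge> N" for m n
    proof -
      have "dist (coord (f m) i j) (coord (f n) i j) = cmod (coord (f m \<ominus> f n) i j)"
        using f ij by (simp add: dist_norm coord_minus)
      also have "\<dots> \<le> nrm A (f m \<ominus> f n)"
        using f ij by (intro coord_le_nrm mspan_minus)
      also have "\<dots> \<le> nrm A (f m \<ominus> x) + nrm A (x \<ominus> f n)"
        using fA x by (intro nrm_minus_triangle)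
      also have "\<dots> < r"
        using N[OF that(1)] N[OF that(2)] nrm_minus_commute[of "f n" x] fA x by simp
      finally show ?thesis .
    qed
    thus "\<exists>M. \<forall>m\<ge>M. \<forall>n\<ge>M. dist (coord (f m) i j) (coord (f n) i j) < r" by blast
  qed
  define X where "X = (\<lambda>i j. lim (\<lambda>n. coord (f n) i j))"
  have X: "(\<lambda>n. coord (f n) i j) \<longlonglongrightarrow> X i j" if "i \<in> W" "j \<in> W" for i j
    using conv[OF that] by (simp add: X_def convergent_LIMSEQ_iff)
  have "(\<lambda>n. nrm A (f n \<ominus> synth X)) \<longlonglongrightarrow> 0"
  proof (rule tendsto_sandwich[OF _ _ tendsto_const])
    show "\<forall>\<^sub>F n in sequentially. 0 \<le> nrm A (f n \<ominus> synth X)"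
      using fA by (simp add: nrm_nonneg)
    show "\<forall>\<^sub>F n in sequentially. nrm A (f n \<ominus> synth X)
        \<le> (\<Sum>i\<in>W. \<Sum>j\<in>W. cmod (coord (f n) i j - X i j))"
    proof (rule always_eventually, rule allI)
      fix n
      have "nrm A (f n \<ominus> synth X) \<le> (\<Sum>i\<in>W. \<Sum>j\<in>W. cmod (coord (f n \<ominus> synth X) i j))"
        using f by (intro nrm_le_coord mspan_minus) auto
      also have "\<dots> = (\<Sum>i\<in>W. \<Sum>j\<in>W. cmod (coord (f n) i j - X i j))"
        using f by (intro sum.cong refl) (simp add: coord_minus coord_synth)
      finally show "nrm A (f n \<ominus> synth X) \<le> (\<Sum>i\<in>W. \<Sum>j\<in>W. cmod (coord (f n) i j - X i j))" .
    qed
    show "(\<lambda>n. \<Sum>i\<in>W. \<Sum>j\<in>W. cmod (coord (f n) i j - X i j)) \<longlonglongrightarrow> 0"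
      using X by (intro tendsto_null_sum) (simp add: LIM_zero tendsto_norm_zero)
  qed
  hence "x = synth X"
    using limit_unique[of f x "synth X"] fA x by auto
  thus "x \<in> mspan" by simp
qed (auto simp: mspan_add mspan_smult mspan_mult mspan_star mspan_closed)

lemma mspan_finsum: "\<lbrakk>finite I; \<And>i. i \<in> I \<Longrightarrow> f i \<in> mspan\<rbrakk> \<Longrightarrow> (\<Oplus>i\<in>I. f i) \<in> mspan"
proof (induction I rule: finite_induct)
  case (insert j I)
  have "(\<Oplus>i\<in>insert j I. f i) = f j \<oplus> (\<Oplus>i\<in>I. f i)"
    using insert mspan_closed by (intro cs_finsum_insert) auto
  thus ?case using insert by (simp add: mspan_add)
qed (use cstar_subalgebraD(2)[OF mspan_subalgebra] in simp)

lemma mspan_subset: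
  assumes "cstar_subalgebra S A" "\<And>i j. \<lbrakk>i \<in> W; j \<in> W\<rbrakk> \<Longrightarrow> e i j \<in> S"
  shows "mspan \<subseteq> S"
proof
  fix x assume x: "x \<in> mspan"
  note S = cstar_subalgebraD[OF assms(1)]
  have *: "(\<Oplus>i\<in>I. f i) \<in> S" if "finite I" "\<And>i. i \<in> I \<Longrightarrow> f i \<in> S" for I :: "'w set" and f
    using that
  proof (induction I rule: finite_induct)
    case (insert j I)
    have "(\<Oplus>i\<in>insert j I. f i) = f j \<oplus> (\<Oplus>i\<in>I. f i)"
      using insert S(1) by (intro cs_finsum_insert) auto
    thus ?case using insert S by simp
  qed (use S in simp)
  have "synth (coord x) \<in> S"
    unfolding synth_def by (intro * S(4) assms finite_W)
  thus "x \<in> S" using x by (simp add: synth_coord)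
qed

subsection \<open>The normalised trace\<close>

definition mtrace :: "'a \<Rightarrow> complex" where
  "mtrace x = (\<Sum>i\<in>W. coord x i i) / of_nat (card W)"

lemma card_W_pos [simp]: "card W > 0"
  using W_nonempty by (simp add: card_gt_0_iff)

lemma mtrace_add: "\<lbrakk>x \<in> mspan; y \<in> mspan\<rbrakk> \<Longrightarrow> mtrace (x \<oplus> y) = mtrace x + mtrace y"
  by (simp add: mtrace_def coord_add sum.distrib add_divide_distrib)

lemma mtrace_smult: "x \<in> mspan \<Longrightarrow> mtrace (c \<odot> x) = c * mtrace x"
  by (simp add: mtrace_def coord_smult sum_distrib_left)

lemma mtrace_one: "mtrace \<one> = 1"
  by (simp add: mtrace_def coord_one)

lemma mtrace_mult_commute:
  assumes "x \<in> mspan" "y \<in> mspan"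
  shows "mtrace (x \<otimes> y) = mtrace (y \<otimes> x)"
proof -
  have "(\<Sum>i\<in>W. \<Sum>k\<in>W. coord x i k * coord y k i) = (\<Sum>i\<in>W. \<Sum>k\<in>W. coord y i k * coord x k i)"
    by (subst sum.swap) (simp add: mult.commute)
  thus ?thesis
    using assms by (simp add: mtrace_def coord_mult)
qed

text \<open>The right-hand side is the squared Hilbert-Schmidt norm divided by
  \<open>card W\<close>. Positivity of the trace and the comparison \<open>nrm_le_sq2\<close> rest
  on it.\<close>

lemma mtrace_star_mult:
  assumes "x \<in> mspan"
  shows "mtrace (star A x \<otimes> x)
    = of_real ((\<Sum>i\<in>W. \<Sum>k\<in>W. (cmod (coord x k i))\<^sup>2) / real (card W))"
proof -
  have "z * cnj z = (complex_of_real (cmod z))\<^sup>2" for z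
    by (metis complex_norm_square of_real_power)
  thus ?thesis
    using assms by (simp add: mtrace_def coord_mult mspan_star coord_star mult.commute)
qed

lemma cmod_mtrace_le:
  assumes "x \<in> mspan"
  shows "cmod (mtrace x) \<le> nrm A x"
proof -
  have "cmod (\<Sum>i\<in>W. coord x i i) \<le> (\<Sum>i\<in>W. nrm A x)"
    using assms by (intro sum_norm_le coord_le_nrm)
  thus ?thesis
    by (simp add: mtrace_def norm_divide divide_le_eq mult.commute)
qed

text \<open>Off-diagonal units are commutators, and the diagonal units have equal values that add up
  to 1. Uniqueness makes the traces of nested matrix algebras compatible, whatever their units
  are.\<close>

lemma mtrace_unique:
  assumes add: "\<And>x y. \<lbrakk>x \<in> mspan; y \<in> mspan\<rbrakk> \<Longrightarrow> t (x \<oplus> y) = t x + t y"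
    and smult: "\<And>c x. x \<in> mspan \<Longrightarrow> t (c \<odot> x) = c * t x"
    and comm: "\<And>x y. \<lbrakk>x \<in> mspan; y \<in> mspan\<rbrakk> \<Longrightarrow> t (x \<otimes> y) = t (y \<otimes> x)"
    and one: "t \<one> = 1" and x: "x \<in> mspan"
  shows "t x = mtrace x"
proof -
  have zero: "t \<zero> = 0"
    using smult[of \<one> 0] mspan_one by simp
  have fs: "t (\<Oplus>i\<in>I. f i) = (\<Sum>i\<in>I. t (f i))"
    if "finite I" "\<And>i. i \<in> I \<Longrightarrow> f i \<in> mspan" for I :: "'w set" and f
    using that
  proof (induction I rule: finite_induct)
    case (insert j I)
    have "(\<Oplus>i\<in>insert j I. f i) = f j \<oplus> (\<Oplus>i\<in>I. f i)"
      using insert mspan_closed by (intro cs_finsum_insert) auto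
    thus ?case using insert by (simp add: add mspan_finsum)
  qed (simp add: zero)
  have off: "t (e i j) = 0" if "i \<in> W" "j \<in> W" "i \<noteq> j" for i j
    using comm[of "e i i" "e i j"] that zero by (simp add: e_mspan e_mult)
  have diag: "t (e i i) = t (e j j)" if "i \<in> W" "j \<in> W" for i j
    using comm[of "e i j" "e j i"] that by (simp add: e_mspan e_mult)
  have t_e: "t (e i i) = 1 / of_nat (card W)" if i: "i \<in> W" for i
  proof -
    have "1 = (\<Sum>j\<in>W. t (e j j))"
      using one fs[of W "\<lambda>j. e j j"] by (simp add: sum_e e_mspan)
    also have "\<dots> = (\<Sum>j\<in>W. t (e i i))"
      by (intro sum.cong refl diag i)
    finally show ?thesis by (simp add: eq_divide_eq mult.commute)
  qed
  have "t x = t (synth (coord x))"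
    using x by (simp add: synth_coord)
  also have "\<dots> = (\<Sum>i\<in>W. t (\<Oplus>j\<in>W. coord x i j \<odot> e i j))"
    unfolding synth_def by (intro fs mspan_finsum mspan_smult e_mspan finite_W)
  also have "\<dots> = (\<Sum>i\<in>W. \<Sum>j\<in>W. t (coord x i j \<odot> e i j))"
    by (intro sum.cong refl fs mspan_smult e_mspan finite_W)
  also have "\<dots> = (\<Sum>i\<in>W. \<Sum>j\<in>W. coord x i j * t (e i j))"
    by (intro sum.cong refl smult e_mspan)
  also have "\<dots> = (\<Sum>i\<in>W. \<Sum>j\<in>W. if j = i then coord x i i / of_nat (card W) else 0)"
    by (intro sum.cong refl) (auto simp: off t_e)
  also have "\<dots> = mtrace x"
    by (simp add: mtrace_def sum_divide_distrib)
  finally show ?thesis .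
qed

end

section \<open>Tracial states\<close>

context cstar_algebra
begin

abbreviation tends :: "(nat \<Rightarrow> 'a) \<Rightarrow> 'a \<Rightarrow> bool" where
  "tends f x \<equiv> (\<lambda>n. nrm A (f n \<ominus> x)) \<longlonglongrightarrow> 0"

lemma tends_nrm:
  assumes "\<And>n. f n \<in> carrier A" "x \<in> carrier A" "tends f x"
  shows "(\<lambda>n. nrm A (f n)) \<longlonglongrightarrow> nrm A x"
proof -
  have "\<bar>nrm A (f n) - nrm A x\<bar> \<le> nrm A (f n \<ominus> x)" for n
    using nrm_le_minus[of "f n" x] nrm_le_minus[of x "f n"] nrm_minus_commute[of x "f n"] assms
    by (simp add: abs_le_iff)
  hence "(\<lambda>n. nrm A (f n) - nrm A x) \<longlonglongrightarrow> 0"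
    using assms(3) by (rule_tac Lim_null_comparison[of _ "\<lambda>n. nrm A (f n \<ominus> x)"]) auto
  thus ?thesis by (simp add: LIM_zero_iff)
qed

lemma tends_add:
  assumes "\<And>n. f n \<in> carrier A" "x \<in> carrier A" "tends f x"
    and "\<And>n. g n \<in> carrier A" "y \<in> carrier A" "tends g y"
  shows "tends (\<lambda>n. f n \<oplus> g n) (x \<oplus> y)"
proof (rule Lim_null_comparison[of _ "\<lambda>n. nrm A (f n \<ominus> x) + nrm A (g n \<ominus> y)"])
  show "\<forall>\<^sub>F n in sequentially. norm (nrm A (f n \<oplus> g n \<ominus> (x \<oplus> y)))
      \<le> nrm A (f n \<ominus> x) + nrm A (g n \<ominus> y)"
    using assms by (intro always_eventually) (simp add: cs_add_minus_add nrm_nonneg nrm_triangle)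
qed (use tendsto_add[OF assms(3,6)] in simp)

lemma tends_smult:
  assumes "\<And>n. f n \<in> carrier A" "x \<in> carrier A" "tends f x"
  shows "tends (\<lambda>n. c \<odot> f n) (c \<odot> x)"
proof -
  have "nrm A (c \<odot> f n \<ominus> c \<odot> x) = cmod c * nrm A (f n \<ominus> x)" for n
    using assms by (simp add: cs_smult_minus[symmetric] nrm_smult)
  thus ?thesis
    using tendsto_mult[OF tendsto_const assms(3)] by simp
qed

lemma tends_star:
  assumes "\<And>n. f n \<in> carrier A" "x \<in> carrier A" "tends f x"
  shows "tends (\<lambda>n. star A (f n)) (star A x)"
proof -
  have "nrm A (star A (f n) \<ominus> star A x) = nrm A (f n \<ominus> x)" for n
    using assms by (simp add: star_minus[symmetric])
  thus ?thesis using assms by simp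
qed

lemma tends_mult:
  assumes f: "\<And>n. f n \<in> carrier A" "x \<in> carrier A" "tends f x"
    and g: "\<And>n. g n \<in> carrier A" "y \<in> carrier A" "tends g y"
  shows "tends (\<lambda>n. f n \<otimes> g n) (x \<otimes> y)"
proof (rule Lim_null_comparison)
  show "\<forall>\<^sub>F n in sequentially. norm (nrm A (f n \<otimes> g n \<ominus> x \<otimes> y))
      \<le> nrm A (f n \<ominus> x) * nrm A (g n) + nrm A x * nrm A (g n \<ominus> y)"
    using f g nrm_mult_minus_mult by (intro always_eventually) (simp add: nrm_nonneg)
  show "(\<lambda>n. nrm A (f n \<ominus> x) * nrm A (g n) + nrm A x * nrm A (g n \<ominus> y)) \<longlonglongrightarrow> 0"
    using tendsto_add[OF tendsto_mult[OF f(3) tends_nrm[OF g]] tendsto_mult[OF tendsto_const g(3)]]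
    by simp
qed

end

definition tracial_state :: "'a cstar_alg \<Rightarrow> ('a \<Rightarrow> complex) \<Rightarrow> bool" where
  "tracial_state A t \<longleftrightarrow> linear_functional A t \<and> t \<one>\<^bsub>A\<^esub> = 1 \<and>
    (\<forall>x\<in>carrier A. t (star A x \<otimes>\<^bsub>A\<^esub> x) \<in> \<real>\<^sub>\<ge>\<^sub>0) \<and>
    (\<forall>x\<in>carrier A. \<forall>y\<in>carrier A. t (x \<otimes>\<^bsub>A\<^esub> y) = t (y \<otimes>\<^bsub>A\<^esub> x))"

text \<open>Only the spans are nested; the units of successive levels need not be related, since
  uniqueness of the trace provides the consistency.\<close>

locale matrix_unit_sequence = unital_cstar_algebra A for A :: "'a cstar_alg" (structure) +
  fixes W :: "nat \<Rightarrow> 'w set" and e :: "nat \<Rightarrow> 'w \<Rightarrow> 'w \<Rightarrow> 'a" and D :: "nat \<Rightarrow> 'a set"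
  assumes units: "matrix_units A (W n) (e n)"
    and D_def: "D n = matrix_units.mspan A (W n) (e n)"
    and D_Suc: "D n \<subseteq> D (Suc n)"
    and dense: "\<lbrakk>x \<in> carrier A; 0 < r\<rbrakk> \<Longrightarrow> \<exists>n. \<exists>y\<in>D n. nrm A (y \<ominus> x) < r"
begin

lemma D_mono: "m \<le> n \<Longrightarrow> D m \<subseteq> D n"
  using lift_Suc_mono_le[of D m n] D_Suc by blast

lemma D_subalgebra: "cstar_subalgebra (D n) A"
  unfolding D_def by (rule matrix_units.mspan_subalgebra[OF units])

lemmas D_closed = cstar_subalgebraD[OF D_subalgebra]

definition tr :: "nat \<Rightarrow> 'a \<Rightarrow> complex" where
  "tr n = matrix_units.mtrace A (W n) (e n)"

lemmas tr_facts =
  matrix_units.mtrace_add[OF units, folded D_def tr_def]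
  matrix_units.mtrace_smult[OF units, folded D_def tr_def]
  matrix_units.mtrace_one[OF units, folded tr_def]
  matrix_units.mtrace_mult_commute[OF units, folded D_def tr_def]
  matrix_units.cmod_mtrace_le[OF units, folded D_def tr_def]

lemma one_D: "\<one> \<in> D n"
  unfolding D_def by (rule matrix_units.mspan_one[OF units])

lemma tr_star_mult: "x \<in> D n \<Longrightarrow> tr n (star A x \<otimes> x) \<in> \<real>\<^sub>\<ge>\<^sub>0"
  using matrix_units.mtrace_star_mult[OF units, of x n, folded D_def tr_def]
  by (simp add: sum_nonneg del: of_real_sum of_real_divide)

lemma tr_extend:
  assumes "m \<le> n" "x \<in> D m"
  shows "tr n x = tr m x"
  unfolding tr_def[of m]
proof (rule matrix_units.mtrace_unique[OF units], unfold D_def[symmetric])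
  have sub: "y \<in> D n" if "y \<in> D m" for y
    using D_mono[OF assms(1)] that by blast
  show "tr n (x \<oplus> y) = tr n x + tr n y" "tr n (x \<otimes> y) = tr n (y \<otimes> x)"
    if "x \<in> D m" "y \<in> D m" for x y
    using that by (simp_all add: tr_facts(1,4) sub)
  show "tr n (c \<odot> x) = c * tr n x" if "x \<in> D m" for c x
    using that by (simp add: tr_facts(2) sub)
qed (use assms tr_facts(3) in auto)

definition U :: "'a set" where "U = (\<Union>n. D n)"

lemma U_closed: "x \<in> U \<Longrightarrow> x \<in> carrier A"
  using D_closed(1) by (auto simp: U_def)

lemma D_U: "x \<in> D n \<Longrightarrow> x \<in> U"
  by (auto simp: U_def)

lemma U_common:
  assumes "x \<in> U" "y \<in> U"
  obtains n where "x \<in> D n" "y \<in> D n"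
proof -
  obtain i j where "x \<in> D i" "y \<in> D j" using assms by (auto simp: U_def)
  thus ?thesis
    using D_mono[of i "max i j"] D_mono[of j "max i j"] that[of "max i j"] by auto
qed

text \<open>The least level is merely a canonical choice; by \<open>trU_eq\<close> every level
  containing x gives the same value.\<close>

definition trU :: "'a \<Rightarrow> complex" where
  "trU x = tr (LEAST n. x \<in> D n) x"

lemma trU_eq: "x \<in> D n \<Longrightarrow> trU x = tr n x"
  unfolding trU_def using tr_extend[of "LEAST n. x \<in> D n" n x]
  by (metis LeastI Least_le)

lemma
  assumes "x \<in> U" "y \<in> U"
  shows U_add: "x \<oplus> y \<in> U" and trU_add: "trU (x \<oplus> y) = trU x + trU y"
    and U_mult: "x \<otimes> y \<in> U" and trU_mult: "trU (x \<otimes> y) = trU (y \<otimes> x)"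
    and U_minus: "x \<ominus> y \<in> U" and trU_minus: "trU (x \<ominus> y) = trU x - trU y"
proof -
  obtain n where n: "x \<in> D n" "y \<in> D n" using U_common[OF assms] .
  show "x \<oplus> y \<in> U" "x \<otimes> y \<in> U" "x \<ominus> y \<in> U"
    using n by (auto intro!: D_U[of _ n] D_closed(3-7))
  show "trU (x \<oplus> y) = trU x + trU y" "trU (x \<otimes> y) = trU (y \<otimes> x)"
    using n by (simp_all add: trU_eq[of _ n] D_closed(3,5) tr_facts(1,4))
  have "tr n (x \<oplus> (-1) \<odot> y) = tr n x - tr n y"
    using n by (simp add: tr_facts(1,2) D_closed(4))
  thus "trU (x \<ominus> y) = trU x - trU y"
    using n D_closed(7)[of x n y] U_closed[OF assms(1)] U_closed[OF assms(2)]
    by (simp add: trU_eq[of _ n] cs_minus)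
qed

lemma
  assumes "x \<in> U"
  shows U_smult: "c \<odot> x \<in> U" and trU_smult: "trU (c \<odot> x) = c * trU x"
    and trU_le: "cmod (trU x) \<le> nrm A x" and U_star: "star A x \<in> U"
    and trU_star_mult: "trU (star A x \<otimes> x) \<in> \<real>\<^sub>\<ge>\<^sub>0"
proof -
  obtain n where n: "x \<in> D n" using assms by (auto simp: U_def)
  show "c \<odot> x \<in> U" "star A x \<in> U"
    using n by (auto intro!: D_U[of _ n] D_closed(3-7))
  show "trU (c \<odot> x) = c * trU x" "cmod (trU x) \<le> nrm A x"
    using n by (simp_all add: trU_eq[of _ n] D_closed(4) tr_facts(2,5))
  show "trU (star A x \<otimes> x) \<in> \<real>\<^sub>\<ge>\<^sub>0"
    using n by (simp add: trU_eq[of _ n] D_closed(5,6) tr_star_mult)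
qed

definition approx :: "'a \<Rightarrow> nat \<Rightarrow> 'a" where
  "approx x n = (SOME y. y \<in> U \<and> nrm A (y \<ominus> x) < inverse (real (Suc n)))"

lemma
  assumes "x \<in> carrier A"
  shows approx_U: "approx x n \<in> U" and approx_tends: "tends (approx x) x"
proof -
  have *: "approx x n \<in> U \<and> nrm A (approx x n \<ominus> x) < inverse (real (Suc n))" for n
    unfolding approx_def
    by (rule someI_ex) (use dense[OF assms, of "inverse (real (Suc n))"] in \<open>auto simp: U_def\<close>)
  thus "approx x n \<in> U" by simp
  show "tends (approx x) x"
  proof (rule Lim_null_comparison[OF _ LIMSEQ_inverse_real_of_nat])
    show "\<forall>\<^sub>F n in sequentially. norm (nrm A (approx x n \<ominus> x)) \<le> inverse (real (Suc n))"
      using * U_closed assms by (intro always_eventually) (auto simp: nrm_nonneg less_imp_le)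
  qed
qed

definition tau :: "'a \<Rightarrow> complex" where
  "tau x = lim (\<lambda>n. trU (approx x n))"

text \<open>On \<open>U\<close> the trace is linear and norm-decreasing, so it maps Cauchy sequences
  to Cauchy sequences and sends two sequences with the same limit to the same value. Thus any
  approximating sequence computes \<open>tau\<close>.\<close>

lemma tau_limit:
  assumes f: "\<And>n. f n \<in> U" and x: "x \<in> carrier A" "tends f x"
  shows "(\<lambda>n. trU (f n)) \<longlonglongrightarrow> tau x"
proof -
  have conv: "convergent (\<lambda>n. trU (g n))" if g: "\<And>n. g n \<in> U" "tends g x" for g
  proof (rule Cauchy_convergent, rule metric_CauchyI)
    fix r :: real assume "r > 0"
    hence "\<forall>\<^sub>F n in sequentially. nrm A (g n \<ominus> x) < r / 2"
      using g(2) by (intro order_tendstoD(2)[of _ 0]) auto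
    then obtain N where N: "\<And>n. n \<ge> N \<Longrightarrow> nrm A (g n \<ominus> x) < r / 2"
      by (auto simp: eventually_sequentially)
    have "dist (trU (g m)) (trU (g n)) < r" if "m \<ge> N" "n \<ge> N" for m n
    proof -
      have "dist (trU (g m)) (trU (g n)) = cmod (trU (g m \<ominus> g n))"
        using g by (simp add: dist_norm trU_minus)
      also have "\<dots> \<le> nrm A (g m \<ominus> g n)"
        using g by (intro trU_le U_minus)
      also have "\<dots> \<le> nrm A (g m \<ominus> x) + nrm A (x \<ominus> g n)"
        using g U_closed x by (intro nrm_minus_triangle) auto
      also have "\<dots> < r"
        using N[OF that(1)] N[OF that(2)] nrm_minus_commute[of "g n" x] g U_closed x by simp
      finally show ?thesis .
    qed
    thus "\<exists>M. \<forall>m\<ge>M. \<forall>n\<ge>M. dist (trU (g m)) (trU (g n)) < r" by blast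
  qed
  have lim: "(\<lambda>n. trU (approx x n)) \<longlonglongrightarrow> tau x"
    using conv[OF approx_U[OF x(1)] approx_tends[OF x(1)]] by (simp add: tau_def convergent_LIMSEQ_iff)
  have "(\<lambda>n. trU (f n) - trU (approx x n)) \<longlonglongrightarrow> 0"
  proof (rule Lim_null_comparison)
    show "\<forall>\<^sub>F n in sequentially. cmod (trU (f n) - trU (approx x n))
        \<le> nrm A (f n \<ominus> x) + nrm A (approx x n \<ominus> x)"
    proof (rule always_eventually, rule allI)
      fix n
      have "cmod (trU (f n) - trU (approx x n)) = cmod (trU (f n \<ominus> approx x n))"
        using f approx_U x by (simp add: trU_minus)
      also have "\<dots> \<le> nrm A (f n \<ominus> approx x n)"
        using f approx_U x by (intro trU_le U_minus)
      also have "\<dots> \<le> nrm A (f n \<ominus> x) + nrm A (x \<ominus> approx x n)"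
        using f approx_U x U_closed by (intro nrm_minus_triangle) auto
      finally show "cmod (trU (f n) - trU (approx x n)) \<le> nrm A (f n \<ominus> x) + nrm A (approx x n \<ominus> x)"
        using nrm_minus_commute[of x "approx x n"] approx_U x U_closed by simp
    qed
    show "(\<lambda>n. nrm A (f n \<ominus> x) + nrm A (approx x n \<ominus> x)) \<longlonglongrightarrow> 0"
      using tendsto_add[OF x(2) approx_tends[OF x(1)]] by simp
  qed
  from tendsto_add[OF this lim] show ?thesis by simp
qed

lemma tau_U: "x \<in> U \<Longrightarrow> tau x = trU x"
  using tau_limit[of "\<lambda>_. x" x] U_closed[of x] by (simp add: LIMSEQ_const_iff)

text \<open>Each identity holds on \<open>U\<close> and survives limits because the operations are
  continuous; positivity survives because the nonnegative reals are closed.\<close>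

lemma tracial_state_tau: "tracial_state A tau"
  unfolding tracial_state_def linear_functional_def
proof (intro conjI ballI allI)
  fix x y assume xy: "x \<in> carrier A" "y \<in> carrier A"
  note ax = approx_U[OF xy(1)] xy(1) approx_tends[OF xy(1)]
  note ay = approx_U[OF xy(2)] xy(2) approx_tends[OF xy(2)]
  have cl: "approx x n \<in> carrier A" "approx y n \<in> carrier A" for n
    using ax(1) ay(1) U_closed by auto
  have "(\<lambda>n. trU (approx x n \<oplus> approx y n)) \<longlonglongrightarrow> tau (x \<oplus> y)"
    using xy ax ay cl by (intro tau_limit U_add tends_add) auto
  moreover have "(\<lambda>n. trU (approx x n \<oplus> approx y n)) \<longlonglongrightarrow> tau x + tau y"
    using tendsto_add[OF tau_limit[OF ax] tau_limit[OF ay]] ax ay by (simp add: trU_add)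
  ultimately show "tau (x \<oplus> y) = tau x + tau y"
    using LIMSEQ_unique by blast
  have "(\<lambda>n. trU (approx x n \<otimes> approx y n)) \<longlonglongrightarrow> tau (x \<otimes> y)"
    using xy ax ay cl by (intro tau_limit U_mult tends_mult) auto
  moreover have "(\<lambda>n. trU (approx y n \<otimes> approx x n)) \<longlonglongrightarrow> tau (y \<otimes> x)"
    using xy ax ay cl by (intro tau_limit U_mult tends_mult) auto
  moreover have "trU (approx x n \<otimes> approx y n) = trU (approx y n \<otimes> approx x n)" for n
    using ax ay by (intro trU_mult)
  ultimately show "tau (x \<otimes> y) = tau (y \<otimes> x)"
    using LIMSEQ_unique by simp
next
  fix x c assume x: "x \<in> carrier A"
  note ax = approx_U[OF x] x approx_tends[OF x]
  have cl: "approx x n \<in> carrier A" for n using ax(1) U_closed by auto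
  have "(\<lambda>n. trU (c \<odot> approx x n)) \<longlonglongrightarrow> tau (c \<odot> x)"
    using x ax cl by (intro tau_limit U_smult tends_smult) auto
  moreover have "(\<lambda>n. trU (c \<odot> approx x n)) \<longlonglongrightarrow> c * tau x"
    using tendsto_mult[OF tendsto_const tau_limit[OF ax]] ax by (simp add: trU_smult)
  ultimately show "tau (c \<odot> x) = c * tau x"
    using LIMSEQ_unique by blast
next
  fix x assume x: "x \<in> carrier A"
  note ax = approx_U[OF x] x approx_tends[OF x]
  have cl: "approx x n \<in> carrier A" for n using ax(1) U_closed by auto
  have "(\<lambda>n. trU (star A (approx x n) \<otimes> approx x n)) \<longlonglongrightarrow> tau (star A x \<otimes> x)"
    using x ax cl by (intro tau_limit U_mult U_star tends_mult tends_star) auto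
  thus "tau (star A x \<otimes> x) \<in> \<real>\<^sub>\<ge>\<^sub>0"
    using closed_sequentially[OF closed_nonneg_Reals_complex, of "\<lambda>n. trU (star A (approx x n) \<otimes> approx x n)"]
      trU_star_mult[OF ax(1)] by blast
next
  have "\<one> \<in> U" using one_D by (auto simp: U_def)
  thus "tau \<one> = 1"
    using tau_U trU_eq[OF one_D] tr_facts(3) by simp
qed

end

lemma (in unital_cstar_algebra)
  assumes "tracial_state A t"
  shows tracial_state_linear: "linear_functional A t"
    and tracial_state_one: "t \<one> = 1"
    and tracial_state_pos: "x \<in> carrier A \<Longrightarrow> t (star A x \<otimes> x) \<in> \<real>\<^sub>\<ge>\<^sub>0"
    and tracial_state_pos': "x \<in> carrier A \<Longrightarrow> 0 \<le> Re (t (star A x \<otimes> x))"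
    and tracial_state_commute: "\<lbrakk>x \<in> carrier A; y \<in> carrier A\<rbrakk> \<Longrightarrow> t (x \<otimes> y) = t (y \<otimes> x)"
  using assms by (auto simp: tracial_state_def complex_nonneg_Reals_iff)

text \<open>Hermitian symmetry follows from the reality of the values at \<open>(1 + cx)* (1 + cx)\<close> for \<open>c = 1, \<i>\<close>.\<close>

lemma (in unital_cstar_algebra) tracial_state_star:
  assumes t: "tracial_state A t" and x: "x \<in> carrier A"
  shows "t (star A x) = cnj (t x)"
proof -
  note lin = linear_functionalD[OF tracial_state_linear[OF t]]
  have real: "Im (t (star A y \<otimes> y)) = 0" if "y \<in> carrier A" for y
    using tracial_state_pos[OF t that] by (simp add: complex_nonneg_Reals_iff)
  have ex: "t (star A (\<one> \<oplus> c \<odot> x) \<otimes> (\<one> \<oplus> c \<odot> x))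
      = 1 + c * t x + cnj c * t (star A x) + cnj c * c * t (star A x \<otimes> x)" for c
    using x tracial_state_one[OF t]
    by (simp add: star_add star_smult mult_add_left mult_add_right smult_mult_left smult_mult_right
        lin algebra_simps)
  have "Im (t x) + Im (t (star A x)) = 0"
    using real[of "\<one> \<oplus> 1 \<odot> x"] real[OF x] x by (simp only: ex cs_add_closed one_closed cs_smult_closed) simp
  moreover have "Re (t x) - Re (t (star A x)) = 0"
    using real[of "\<one> \<oplus> \<i> \<odot> x"] real[OF x] x by (simp only: ex cs_add_closed one_closed cs_smult_closed) simp
  ultimately show ?thesis by (simp add: complex_eq_iff)
qed

section \<open>Factorisation of positive semidefinite kernels\<close>

text \<open>Cholesky factorisation by induction on \<open>I\<close>: one index is eliminated by
  passing to the Schur complement. It turns a positive kernel into the sums of y* y that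
  \<open>mat_pos\<close> demands.\<close>

lemma psd_factor:
  fixes K :: "'i \<Rightarrow> 'i \<Rightarrow> complex"
  assumes "finite I"
    and "\<And>i j. \<lbrakk>i \<in> I; j \<in> I\<rbrakk> \<Longrightarrow> K j i = cnj (K i j)"
    and "\<And>c. 0 \<le> Re (\<Sum>i\<in>I. \<Sum>j\<in>I. cnj (c i) * c j * K i j)"
  shows "\<exists>V. \<forall>i\<in>I. \<forall>j\<in>I. K i j = (\<Sum>s\<in>I. cnj (V s i) * V s j)"
  using assms
proof (induction I arbitrary: K rule: finite_induct)
  case (insert a I)
  have herm: "K j i = cnj (K i j)" if "i \<in> insert a I" "j \<in> insert a I" for i j
    using insert.prems(1) that by blast
  have split: "(\<Sum>i\<in>insert a I. \<Sum>j\<in>insert a I. cnj (c i) * c j * K i j)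
      = cnj (c a) * c a * K a a + (\<Sum>j\<in>I. cnj (c a) * c j * K a j)
        + (\<Sum>i\<in>I. cnj (c i) * c a * K i a) + (\<Sum>i\<in>I. \<Sum>j\<in>I. cnj (c i) * c j * K i j)" for c
    using insert.hyps by (simp add: sum.distrib)
  have psd: "0 \<le> Re (cnj (c a) * c a * K a a + (\<Sum>j\<in>I. cnj (c a) * c j * K a j)
        + (\<Sum>i\<in>I. cnj (c i) * c a * K i a) + (\<Sum>i\<in>I. \<Sum>j\<in>I. cnj (c i) * c j * K i j))" for c
    using insert.prems(2)[of c] by (simp only: split)
  define d where "d = Re (K a a)"
  have Kaa: "K a a = of_real d"
    using herm[of a a] by (simp add: d_def complex_eq_iff)
  have d0: "0 \<le> d"
  proof -
    define c :: "'i \<Rightarrow> complex" where "c = (\<lambda>i. if i = a then 1 else 0)"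
    have "c a = 1" "\<And>i. i \<in> I \<Longrightarrow> c i = 0" using insert.hyps(2) by (auto simp: c_def)
    thus ?thesis using psd[of c] by (simp add: d_def)
  qed
  \<comment> \<open>A zero diagonal entry forces a zero row: with entry -t \<open>K a i\<close> at a
    and 1 at i, the form equals b - 2tm, which cannot stay nonnegative for large t.\<close>
  have K0: "K a i = 0" if i: "i \<in> I" and d: "d = 0" for i
  proof (rule ccontr)
    assume nz: "K a i \<noteq> 0"
    have ai: "a \<noteq> i" using i insert.hyps by auto
    define b where "b = Re (K i i)"
    define m where "m = (cmod (K a i))\<^sup>2"
    have m: "m > 0" using nz by (simp add: m_def)
    have m': "complex_of_real m = K a i * cnj (K a i)"
      by (simp only: m_def complex_norm_square)
    have "0 \<le> - 2 * t * m + b" for t :: real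
    proof -
      define c where "c = (\<lambda>j. if j = a then - of_real t * K a i else if j = i then 1 else 0)"
      have c: "c a = - of_real t * K a i" "c i = 1" "\<And>j. \<lbrakk>j \<in> I; j \<noteq> i\<rbrakk> \<Longrightarrow> c j = 0"
        using ai insert.hyps by (auto simp: c_def)
      have single: "(\<Sum>j\<in>I. f j) = f i" if "\<And>j. \<lbrakk>j \<in> I; j \<noteq> i\<rbrakk> \<Longrightarrow> f j = 0" for f :: "'i \<Rightarrow> complex"
        using that i insert.hyps(1) by (simp add: sum.remove[of I i] sum.neutral)
      have "0 \<le> Re (cnj (c a) * K a i + c a * K i a + K i i)"
        using psd[of c] d by (simp add: Kaa single c(2,3))
      also have "K i a = cnj (K a i)" using herm[of a i] i by simp
      also have "cnj (c a) * K a i + c a * cnj (K a i) + K i i = of_real (- 2 * t * m) + K i i"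
        by (simp add: c(1) m' algebra_simps)
      finally show ?thesis by (simp add: b_def)
    qed
    \<comment> \<open>This t makes the value equal to -1.\<close>
    from this[of "(b + 1) / (2 * m)"] m show False by (simp add: field_simps)
  qed
  \<comment> \<open>The Schur complement. For \<open>d = 0\<close> the quotient is 0 and
    \<open>K'\<close> is \<open>K\<close>.\<close>
  define K' where "K' = (\<lambda>i j. K i j - K i a * K a j / of_real d)"
  have herm': "K' j i = cnj (K' i j)" if "i \<in> I" "j \<in> I" for i j
    using herm[of i j] herm[of i a] herm[of a j] that by (simp add: K'_def)
  have psd': "0 \<le> Re (\<Sum>i\<in>I. \<Sum>j\<in>I. cnj (c i) * c j * K' i j)" for c
  proof (cases "d = 0")
    case True
    have "(\<Sum>i\<in>I. \<Sum>j\<in>I. cnj (c i) * c j * K' i j) = (\<Sum>i\<in>I. \<Sum>j\<in>I. cnj (c i) * c j * K i j)"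
      using True by (simp add: K'_def)
    moreover have "0 \<le> Re (\<Sum>i\<in>I. \<Sum>j\<in>I. cnj (c i) * c j * K i j)"
    proof -
      have "(\<Sum>i\<in>I. \<Sum>j\<in>I. cnj (if i = a then 0 else c i) * (if j = a then 0 else c j) * K i j)
        = (\<Sum>i\<in>I. \<Sum>j\<in>I. cnj (c i) * c j * K i j)"
        using insert.hyps(2) by (intro sum.cong refl) auto
      thus ?thesis
        using psd[of "\<lambda>i. if i = a then 0 else c i"] by simp
    qed
    ultimately show ?thesis by simp
  next
    case False
    define s where "s = (\<Sum>j\<in>I. K a j * c j)"
    \<comment> \<open>The entry at a that minimises the form when the other entries are fixed; the
      minimum is the form of the Schur complement.\<close>
    define c' where "c' = (\<lambda>i. if i = a then - s / of_real d else c i)"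
    have c': "c' a = - s / of_real d" "\<And>i. i \<in> I \<Longrightarrow> c' i = c i"
      using insert.hyps(2) by (auto simp: c'_def)
    have s': "(\<Sum>i\<in>I. cnj (c i) * K i a) = cnj s"
      unfolding s_def cnj_sum
      by (intro sum.cong refl) (simp add: herm[of a] mult.commute)
    have "0 \<le> Re (cnj (c' a) * c' a * K a a + (\<Sum>j\<in>I. cnj (c' a) * c' j * K a j)
        + (\<Sum>i\<in>I. cnj (c' i) * c' a * K i a) + (\<Sum>i\<in>I. \<Sum>j\<in>I. cnj (c' i) * c' j * K i j))"
      by (rule psd)
    also have "(\<Sum>j\<in>I. cnj (c' a) * c' j * K a j) = cnj (c' a) * s"
      unfolding s_def sum_distrib_left by (intro sum.cong refl) (simp add: c' mult_ac)
    also have "(\<Sum>i\<in>I. cnj (c' i) * c' a * K i a) = c' a * cnj s"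
      unfolding s'[symmetric] sum_distrib_left by (intro sum.cong refl) (simp add: c' mult_ac)
    also have "(\<Sum>i\<in>I. \<Sum>j\<in>I. cnj (c' i) * c' j * K i j) = (\<Sum>i\<in>I. \<Sum>j\<in>I. cnj (c i) * c j * K i j)"
      by (intro sum.cong refl) (simp add: c')
    also have "cnj (c' a) * c' a * K a a + cnj (c' a) * s + c' a * cnj s
        + (\<Sum>i\<in>I. \<Sum>j\<in>I. cnj (c i) * c j * K i j)
      = (\<Sum>i\<in>I. \<Sum>j\<in>I. cnj (c i) * c j * K i j) - cnj s * s / of_real d"
      using False by (simp add: c'(1) Kaa)
    also have "cnj s * s / of_real d = (\<Sum>i\<in>I. \<Sum>j\<in>I. cnj (c i) * c j * (K i a * K a j / of_real d))"
      unfolding s'[symmetric] unfolding s_def sum_product sum_divide_distrib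
      by (intro sum.cong refl) (simp add: mult_ac)
    also have "(\<Sum>i\<in>I. \<Sum>j\<in>I. cnj (c i) * c j * K i j) - \<dots> = (\<Sum>i\<in>I. \<Sum>j\<in>I. cnj (c i) * c j * K' i j)"
      by (simp add: K'_def sum_subtractf[symmetric] right_diff_distrib)
    finally show ?thesis .
  qed
  obtain V where V: "\<And>i j. \<lbrakk>i \<in> I; j \<in> I\<rbrakk> \<Longrightarrow> K' i j = (\<Sum>s\<in>I. cnj (V s i) * V s j)"
    using insert.IH[OF herm' psd'] by blast
  \<comment> \<open>The new row a of the factor. For \<open>d = 0\<close> it is 0 by division by
    zero, in agreement with \<open>K0\<close>.\<close>
  define V' where "V' = (\<lambda>s i. if s = a then K a i / of_real (sqrt d) else if i = a then 0 else V s i)"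
  have sq: "of_real (sqrt d) * of_real (sqrt d) = (of_real d :: complex)"
    using d0 by (metis of_real_mult real_sqrt_mult_self abs_of_nonneg)
  have V'_sum: "(\<Sum>s\<in>insert a I. cnj (V' s i) * V' s j)
      = cnj (K a i) * K a j / of_real d + (\<Sum>s\<in>I. cnj (V' s i) * V' s j)" for i j
    using insert.hyps by (simp add: V'_def sq)
  have rest: "(\<Sum>s\<in>I. cnj (V' s i) * V' s j) = (if i = a \<or> j = a then 0 else (\<Sum>s\<in>I. cnj (V s i) * V s j))" for i j
    using insert.hyps(2) by (auto simp: V'_def intro!: sum.cong sum.neutral)
  have "K i j = (\<Sum>s\<in>insert a I. cnj (V' s i) * V' s j)"
    if ij: "i \<in> insert a I" "j \<in> insert a I" for i j
  proof -
    have Kia: "cnj (K a i) = K i a" using herm[of a i] ij by simp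
    consider "i = a" "j = a" | "i = a" "j \<in> I" | "i \<in> I" "j = a" | "i \<in> I" "j \<in> I" using ij by blast
    thus ?thesis
    proof cases
      case 1
      thus ?thesis unfolding V'_sum rest by (simp add: Kaa)
    next
      case 2
      thus ?thesis unfolding V'_sum rest using K0[of j] by (simp add: Kaa)
    next
      case 3
      hence "d = 0 \<Longrightarrow> K i a = 0" using K0[of i] Kia by simp
      thus ?thesis unfolding V'_sum rest using 3 Kia by (auto simp: Kaa)
    next
      case 4
      hence "i \<noteq> a" "j \<noteq> a" using insert.hyps(2) by auto
      thus ?thesis unfolding V'_sum rest using V[OF 4] Kia by (simp add: K'_def diff_eq_eq)
    qed
  qed
  thus ?case by blast
qed simp

section \<open>The conditional expectation onto a matrix subalgebra\<close>

locale matrix_units_trace = matrix_units +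
  fixes t
  assumes tracial: "tracial_state A t"
begin

lemmas t_lin = linear_functionalD[OF tracial_state_linear[OF tracial]]
lemmas t_one = tracial_state_one[OF tracial]
lemmas t_pos = tracial_state_pos'[OF tracial]
lemmas t_commute = tracial_state_commute[OF tracial]
lemmas t_star = tracial_state_star[OF tracial]

section \<open>The trace inner product and the norm it determines\<close>

definition sq2 :: "'a \<Rightarrow> real" where
  "sq2 x = Re (t (star A x \<otimes> x))"

lemma sq2_nonneg: "x \<in> carrier A \<Longrightarrow> 0 \<le> sq2 x"
  by (simp add: sq2_def t_pos)

lemma sq2_minus:
  assumes "x \<in> carrier A" "y \<in> carrier A"
  shows "sq2 (x \<ominus> y) = sq2 x - 2 * Re (t (star A y \<otimes> x)) + sq2 y"
proof -
  have "t (star A x \<otimes> y) = cnj (t (star A y \<otimes> x))"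
    using assms by (simp add: t_star[symmetric] star_mult star_star)
  thus ?thesis
    using assms by (simp add: sq2_def star_minus cs_minus_mult cs_mult_minus t_lin)
qed

lemma sq2_smult: "x \<in> carrier A \<Longrightarrow> sq2 (complex_of_real c \<odot> x) = c\<^sup>2 * sq2 x"
  by (simp add: sq2_def star_smult smult_mult_left smult_mult_right t_lin power2_eq_square)

lemma t_mtrace: "x \<in> mspan \<Longrightarrow> t x = mtrace x"
  by (rule mtrace_unique) (auto simp: t_lin t_one mspan_closed intro: t_commute)

lemma t_e: "\<lbrakk>i \<in> W; j \<in> W\<rbrakk> \<Longrightarrow> t (e i j) = (if i = j then 1 / of_nat (card W) else 0)"
proof -
  assume ij: "i \<in> W" "j \<in> W"
  have "(\<Sum>k\<in>W. coord (e i j) k k) = (\<Sum>k\<in>W. if k = i then (if i = j then 1 else 0) else 0)"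
    using ij by (intro sum.cong refl) (auto simp: coord_e)
  thus ?thesis
    using ij by (simp add: t_mtrace e_mspan mtrace_def sum.delta)
qed

text \<open>This is \<open>positive_functional_bound\<close> for the functional x -> t (b* x b):
  left multiplication by a is bounded by ||a|| for the trace inner product.\<close>

lemma sq2_mult_le:
  assumes a: "a \<in> carrier A" and b: "b \<in> carrier A"
  shows "sq2 (a \<otimes> b) \<le> (nrm A a)\<^sup>2 * sq2 b"
proof -
  define f where "f = (\<lambda>x. t (star A b \<otimes> x \<otimes> b))"
  have f: "linear_functional A f"
    using b by (simp add: linear_functional_def f_def mult_add_left mult_add_right smult_mult_left
        smult_mult_right t_lin)
  have eq: "f (star A y \<otimes> y) = t (star A (y \<otimes> b) \<otimes> (y \<otimes> b))" if "y \<in> carrier A" for y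
    using that b by (simp add: f_def star_mult mult_assoc)
  have "Re (f (star A a \<otimes> a)) \<le> (nrm A a)\<^sup>2 * Re (f \<one>)"
    using b by (intro positive_functional_bound[OF f _ a]) (simp add: eq t_pos)
  thus ?thesis
    using a b by (simp add: eq sq2_def) (simp add: f_def)
qed

text \<open>Each of the N^2 coordinates, N = \<open>card W\<close>, is at most the square root of N
  \<open>sq2 x\<close>; summing and squaring gives N^4 * N. It matters only that the constant
  depends on \<open>W\<close> alone.\<close>

lemma nrm_le_sq2:
  assumes "x \<in> mspan"
  shows "(nrm A x)\<^sup>2 \<le> real (card W) ^ 5 * sq2 x"
proof -
  let ?n = "real (card W)"
  define q where "q = ?n * sq2 x"
  have q: "q = (\<Sum>i\<in>W. \<Sum>k\<in>W. (cmod (coord x k i))\<^sup>2)"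
    unfolding q_def sq2_def using assms
    by (simp add: t_mtrace mspan_mult mspan_star mtrace_star_mult)
  have le: "cmod (coord x k i) \<le> sqrt q" if "k \<in> W" "i \<in> W" for k i
  proof (rule real_le_rsqrt)
    have "(cmod (coord x k i))\<^sup>2 \<le> (\<Sum>k\<in>W. (cmod (coord x k i))\<^sup>2)"
      using that by (intro member_le_sum) auto
    also have "\<dots> \<le> q"
      unfolding q using that by (intro member_le_sum[of i W "\<lambda>i. \<Sum>k\<in>W. (cmod (coord x k i))\<^sup>2"] sum_nonneg) auto
    finally show "(cmod (coord x k i))\<^sup>2 \<le> q" .
  qed
  have q0: "0 \<le> q" unfolding q by (intro sum_nonneg) auto
  have "nrm A x \<le> (\<Sum>i\<in>W. \<Sum>j\<in>W. cmod (coord x i j))"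
    using assms by (rule nrm_le_coord)
  also have "\<dots> \<le> (\<Sum>i\<in>W. \<Sum>j\<in>W. sqrt q)"
    using le by (intro sum_mono) auto
  also have "\<dots> = ?n * ?n * sqrt q" by simp
  finally have "(nrm A x)\<^sup>2 \<le> (?n * ?n * sqrt q)\<^sup>2"
    using nrm_nonneg[of x] mspan_closed[OF assms] by (intro power_mono) auto
  also have "\<dots> = ?n ^ 4 * q"
    using q0 by (simp add: power_mult_distrib power2_eq_square eval_nat_numeral mult_ac)
  finally show ?thesis
    by (simp add: q_def eval_nat_numeral mult_ac)
qed

text \<open>The bound passes from \<open>x\<close> to \<open>x*\<close> by expanding \<open>sq2 (c\<^sup>2 b - x x* b) \<ge> 0\<close>. It then holds for
  the powers of \<open>x* x\<close>, and the constant that compares the two norms on the matrix subalgebra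
  disappears on taking roots.\<close>

lemma nrm_le_if_sq2_le:
  assumes x: "x \<in> mspan" and C: "0 \<le> C" and le: "\<And>b. b \<in> mspan \<Longrightarrow> sq2 (x \<otimes> b) \<le> C\<^sup>2 * sq2 b"
  shows "nrm A x \<le> C"
proof (rule field_le_epsilon)
  fix r :: real assume r: "0 < r"
  \<comment> \<open>The slack r makes c positive, so that a factor c^2 can be cancelled in
    \<open>le2\<close>.\<close>
  define c where "c = C + r"
  have c: "c > 0" "C\<^sup>2 \<le> c\<^sup>2" using C r by (auto simp: c_def power_mono)
  note xc = mspan_closed[OF x]
  have le1: "sq2 (x \<otimes> b) \<le> c\<^sup>2 * sq2 b" if "b \<in> mspan" for b
    using le[OF that] mult_right_mono[OF c(2) sq2_nonneg[OF mspan_closed[OF that]]] by linarith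
  have le2: "sq2 (star A x \<otimes> b) \<le> c\<^sup>2 * sq2 b" if b: "b \<in> mspan" for b
  proof -
    note bc = mspan_closed[OF b]
    define y where "y = star A x \<otimes> b"
    have y: "y \<in> mspan" "y \<in> carrier A"
      using x b by (auto simp: y_def mspan_mult mspan_star mspan_closed)
    have "t (star A (x \<otimes> y) \<otimes> b) = t (star A y \<otimes> y)"
      using xc bc y by (simp add: star_mult mult_assoc y_def)
    hence "0 \<le> (c\<^sup>2)\<^sup>2 * sq2 b - 2 * c\<^sup>2 * sq2 y + sq2 (x \<otimes> y)"
      using sq2_nonneg[of "complex_of_real (c\<^sup>2) \<odot> b \<ominus> x \<otimes> y"] xc bc y
        sq2_smult[OF bc, of "c\<^sup>2"]
      by (simp add: sq2_minus smult_mult_right t_lin sq2_def[of y])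
    also have "\<dots> \<le> (c\<^sup>2)\<^sup>2 * sq2 b - 2 * c\<^sup>2 * sq2 y + c\<^sup>2 * sq2 y"
      using le1[OF y(1)] by (simp add: mult.commute)
    also have "\<dots> = c\<^sup>2 * (c\<^sup>2 * sq2 b - sq2 y)"
      by (simp add: algebra_simps power2_eq_square)
    finally show ?thesis
      using c by (simp add: y_def zero_le_mult_iff)
  qed
  define h where "h = star A x \<otimes> x"
  have h: "h \<in> mspan" "h \<in> carrier A" "star A h = h"
    using x xc by (auto simp: h_def mspan_mult mspan_star star_mult star_star)
  have hn: "dyadic_pow h n \<in> mspan" for n
    by (induction n) (auto simp: h mspan_mult)
  \<comment> \<open>Left multiplication by x* x scales lengths by at most c^2, hence
    \<open>sq2\<close> by c^4; every dyadic step squares the bound.\<close>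
  have le3: "sq2 (dyadic_pow h n \<otimes> b) \<le> (c ^ 4) ^ (2 ^ n) * sq2 b" if "b \<in> mspan" for b n
    using that
  proof (induction n arbitrary: b)
    case 0
    have "sq2 (h \<otimes> b) = sq2 (star A x \<otimes> (x \<otimes> b))"
      using 0 xc mspan_closed by (simp add: h_def mult_assoc)
    also have "\<dots> \<le> c\<^sup>2 * sq2 (x \<otimes> b)"
      using 0 x by (intro le2 mspan_mult)
    also have "\<dots> \<le> c\<^sup>2 * (c\<^sup>2 * sq2 b)"
      using 0 by (intro mult_left_mono le1) auto
    finally show ?case by (simp add: eval_nat_numeral mult_ac)
  next
    case (Suc n)
    have "sq2 (dyadic_pow h (Suc n) \<otimes> b) = sq2 (dyadic_pow h n \<otimes> (dyadic_pow h n \<otimes> b))"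
      using Suc.prems h mspan_closed by (simp add: mult_assoc)
    also have "\<dots> \<le> (c ^ 4) ^ (2 ^ n) * sq2 (dyadic_pow h n \<otimes> b)"
      using Suc.prems by (intro Suc.IH mspan_mult hn)
    also have "\<dots> \<le> (c ^ 4) ^ (2 ^ n) * ((c ^ 4) ^ (2 ^ n) * sq2 b)"
      using c by (intro mult_left_mono Suc.IH Suc.prems) auto
    also have "\<dots> = (c ^ 4) ^ (2 ^ Suc n) * sq2 b"
      by (simp add: power_add[symmetric] mult.assoc[symmetric] mult_2)
    finally show ?case .
  qed
  let ?n = "real (card W)"
  have "((nrm A h)\<^sup>2) ^ (2 ^ n) \<le> ?n ^ 5 * (c ^ 4) ^ (2 ^ n)" for n
  proof -
    have "((nrm A h)\<^sup>2) ^ (2 ^ n) = (nrm A (dyadic_pow h n))\<^sup>2"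
      using h by (simp add: nrm_dyadic_pow power_mult[symmetric] mult.commute)
    also have "\<dots> \<le> ?n ^ 5 * sq2 (dyadic_pow h n)"
      by (rule nrm_le_sq2[OF hn])
    also have "sq2 (dyadic_pow h n) \<le> (c ^ 4) ^ (2 ^ n)"
      using le3[OF mspan_one, of n] h by (simp add: sq2_def t_one)
    finally show ?thesis
      by (simp add: mult_left_mono)
  qed
  hence "(nrm A h)\<^sup>2 \<le> c ^ 4"
    using c by (rule_tac le_if_dyadic_powers_le[of _ _ "?n ^ 5"]) auto
  hence "(nrm A x) ^ 4 \<le> c ^ 4"
    using cstar_identity[OF xc] by (simp add: h_def power_mult[symmetric])
  thus "nrm A x \<le> C + r"
    using c nrm_nonneg[OF xc] by (simp add: c_def[symmetric] power_mono_iff)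
qed

text \<open>The factor \<open>card W\<close> is the inverse of t (e j i e i j), so the coefficients
  are those forced by requiring \<open>cexp a\<close> and a to have the same trace against every
  unit.\<close>

definition cexp :: "'a \<Rightarrow> 'a" where
  "cexp a = synth (\<lambda>i j. of_nat (card W) * t (e j i \<otimes> a))"

lemma cexp_mspan [simp, intro]: "cexp a \<in> mspan"
  by (simp add: cexp_def)

lemma cexp_closed [simp, intro]: "cexp a \<in> carrier A"
  by (simp add: cexp_def)

lemma coord_cexp: "\<lbrakk>i \<in> W; j \<in> W\<rbrakk> \<Longrightarrow> coord (cexp a) i j = of_nat (card W) * t (e j i \<otimes> a)"
  by (simp add: cexp_def coord_synth)

lemma cexp_add:
  "\<lbrakk>a \<in> carrier A; b \<in> carrier A\<rbrakk> \<Longrightarrow> cexp (a \<oplus> b) = cexp a \<oplus> cexp b"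
  by (rule mspan_eqI) (auto simp: mspan_add coord_add coord_cexp mult_add_right t_lin algebra_simps)

lemma cexp_smult: "a \<in> carrier A \<Longrightarrow> cexp (c \<odot> a) = c \<odot> cexp a"
  by (rule mspan_eqI) (auto simp: mspan_smult coord_smult coord_cexp smult_mult_right t_lin)

lemma cexp_id:
  assumes "x \<in> mspan"
  shows "cexp x = x"
proof (rule mspan_eqI)
  fix i j assume ij: "i \<in> W" "j \<in> W"
  have "t (e j i \<otimes> x) = (\<Sum>k\<in>W. coord (e j i \<otimes> x) k k) / of_nat (card W)"
    using assms ij by (simp add: t_mtrace mspan_mult e_mspan mtrace_def)
  also have "(\<Sum>k\<in>W. coord (e j i \<otimes> x) k k) = (\<Sum>k\<in>W. if k = j then coord x i j else 0)"
  proof (rule sum.cong[OF refl])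
    fix k assume k: "k \<in> W"
    have "coord (e j i \<otimes> x) k k = (\<Sum>l\<in>W. coord (e j i) k l * coord x l k)"
      using assms ij k by (intro coord_mult) auto
    also have "\<dots> = (\<Sum>l\<in>W. if l = i then (if k = j then coord x i k else 0) else 0)"
      using ij k by (intro sum.cong refl) (auto simp: coord_e)
    finally show "coord (e j i \<otimes> x) k k = (if k = j then coord x i j else 0)"
      using ij by (simp add: sum.delta)
  qed
  also have "\<dots> = coord x i j"
    using ij by (simp add: sum.delta)
  finally show "coord (cexp x) i j = coord x i j"
    using ij by (simp add: coord_cexp)
qed (use assms in auto)

text \<open>By linearity y may be a unit. The trace of a unit times a is a coordinate of
  \<open>cexp a\<close>, and idempotence of \<open>cexp\<close> makes this the same coordinate
  computation for \<open>cexp a\<close>.\<close>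

lemma t_mult_cexp:
  assumes a: "a \<in> carrier A" and y: "y \<in> mspan"
  shows "t (y \<otimes> cexp a) = t (y \<otimes> a)"
proof -
  have ex: "t (y \<otimes> b) = (\<Sum>i\<in>W. \<Sum>j\<in>W. coord y i j * t (e i j \<otimes> b))" if b: "b \<in> carrier A" for b
  proof -
    have "y \<otimes> b = (\<Oplus>i\<in>W. \<Oplus>j\<in>W. coord y i j \<odot> e i j) \<otimes> b"
      using synth_coord[OF y] by (simp add: synth_def)
    also have "\<dots> = (\<Oplus>i\<in>W. (\<Oplus>j\<in>W. coord y i j \<odot> e i j) \<otimes> b)"
      using b by (intro finsum_mult cs_finsum_closed) auto
    also have "\<dots> = (\<Oplus>i\<in>W. \<Oplus>j\<in>W. (coord y i j \<odot> e i j) \<otimes> b)"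
      using b by (intro cs_finsum_cong finsum_mult cs_finsum_closed) auto
    finally show ?thesis
      using b by (simp add: t_lin(5) cs_finsum_closed smult_mult_left t_lin(2))
  qed
  have "t (e i j \<otimes> cexp a) = t (e i j \<otimes> a)" if ij: "i \<in> W" "j \<in> W" for i j
  proof -
    have "t (e i j \<otimes> cexp a) = coord (cexp (cexp a)) j i / of_nat (card W)"
      using ij by (simp add: coord_cexp)
    also have "\<dots> = t (e i j \<otimes> a)"
      using ij by (simp add: cexp_id coord_cexp)
    finally show ?thesis .
  qed
  thus ?thesis
    using a by (simp add: ex)
qed

text \<open>\<open>cexp a b\<close> is the orthogonal projection of \<open>a b\<close> for the trace inner product.\<close>

lemma nrm_cexp_le:
  assumes a: "a \<in> carrier A"
  shows "nrm A (cexp a) \<le> nrm A a"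
proof (rule nrm_le_if_sq2_le)
  fix b assume b: "b \<in> mspan"
  note bc = mspan_closed[OF b]
  define y where "y = b \<otimes> star A (cexp a \<otimes> b)"
  have y: "y \<in> mspan" "y \<in> carrier A"
    using b bc by (auto simp: y_def mspan_mult mspan_star)
  have "t (star A (cexp a \<otimes> b) \<otimes> (a \<otimes> b)) = t (y \<otimes> a)"
    using a bc t_commute[of "star A (cexp a \<otimes> b) \<otimes> a" b]
    by (simp add: y_def mult_assoc)
  also have "\<dots> = t (y \<otimes> cexp a)"
    using a y by (simp add: t_mult_cexp)
  also have "\<dots> = t (star A (cexp a \<otimes> b) \<otimes> (cexp a \<otimes> b))"
    using a bc t_commute[of "star A (cexp a \<otimes> b) \<otimes> cexp a" b]
    by (simp add: y_def mult_assoc)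
  finally have "Re (t (star A (cexp a \<otimes> b) \<otimes> (a \<otimes> b))) = sq2 (cexp a \<otimes> b)"
    by (simp add: sq2_def)
  moreover have "sq2 (a \<otimes> b \<ominus> cexp a \<otimes> b)
      = sq2 (a \<otimes> b) - 2 * Re (t (star A (cexp a \<otimes> b) \<otimes> (a \<otimes> b))) + sq2 (cexp a \<otimes> b)"
    using a bc by (intro sq2_minus) auto
  ultimately have "0 \<le> sq2 (a \<otimes> b) - sq2 (cexp a \<otimes> b)"
    using sq2_nonneg[of "a \<otimes> b \<ominus> cexp a \<otimes> b"] a bc by simp
  thus "sq2 (cexp a \<otimes> b) \<le> (nrm A a)\<^sup>2 * sq2 b"
    using sq2_mult_le[OF a bc] by simp
qed (use a nrm_nonneg in auto)

text \<open>This is complete positivity of the expectation. The coordinates of all entries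
  \<open>cexp (x i j)\<close> form one kernel \<open>K\<close>, indexed by pairs of a matrix
  position and a unit index; its quadratic form is a sum of traces of squares. A factor of
  \<open>K\<close> then supplies the coordinates of z.\<close>

lemma cexp_mat_pos:
  fixes n :: nat
  assumes y: "\<And>i j. \<lbrakk>i < n; j < n\<rbrakk> \<Longrightarrow> y i j \<in> carrier A"
    and x: "\<And>i j. \<lbrakk>i < n; j < n\<rbrakk> \<Longrightarrow> x i j = (\<Oplus>l\<in>{..<n}. star A (y l i) \<otimes> y l j)"
  obtains z where "\<And>i j. z i j \<in> mspan"
    and "\<And>i j. \<lbrakk>i < n; j < n\<rbrakk> \<Longrightarrow> cexp (x i j) = (\<Oplus>l\<in>{..<n}. star A (z l i) \<otimes> z l j)"
proof -
  let ?N = "of_nat (card W) :: complex"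
  let ?I = "{..<n} \<times> W"
  define K where "K = (\<lambda>a b. ?N * t (e (snd b) (snd a) \<otimes> x (fst a) (fst b)))"
  obtain w where w: "w \<in> W" using W_nonempty by blast
  have xc: "x i j \<in> carrier A" if "i < n" "j < n" for i j
    using that y by (auto simp: x intro!: cs_finsum_closed)
  have star_x: "star A (x i j) = x j i" if "i < n" "j < n" for i j
  proof -
    have "star A (x i j) = (\<Oplus>l\<in>{..<n}. star A (star A (y l i) \<otimes> y l j))"
      unfolding x[OF that] using that y by (intro star_finsum) auto
    also have "\<dots> = x j i"
      unfolding x[OF that(2,1)] using that y by (intro cs_finsum_cong) (auto simp: star_mult star_star)
    finally show ?thesis .
  qed
  have herm: "K b a = cnj (K a b)" if "a \<in> ?I" "b \<in> ?I" for a b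
  proof -
    have ab: "fst a < n" "fst b < n" "snd a \<in> W" "snd b \<in> W" using that by auto
    have "cnj (t (e (snd b) (snd a) \<otimes> x (fst a) (fst b))) = t (x (fst b) (fst a) \<otimes> e (snd a) (snd b))"
      using ab xc by (simp add: t_star[symmetric] star_mult star_x star_e)
    also have "\<dots> = t (e (snd a) (snd b) \<otimes> x (fst b) (fst a))"
      using ab xc by (intro t_commute) auto
    finally show ?thesis by (simp add: K_def)
  qed
  have psd: "0 \<le> Re (\<Sum>a\<in>?I. \<Sum>b\<in>?I. cnj (c a) * c b * K a b)" for c
  proof -
    define v where "v = (\<lambda>l. (\<Oplus>b\<in>?I. c b \<odot> (y l (fst b) \<otimes> e (snd b) w)))"
    have vc: "v l \<in> carrier A" if "l < n" for l
      using that w y by (auto simp: v_def intro!: cs_finsum_closed)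
    have K: "K a b = ?N * (\<Sum>l<n. t ((y l (fst b) \<otimes> e (snd b) w) \<otimes> star A (y l (fst a) \<otimes> e (snd a) w)))"
      if "a \<in> ?I" "b \<in> ?I" for a b
    proof -
      have ab: "fst a < n" "fst b < n" "snd a \<in> W" "snd b \<in> W" using that by auto
      have "e (snd b) (snd a) \<otimes> x (fst a) (fst b)
          = (\<Oplus>l\<in>{..<n}. e (snd b) (snd a) \<otimes> (star A (y l (fst a)) \<otimes> y l (fst b)))"
        unfolding x[OF ab(1,2)] using ab y by (intro mult_finsum) auto
      hence "t (e (snd b) (snd a) \<otimes> x (fst a) (fst b))
          = (\<Sum>l<n. t (e (snd b) (snd a) \<otimes> (star A (y l (fst a)) \<otimes> y l (fst b))))"
        using ab y by (simp only:) (intro t_lin(5), auto)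
      also have "\<dots> = (\<Sum>l<n. t ((y l (fst b) \<otimes> e (snd b) w) \<otimes> star A (y l (fst a) \<otimes> e (snd a) w)))"
      proof (rule sum.cong[OF refl])
        fix l assume l: "l \<in> {..<n}"
        let ?e = "e (snd b) (snd a)" and ?ya = "star A (y l (fst a))" and ?yb = "y l (fst b)"
        have "t (?e \<otimes> (?ya \<otimes> ?yb)) = t ((?e \<otimes> ?ya) \<otimes> ?yb)"
          using ab y l by (simp add: mult_assoc)
        also have "\<dots> = t (?yb \<otimes> (?e \<otimes> ?ya))"
          using ab y l by (intro t_commute) auto
        also have "\<dots> = t (?yb \<otimes> ((e (snd b) w \<otimes> e w (snd a)) \<otimes> ?ya))"
          using ab w by (simp add: e_mult)
        finally show "t (e (snd b) (snd a) \<otimes> (star A (y l (fst a)) \<otimes> y l (fst b)))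
            = t ((y l (fst b) \<otimes> e (snd b) w) \<otimes> star A (y l (fst a) \<otimes> e (snd a) w))"
          using ab y l w by (simp add: star_mult star_e mult_assoc)
      qed
      finally show ?thesis by (simp add: K_def)
    qed
    have tv: "t (v l \<otimes> star A (v l)) = (\<Sum>a\<in>?I. \<Sum>b\<in>?I. cnj (c a) * c b *
        t ((y l (fst b) \<otimes> e (snd b) w) \<otimes> star A (y l (fst a) \<otimes> e (snd a) w)))" if l: "l < n" for l
    proof -
      let ?u = "\<lambda>b. y l (fst b) \<otimes> e (snd b) w"
      have u: "?u b \<in> carrier A" if "b \<in> ?I" for b using that l y w by auto
      have "t (v l \<otimes> star A (v l)) = (\<Sum>a\<in>?I. t (v l \<otimes> star A (c a \<odot> ?u a)))"
      proof -
        have "v l \<otimes> star A (v l) = v l \<otimes> (\<Oplus>a\<in>?I. star A (c a \<odot> ?u a))"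
          unfolding v_def using u by (subst star_finsum) (auto simp del: mult_closed)
        also have "\<dots> = (\<Oplus>a\<in>?I. v l \<otimes> star A (c a \<odot> ?u a))"
          using u vc[OF l] by (intro mult_finsum) (auto simp del: mult_closed)
        finally show ?thesis
          using u vc[OF l] by (simp add: t_lin(5))
      qed
      also have "\<dots> = (\<Sum>a\<in>?I. \<Sum>b\<in>?I. t ((c b \<odot> ?u b) \<otimes> star A (c a \<odot> ?u a)))"
      proof (rule sum.cong[OF refl])
        fix a assume a: "a \<in> ?I"
        have "v l \<otimes> star A (c a \<odot> ?u a) = (\<Oplus>b\<in>?I. (c b \<odot> ?u b) \<otimes> star A (c a \<odot> ?u a))"
          unfolding v_def using u a by (intro finsum_mult) (auto simp del: mult_closed)
        thus "t (v l \<otimes> star A (c a \<odot> ?u a)) = (\<Sum>b\<in>?I. t ((c b \<odot> ?u b) \<otimes> star A (c a \<odot> ?u a)))"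
          using u a by (simp add: t_lin(5))
      qed
      also have "\<dots> = (\<Sum>a\<in>?I. \<Sum>b\<in>?I. cnj (c a) * c b * t (?u b \<otimes> star A (?u a)))"
      proof (intro sum.cong refl)
        fix a b assume "a \<in> ?I" "b \<in> ?I"
        hence ab: "?u a \<in> carrier A" "?u b \<in> carrier A" using u by auto
        show "t ((c b \<odot> ?u b) \<otimes> star A (c a \<odot> ?u a)) = cnj (c a) * c b * t (?u b \<otimes> star A (?u a))"
          using ab by (simp add: star_smult smult_mult_left smult_mult_right t_lin(2) mult_ac)
      qed
      finally show ?thesis .
    qed
    have "(\<Sum>a\<in>?I. \<Sum>b\<in>?I. cnj (c a) * c b * K a b) = ?N * (\<Sum>l<n. t (v l \<otimes> star A (v l)))"
    proof -
      have "(\<Sum>a\<in>?I. \<Sum>b\<in>?I. cnj (c a) * c b * K a b)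
        = (\<Sum>a\<in>?I. \<Sum>b\<in>?I. \<Sum>l<n. ?N * (cnj (c a) * c b *
            t ((y l (fst b) \<otimes> e (snd b) w) \<otimes> star A (y l (fst a) \<otimes> e (snd a) w))))"
        by (intro sum.cong refl) (simp add: K sum_distrib_left mult_ac del: SigmaE)
      also have "\<dots> = (\<Sum>l<n. \<Sum>a\<in>?I. \<Sum>b\<in>?I. ?N * (cnj (c a) * c b *
            t ((y l (fst b) \<otimes> e (snd b) w) \<otimes> star A (y l (fst a) \<otimes> e (snd a) w))))"
        by (subst (2) sum.swap, subst sum.swap) simp
      also have "\<dots> = (\<Sum>l<n. ?N * t (v l \<otimes> star A (v l)))"
        by (intro sum.cong refl) (simp add: tv sum_distrib_left)
      finally show ?thesis by (simp add: sum_distrib_left)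
    qed
    moreover have "0 \<le> Re (t (v l \<otimes> star A (v l)))" if "l < n" for l
      using t_pos[of "star A (v l)"] vc[OF that] by (simp add: star_star)
    ultimately show ?thesis
      by (auto intro!: mult_nonneg_nonneg sum_nonneg)
  qed
  obtain V where V: "\<And>a b. \<lbrakk>a \<in> ?I; b \<in> ?I\<rbrakk> \<Longrightarrow> K a b = (\<Sum>s\<in>?I. cnj (V s a) * V s b)"
    using psd_factor[OF _ herm psd] by auto
  \<comment> \<open>The row index of the factor is itself a pair (l, s): l becomes the summation
    index and s the row of the matrix \<open>z l q\<close>.\<close>
  define z where "z = (\<lambda>l q. synth (\<lambda>s j. V (l, s) (q, j)))"
  have zm: "z l q \<in> mspan" for l q by (simp add: z_def)
  have "cexp (x p q) = (\<Oplus>l\<in>{..<n}. star A (z l p) \<otimes> z l q)" if pq: "p < n" "q < n" for p q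
  proof (rule mspan_eqI)
    show "(\<Oplus>l\<in>{..<n}. star A (z l p) \<otimes> z l q) \<in> mspan"
      by (intro mspan_finsum) (auto simp: mspan_mult mspan_star zm)
    fix i j assume ij: "i \<in> W" "j \<in> W"
    have sum_coord: "coord (\<Oplus>l\<in>I. f l) i j = (\<Sum>l\<in>I. coord (f l) i j)"
      if "finite I" "\<And>l. l \<in> I \<Longrightarrow> f l \<in> mspan" for I :: "nat set" and f
      using that
    proof (induction I rule: finite_induct)
      case empty
      show ?case by (simp, rule coord_eqI) (use ij in auto)
    next
      case (insert k I)
      have "(\<Oplus>i\<in>insert k I. f i) = f k \<oplus> (\<Oplus>i\<in>I. f i)"
        using insert mspan_closed by (intro cs_finsum_insert) auto
      thus ?case using insert ij by (simp add: coord_add mspan_finsum)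
    qed
    have "coord (\<Oplus>l\<in>{..<n}. star A (z l p) \<otimes> z l q) i j
        = (\<Sum>l<n. coord (star A (z l p) \<otimes> z l q) i j)"
      by (intro sum_coord) (auto simp: mspan_mult mspan_star zm)
    also have "\<dots> = (\<Sum>l<n. \<Sum>s\<in>W. cnj (V (l, s) (p, i)) * V (l, s) (q, j))"
      using ij by (intro sum.cong refl)
        (simp add: coord_mult mspan_star zm coord_star, simp add: z_def coord_synth)
    also have "\<dots> = (\<Sum>s\<in>?I. cnj (V s (p, i)) * V s (q, j))"
      by (simp add: sum.cartesian_product split_def)
    also have "\<dots> = K (p, i) (q, j)"
      using V pq ij by simp
    finally show "coord (cexp (x p q)) i j = coord (\<Oplus>l\<in>{..<n}. star A (z l p) \<otimes> z l q) i j"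
      using ij by (simp add: coord_cexp K_def)
  qed auto
  thus ?thesis
    using that[of z] zm by blast
qed

end

section \<open>Maximal abelian subalgebras of finite-dimensional algebras\<close>

context cstar_algebra
begin

lemma cs_minus_zero [simp]: "x \<in> carrier A \<Longrightarrow> x \<ominus> \<zero> = x"
  by (simp add: cs_minus)

definition orth_projs :: "'a set \<Rightarrow> bool" where
  "orth_projs P \<longleftrightarrow> P \<subseteq> carrier A \<and> \<zero> \<notin> P \<and> (\<forall>p\<in>P. star A p = p) \<and>
    (\<forall>p\<in>P. \<forall>q\<in>P. p \<otimes> q = (if p = q then p else \<zero>))"

lemma orth_projsD:
  assumes "orth_projs P"
  shows "p \<in> P \<Longrightarrow> p \<in> carrier A" "p \<in> P \<Longrightarrow> p \<noteq> \<zero>" "p \<in> P \<Longrightarrow> star A p = p"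
    "p \<in> P \<Longrightarrow> p \<otimes> p = p" "\<lbrakk>p \<in> P; q \<in> P; p \<noteq> q\<rbrakk> \<Longrightarrow> p \<otimes> q = \<zero>"
  using assms by (auto simp: orth_projs_def)

lemma nrm_proj:
  assumes "p \<in> carrier A" "star A p = p" "p \<otimes> p = p" "p \<noteq> \<zero>"
  shows "nrm A p = 1"
  using cstar_identity[of p] assms by (simp add: power2_eq_square nrm_eq_0_iff)

lemma orth_projs_sum_mult:
  assumes P: "orth_projs P" "finite Q" "Q \<subseteq> P" "q \<in> P"
  shows "(\<Oplus>p\<in>Q. c p \<odot> p) \<otimes> q = (if q \<in> Q then c q \<odot> q else \<zero>)"
proof -
  have Q: "p \<in> carrier A" if "p \<in> Q" for p using orth_projsD(1)[OF P(1)] P(3) that by auto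
  have qc: "q \<in> carrier A" using orth_projsD(1)[OF P(1,4)] .
  have eq: "(c p \<odot> p) \<otimes> q = (if p = q then c q \<odot> q else \<zero>)" if "p \<in> Q" for p
    using P Q[OF that] qc that by (auto simp: smult_mult_left orth_projs_def)
  have s: "(\<Oplus>p\<in>Q. c p \<odot> p) \<otimes> q = (\<Oplus>p\<in>Q. (c p \<odot> p) \<otimes> q)"
    using Q qc P by (intro finsum_mult) auto
  show ?thesis
  proof (cases "q \<in> Q")
    case True
    have "(\<Oplus>p\<in>Q. (c p \<odot> p) \<otimes> q) = (c q \<odot> q) \<otimes> q"
      using True qc P eq by (intro cs_finsum_single) auto
    thus ?thesis using True s eq by simp
  next
    case False
    thus ?thesis using s eq by (auto intro!: cs_finsum_zero)
  qed
qed

lemma orth_projs_indpt: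
  assumes "orth_projs P"
  shows "lin_indpt P"
proof
  assume "lin_dep P"
  then obtain Q a v where Q: "finite Q" "Q \<subseteq> P" "lincomb a Q = \<zero>" "v \<in> Q" "a v \<noteq> 0"
    by (auto simp: lin_dep_def)
  have v: "v \<in> carrier A" "v \<noteq> \<zero>" using orth_projsD(1,2)[OF assms, of v] Q by auto
  have "\<zero> = (\<Oplus>p\<in>Q. a p \<odot> p) \<otimes> v"
    using Q v by (simp add: lincomb_def)
  also have "\<dots> = a v \<odot> v"
    using orth_projs_sum_mult[OF assms Q(1,2), of v a] Q by auto
  finally show False
    using cs_smult_eq_0[of "a v" v] v Q by simp
qed

lemma orth_projs_bound:
  assumes "finite_dimensional A"
  obtains n where "\<And>P. orth_projs P \<Longrightarrow> finite P \<and> card P \<le> n"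
  using that li_le_dim[of _] orth_projs_indpt assms orth_projsD(1)
  by (metis finite_dimensional_def subsetI)

subsection \<open>Eigenprojections\<close>

text \<open>The value at n is the power n + 1, as no unit is available.\<close>

primrec pw :: "'a \<Rightarrow> nat \<Rightarrow> 'a" where
  "pw x 0 = x"
| "pw x (Suc n) = x \<otimes> pw x n"

lemma pw_closed [simp, intro]: "x \<in> carrier A \<Longrightarrow> pw x n \<in> carrier A"
  by (induction n) auto

text \<open>\<open>peval x p\<close> is \<open>x p(x)\<close>; the additional factor makes sense of it without a unit.\<close>

definition peval :: "'a \<Rightarrow> complex poly \<Rightarrow> 'a" where
  "peval x p = fold_coeffs (\<lambda>a y. a \<odot> x \<oplus> x \<otimes> y) p \<zero>"

lemma peval_0 [simp]: "peval x 0 = \<zero>"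
  by (simp add: peval_def)

lemma peval_pCons:
  assumes "x \<in> carrier A"
  shows "peval x (pCons a p) = a \<odot> x \<oplus> x \<otimes> peval x p"
proof (cases "a = 0 \<and> p = 0")
  case False
  thus ?thesis by (cases "a = 0") (auto simp: peval_def)
qed (use assms in \<open>auto simp: peval_def\<close>)

lemma peval_closed [simp, intro]: "x \<in> carrier A \<Longrightarrow> peval x p \<in> carrier A"
  by (induction p rule: pCons_induct) (auto simp: peval_pCons)

lemma peval_add:
  assumes "x \<in> carrier A"
  shows "peval x (p + q) = peval x p \<oplus> peval x q"
  by (induction p q rule: poly_induct2)
    (use assms in \<open>auto simp: peval_pCons cs_add_smult mult_add_right cs_ac\<close>)

lemma peval_smult:
  assumes "x \<in> carrier A"
  shows "peval x (Polynomial.smult c p) = c \<odot> peval x p"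
  by (induction p rule: pCons_induct)
    (use assms in \<open>auto simp: peval_pCons cs_smult_add smult_mult_right\<close>)

lemma peval_monom: "x \<in> carrier A \<Longrightarrow> peval x (monom c n) = c \<odot> pw x n"
  by (induction n) (auto simp: monom_0 monom_Suc peval_pCons smult_mult_right)

lemma peval_eigen:
  assumes "x \<in> carrier A" "z \<in> carrier A" "x \<otimes> z = m \<odot> z"
  shows "peval x p \<otimes> z = (m * poly p m) \<odot> z"
  by (induction p rule: pCons_induct)
    (use assms in \<open>auto simp: peval_pCons mult_add_left smult_mult_left smult_mult_right mult_assoc
       cs_add_smult[symmetric] algebra_simps\<close>)

lemma peval_annihilator:
  assumes fin: "finite_dimensional A" and x: "x \<in> carrier A"
  obtains p where "p \<noteq> 0" "peval x p = \<zero>"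
proof (cases "inj (pw x)")
  case False
  \<comment> \<open>A repeated power is treated apart, because linear dependence speaks about the
    set of powers and does not see repetitions.\<close>
  then obtain i j where ij: "i \<noteq> j" "pw x i = pw x j" by (auto simp: inj_on_def)
  define p :: "complex poly" where "p = monom 1 i + monom (-1) j"
  have "coeff p i = 1" using ij by (simp add: p_def)
  hence "p \<noteq> 0" by auto
  moreover have "peval x p = \<zero>"
    using x ij cs_minus[of "pw x j" "pw x j"] by (simp add: p_def peval_add peval_monom)
  ultimately show ?thesis using that by blast
next
  case True
  have "lin_dep (range (pw x))"
  proof (rule ccontr)
    assume "\<not> lin_dep (range (pw x))"
    hence "finite (range (pw x))"
      using li_le_dim(1)[of "range (pw x)"] fin x by (auto simp: finite_dimensional_def)
    thus False using True finite_imageD by blast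
  qed
  then obtain Q a v where Q: "finite Q" "Q \<subseteq> range (pw x)" "lincomb a Q = \<zero>" "v \<in> Q" "a v \<noteq> 0"
    by (auto simp: lin_dep_def)
  obtain I where I: "finite I" "Q = pw x ` I"
    using finite_subset_image[OF Q(1,2)] by auto
  define p where "p = (\<Sum>i\<in>I. monom (a (pw x i)) i)"
  obtain j where j: "j \<in> I" "v = pw x j" using Q I by auto
  have "coeff p j = a v"
    using I j by (simp add: p_def coeff_sum sum.delta)
  hence "p \<noteq> 0" using Q by auto
  have "peval x p = (\<Oplus>i\<in>I. a (pw x i) \<odot> pw x i)"
    unfolding p_def using I(1)
  proof (induction I rule: finite_induct)
    case (insert k I)
    have "(\<Oplus>i\<in>insert k I. a (pw x i) \<odot> pw x i)
        = a (pw x k) \<odot> pw x k \<oplus> (\<Oplus>i\<in>I. a (pw x i) \<odot> pw x i)"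
      using insert x by (intro cs_finsum_insert) auto
    thus ?case using insert x by (simp add: peval_add peval_monom)
  qed simp
  also have "\<dots> = (\<Oplus>v\<in>Q. a v \<odot> v)"
    unfolding I(2) using x inj_on_subset[OF True, of I]
    by (subst M.finsum_reindex) auto
  finally have "peval x p = \<zero>" using Q by (simp add: lincomb_def)
  thus ?thesis using that \<open>p \<noteq> 0\<close> by blast
qed

lemma abelian_subalgebraD:
  assumes "abelian_subalgebra D A"
  shows "cstar_subalgebra D A" "\<And>x y. \<lbrakk>x \<in> D; y \<in> D\<rbrakk> \<Longrightarrow> x \<otimes> y = y \<otimes> x"
    "x \<in> D \<Longrightarrow> x \<in> carrier A"
  using assms by (auto simp: abelian_subalgebra_def cstar_subalgebra_def)

text \<open>Let x p(x) = 0 with p of least degree and split off a root c, p = (X - c) s. Then y = x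
  s(x) is nonzero, x y = c y and so y y = k y. Commutativity excludes y y = 0, so y / k is a nonzero
  idempotent; being normal, it is self-adjoint.\<close>

lemma eigenprojection:
  assumes fin: "finite_dimensional A" and D: "abelian_subalgebra D A"
    and x: "x \<in> D" "x \<noteq> \<zero>"
  obtains p c where "p \<in> D" "p \<noteq> \<zero>" "star A p = p" "p \<otimes> p = p" "c \<noteq> 0" "x \<otimes> p = c \<odot> p"
proof -
  note S = cstar_subalgebraD(1-7)[OF abelian_subalgebraD(1)[OF D]]
  note comm = abelian_subalgebraD(2)[OF D]
  note cl = abelian_subalgebraD(3)[OF D]
  have reduced: "y \<otimes> y \<noteq> \<zero>" if y: "y \<in> D" "y \<noteq> \<zero>" for y
  proof
    assume yy: "y \<otimes> y = \<zero>"
    have sy: "star A y \<in> D" using S(6) y by simp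
    note c = cl[OF y(1)] cl[OF sy]
    have "star A (star A y \<otimes> y) \<otimes> (star A y \<otimes> y) = (star A y \<otimes> y) \<otimes> (star A y \<otimes> y)"
      using c by (simp add: star_mult star_star)
    also have "\<dots> = (star A y \<otimes> star A y) \<otimes> (y \<otimes> y)"
      using c comm[OF y(1) sy] by (metis mult_assoc mult_closed)
    also have "\<dots> = \<zero>" using yy c by simp
    finally have "star A y \<otimes> y = \<zero>"
      using c by (rule_tac star_mult_self_eq_0) auto
    hence "y = \<zero>" using c by (rule_tac star_mult_self_eq_0) auto
    thus False using y by simp
  qed
  note xc = cl[OF x(1)]
  obtain p0 where "p0 \<noteq> 0 \<and> peval x p0 = \<zero>" using peval_annihilator[OF fin xc] by blast
  then obtain p where p: "p \<noteq> 0" "peval x p = \<zero>"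
    and least: "\<And>q. \<lbrakk>q \<noteq> 0; peval x q = \<zero>\<rbrakk> \<Longrightarrow> degree p \<le> degree q"
    using ex_has_least_nat[of "\<lambda>p. p \<noteq> 0 \<and> peval x p = \<zero>" p0 degree] by auto
  have "degree p \<noteq> 0"
  proof
    assume "degree p = 0"
    then obtain c where c: "p = [:c:]" by (rule degree_eq_zeroE)
    hence "c \<odot> x = \<zero>" using p xc by (simp add: peval_pCons)
    thus False using cs_smult_eq_0[of c x] x xc c p by auto
  qed
  hence "\<not> constant (poly p)" by (simp add: constant_degree)
  then obtain c where "poly p c = 0" using fundamental_theorem_of_algebra by blast
  then obtain s where s: "p = [:- c, 1:] * s" by (auto simp: poly_eq_0_iff_dvd)
  have s0: "s \<noteq> 0" using s p by auto
  have "degree s < degree p" unfolding s using s0 by (subst degree_mult_eq) auto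
  define y where "y = peval x s"
  have y0: "y \<noteq> \<zero>" using least[OF s0] \<open>degree s < degree p\<close> by (auto simp: y_def)
  have yc: "y \<in> carrier A" using xc by (simp add: y_def)
  have yD: "y \<in> D" unfolding y_def
    by (induction s rule: pCons_induct) (use S xc x in \<open>auto simp: peval_pCons\<close>)
  have "peval x p = (- c) \<odot> y \<oplus> x \<otimes> y"
  proof -
    have "p = Polynomial.smult (- c) s + pCons 0 s"
      unfolding s by (simp only: mult_pCons_left one_pCons[symmetric] mult_1_left)
    thus ?thesis
      using xc unfolding y_def
      by (simp only: peval_add peval_smult peval_pCons cs_zero_smult peval_closed mult_closed M.l_zero)
  qed
  hence "x \<otimes> y \<ominus> c \<odot> y = \<zero>"
    using p xc yc by (simp add: cs_minus M.a_comm)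
  hence xy: "x \<otimes> y = c \<odot> y" using xc yc by (rule_tac cs_minus_eq_0) auto
  define k where "k = c * poly s c"
  have yy: "y \<otimes> y = k \<odot> y"
    using peval_eigen[OF xc yc xy, of s] by (simp add: y_def k_def)
  have k0: "k \<noteq> 0" using reduced[OF yD y0] yy yc by auto
  define q where "q = inverse k \<odot> y"
  have q: "q \<in> D" "q \<in> carrier A" using S yD yc by (auto simp: q_def)
  have q0: "q \<noteq> \<zero>" using cs_smult_eq_0[of "inverse k" y] y0 yc k0 by (auto simp: q_def)
  have qq: "q \<otimes> q = q" using yc yy k0 by (simp add: q_def smult_mult_left smult_mult_right)
  have sq: "star A q \<in> D" "star A q \<in> carrier A" using q S by auto
  note cq = comm[OF q(1) sq(1)]
  \<comment> \<open>Commuting q and q* make q - q* q an element of vanishing square norm; hence q =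
    q* q is self-adjoint.\<close>
  have "star A (q \<ominus> star A q \<otimes> q) \<otimes> (q \<ominus> star A q \<otimes> q) = \<zero>"
  proof -
    have ss: "star A q \<otimes> star A q = star A q" using q qq by (metis star_mult)
    have 1: "star A q \<otimes> (star A q \<otimes> q) = star A q \<otimes> q" using q sq ss by (simp add: mult_assoc[symmetric])
    have 2: "star A q \<otimes> q \<otimes> (star A q \<otimes> q) = star A q \<otimes> q"
    proof -
      have "star A q \<otimes> q \<otimes> (star A q \<otimes> q) = star A q \<otimes> (q \<otimes> star A q) \<otimes> q"
        using q sq by (simp add: mult_assoc)
      also have "\<dots> = star A q \<otimes> star A q \<otimes> (q \<otimes> q)"
        unfolding cq using q sq by (simp add: mult_assoc)
      finally show ?thesis unfolding ss qq .
    qed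
    have "star A (q \<ominus> star A q \<otimes> q) = star A q \<ominus> star A q \<otimes> q"
      using q sq by (simp add: star_minus star_mult star_star)
    thus ?thesis
      using q sq 1 2 qq by (simp add: cs_minus_mult cs_mult_minus mult_assoc)
  qed
  hence "q \<ominus> star A q \<otimes> q = \<zero>" using q sq by (rule_tac star_mult_self_eq_0) auto
  hence "q = star A q \<otimes> q" using q sq by (rule_tac cs_minus_eq_0) auto
  hence "star A q = q" using q by (metis star_mult star_star sq(2))
  moreover have "x \<otimes> q = c \<odot> q"
    using xc yc xy by (simp add: q_def smult_mult_right mult.commute)
  moreover have "c \<noteq> 0" using k0 by (auto simp: k_def)
  ultimately show ?thesis using that q q0 qq by blast
qed

lemma orth_projs_insert:
  assumes P: "orth_projs P" and q: "q \<in> carrier A" "q \<noteq> \<zero>" "star A q = q" "q \<otimes> q = q"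
    and orth: "\<And>p. p \<in> P \<Longrightarrow> q \<otimes> p = \<zero>"
  shows "orth_projs (insert q P)" "q \<notin> P"
proof -
  have "p \<otimes> q = \<zero>" if "p \<in> P" for p
    using orth[OF that] star_mult[of q p] orth_projsD[OF P] q that by simp
  thus "orth_projs (insert q P)" using P q orth by (auto simp: orth_projs_def)
  show "q \<notin> P" using orth q by force
qed

lemma orth_projs_subset: "\<lbrakk>orth_projs P; Q \<subseteq> P\<rbrakk> \<Longrightarrow> orth_projs Q"
  unfolding orth_projs_def by blast

text \<open>A family of maximal size cannot be refined or extended. If d p were no multiple of p, an
  eigenprojection q below p would split p; a nonzero remainder of d would have an eigenprojection
  orthogonal to all of \<open>P\<close>.\<close>

lemma max_orth_projs:
  assumes fin: "finite_dimensional A" and D: "abelian_subalgebra D A"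
    and P: "orth_projs P" "P \<subseteq> D" "finite P"
    and max: "\<forall>Q. orth_projs Q \<and> Q \<subseteq> D \<longrightarrow> card Q \<le> card P"
    and d: "d \<in> D"
  shows "p \<in> P \<Longrightarrow> \<exists>c. d \<otimes> p = c \<odot> p" "d = (\<Oplus>p\<in>P. d \<otimes> p)"
proof -
  note S = cstar_subalgebraD(1-7)[OF abelian_subalgebraD(1)[OF D]]
  note comm = abelian_subalgebraD(2)[OF D]
  note cl = abelian_subalgebraD(3)[OF D]
  note Pd = orth_projsD[OF P(1)]
  show "\<exists>c. d \<otimes> p = c \<odot> p" if p: "p \<in> P"
  proof (cases "d \<otimes> p = \<zero>")
    case True
    thus ?thesis using Pd(1)[OF p] by (intro exI[of _ 0]) simp
  next
    case False
    have pD: "p \<in> D" using p P by auto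
    have dp: "d \<otimes> p \<in> D" using S d pD by simp
    obtain q c where q: "q \<in> D" "q \<noteq> \<zero>" "star A q = q" "q \<otimes> q = q" "c \<noteq> 0" "d \<otimes> p \<otimes> q = c \<odot> q"
      using eigenprojection[OF fin D dp False] .
    note cs = cl[OF d] cl[OF pD] cl[OF q(1)]
    have "q = inverse c \<odot> (d \<otimes> p \<otimes> q)" using q cs by simp
    also have "\<dots> \<otimes> p = inverse c \<odot> (d \<otimes> p \<otimes> q)"
    proof -
      have "d \<otimes> p \<otimes> q \<otimes> p = d \<otimes> p \<otimes> q"
        using comm[OF q(1) pD] Pd(4)[OF p] cs by (simp add: mult_assoc) (metis mult_assoc)
      thus ?thesis using cs by (simp add: smult_mult_left)
    qed
    finally have qp: "q \<otimes> p = q" using q cs by simp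
    have pq: "p \<otimes> q = q" using qp comm[OF q(1) pD] by simp
    have "q = p"
    proof (rule ccontr)
      assume ne: "q \<noteq> p"
      \<comment> \<open>Replacing p by the two pieces q and p - q enlarges the family by
        one.\<close>
      define r where "r = p \<ominus> q"
      have r: "r \<in> D" "r \<in> carrier A" "star A r = r" "r \<otimes> r = r" "r \<noteq> \<zero>" "q \<otimes> r = \<zero>"
        using S(7)[OF pD q(1)] pD q cs Pd[OF p] qp pq cs_minus_eq_0[of p q] ne
        by (auto simp: r_def star_minus cs_minus_mult cs_mult_minus)
      have o: "orth_projs (P - {p})" using P by (intro orth_projs_subset[OF P(1)]) auto
      have qo: "q \<otimes> p' = \<zero>" if "p' \<in> P - {p}" for p'
      proof -
        have "q \<otimes> p' = q \<otimes> (p \<otimes> p')" using qp cs Pd(1) that by (metis DiffD1 mult_assoc)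
        thus ?thesis using Pd(5)[of p p'] p that cs by auto
      qed
      have ro: "r \<otimes> p' = \<zero>" if "p' \<in> P - {p}" for p'
        using qo[OF that] Pd(5)[of p p'] p that cs Pd(1)[of p'] by (auto simp: r_def cs_minus_mult)
      have o1: "orth_projs (insert r (P - {p}))" "r \<notin> P - {p}"
        using orth_projs_insert[OF o r(2,5,3,4) ro] by auto
      have o2: "orth_projs (insert q (insert r (P - {p})))" "q \<notin> insert r (P - {p})"
        by (rule orth_projs_insert[OF o1(1)]; use cs q qo r in auto)+
      have "card (insert q (insert r (P - {p}))) \<le> card P"
        using o2 r q P by (intro max[rule_format]) auto
      moreover have "card (insert q (insert r (P - {p}))) = Suc (card P)"
        using o1 o2 P(3) card_Suc_Diff1[OF P(3) p] by simp
      ultimately show False by simp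
    qed
    hence "d \<otimes> p = c \<odot> p" using q(6) Pd(4)[OF p] cs by (simp add: mult_assoc)
    thus ?thesis ..
  qed
  show "d = (\<Oplus>p\<in>P. d \<otimes> p)"
  proof (rule ccontr)
    assume ne: "d \<noteq> (\<Oplus>p\<in>P. d \<otimes> p)"
    have PD: "p \<in> D" if "p \<in> P" for p using P that by auto
    have sumD: "(\<Oplus>p\<in>Q. d \<otimes> p) \<in> D" if "Q \<subseteq> P" for Q
    proof -
      have "finite Q" using that P finite_subset by auto
      thus ?thesis using that
      proof (induction Q rule: finite_induct)
        case (insert p Q)
        have "(\<Oplus>p\<in>insert p Q. d \<otimes> p) = d \<otimes> p \<oplus> (\<Oplus>p\<in>Q. d \<otimes> p)"
          using insert d cl PD by (intro cs_finsum_insert) (auto simp: subset_iff)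
        thus ?case using insert S d PD by simp
      qed (simp add: S)
    qed
    \<comment> \<open>The remainder kills every member of \<open>P\<close>, and therefore so do its
      eigenprojections with nonzero eigenvalue.\<close>
    define z where "z = d \<ominus> (\<Oplus>p\<in>P. d \<otimes> p)"
    have z: "z \<in> D" "z \<noteq> \<zero>"
      using S sumD[of P] d ne cl cs_minus_eq_0[of d "\<Oplus>p\<in>P. d \<otimes> p"] by (auto simp: z_def)
    obtain q c where q: "q \<in> D" "q \<noteq> \<zero>" "star A q = q" "q \<otimes> q = q" "c \<noteq> 0" "z \<otimes> q = c \<odot> q"
      using eigenprojection[OF fin D z] .
    note cs = cl[OF z(1)] cl[OF q(1)]
    have zp: "z \<otimes> p = \<zero>" if p: "p \<in> P" for p
    proof -
      have "(\<Oplus>p\<in>P. d \<otimes> p) \<otimes> p = (\<Oplus>p'\<in>P. d \<otimes> p' \<otimes> p)"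
        using d cl PD P p by (intro finsum_mult) auto
      also have "\<dots> = d \<otimes> p \<otimes> p"
        using d cl PD P p Pd(5) by (intro cs_finsum_single) (auto simp: mult_assoc)
      also have "\<dots> = d \<otimes> p" using d cl PD p Pd(4) by (simp add: mult_assoc)
      finally have "(\<Oplus>p\<in>P. d \<otimes> p) \<otimes> p = d \<otimes> p" .
      thus ?thesis using d cl PD p sumD[of P] by (simp add: z_def cs_minus_mult)
    qed
    have qp: "q \<otimes> p = \<zero>" if p: "p \<in> P" for p
    proof -
      have "c \<odot> (q \<otimes> p) = z \<otimes> q \<otimes> p" using q cs Pd(1)[OF p] by (simp add: smult_mult_left)
      also have "\<dots> = z \<otimes> p \<otimes> q" using comm[OF q(1) PD[OF p]] cs Pd(1)[OF p] by (simp add: mult_assoc)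
      also have "\<dots> = \<zero>" using zp[OF p] cs by simp
      finally show ?thesis using cs_smult_eq_0 q cs Pd(1)[OF p] by blast
    qed
    note o = orth_projs_insert[OF P(1) cs(2) q(2-4) qp]
    have "card (insert q P) \<le> card P" using o q P by (intro max[rule_format]) auto
    thus False using o P by simp
  qed
qed

subsection \<open>Commutants\<close>

definition commutant :: "'a set \<Rightarrow> 'a set" where
  "commutant T = {y \<in> carrier A. \<forall>s\<in>T. s \<otimes> y = y \<otimes> s}"

lemma commutant_subalgebra:
  assumes T: "T \<subseteq> carrier A" "\<And>s. s \<in> T \<Longrightarrow> star A s \<in> T"
  shows "cstar_subalgebra (commutant T) A"
proof (rule cstar_subalgebraI)
  have Tc: "s \<in> carrier A" if "s \<in> T" for s using T that by auto
  show "\<zero> \<in> commutant T" using Tc by (auto simp: commutant_def)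
  show "x \<oplus> y \<in> commutant T" if "x \<in> commutant T" "y \<in> commutant T" for x y
    using that Tc by (auto simp: commutant_def mult_add_left mult_add_right)
  show "c \<odot> x \<in> commutant T" if "x \<in> commutant T" for c x
    using that Tc by (auto simp: commutant_def smult_mult_left smult_mult_right)
  show "x \<otimes> y \<in> commutant T" if "x \<in> commutant T" "y \<in> commutant T" for x y
    using that Tc by (auto simp: commutant_def) (metis mult_assoc)
  show "star A x \<in> commutant T" if x: "x \<in> commutant T" for x
  proof -
    have "s \<otimes> star A x = star A x \<otimes> s" if s: "s \<in> T" for s
    proof -
      have "star A s \<otimes> x = x \<otimes> star A s" using x T s by (auto simp: commutant_def)
      hence "star A (star A s \<otimes> x) = star A (x \<otimes> star A s)" by simp
      thus ?thesis using x s Tc by (simp add: commutant_def star_mult star_star)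
    qed
    thus ?thesis using x by (auto simp: commutant_def)
  qed
  fix f x assume f: "\<And>n. f n \<in> commutant T" and x: "x \<in> carrier A" "tends f x"
  have fc: "f n \<in> carrier A" for n using f by (auto simp: commutant_def)
  have const: "tends (\<lambda>_. s) s" if "s \<in> T" for s using Tc[OF that] by simp
  have "s \<otimes> x = x \<otimes> s" if s: "s \<in> T" for s
  proof (rule limit_unique[of "\<lambda>n. s \<otimes> f n"])
    show "tends (\<lambda>n. s \<otimes> f n) (s \<otimes> x)"
      using fc x s Tc const by (intro tends_mult) auto
    have "tends (\<lambda>n. f n \<otimes> s) (x \<otimes> s)"
      using fc x s Tc const by (intro tends_mult) auto
    thus "tends (\<lambda>n. s \<otimes> f n) (x \<otimes> s)" using f s by (simp add: commutant_def)
  qed (use fc x s Tc in auto)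
  thus "x \<in> commutant T" using x by (auto simp: commutant_def)
qed (auto simp: commutant_def)

text \<open>With T = D and x together, T is commutative, so T lies in its commutant and the
  bicommutant of T is contained in the commutant of T. The bicommutant is thus an abelian subalgebra
  containing \<open>D\<close> and x, and equals \<open>D\<close> by maximality.\<close>

lemma maximal_abelian_absorbs:
  assumes D: "maximal_abelian D A" and x: "x \<in> carrier A" "star A x = x"
    and comm: "\<And>d. d \<in> D \<Longrightarrow> d \<otimes> x = x \<otimes> d"
  shows "x \<in> D"
proof -
  have ab: "abelian_subalgebra D A" using D by (simp add: maximal_abelian_def)
  note S = cstar_subalgebraD(1-7)[OF abelian_subalgebraD(1)[OF ab]]
  define T where "T = insert x D"
  have T: "T \<subseteq> carrier A" "\<And>s. s \<in> T \<Longrightarrow> star A s \<in> T"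
    using S x by (auto simp: T_def)
  have TT: "s \<otimes> u = u \<otimes> s" if "s \<in> T" "u \<in> T" for s u
    using that comm abelian_subalgebraD(2)[OF ab] by (auto simp: T_def)
  have TC: "T \<subseteq> commutant T" using T TT by (auto simp: commutant_def)
  have C: "commutant T \<subseteq> carrier A" "\<And>s. s \<in> commutant T \<Longrightarrow> star A s \<in> commutant T"
    using cstar_subalgebraD(1,6)[OF commutant_subalgebra[OF T]] by auto
  have CC: "commutant (commutant T) \<subseteq> commutant T"
    using TC by (auto simp: commutant_def)
  have "abelian_subalgebra (commutant (commutant T)) A"
    unfolding abelian_subalgebra_def
    using commutant_subalgebra[OF C] CC by (auto simp: commutant_def)
  moreover have TCC: "T \<subseteq> commutant (commutant T)"
    using T by (auto simp: commutant_def)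
  ultimately have "commutant (commutant T) = D"
    using D by (auto simp: maximal_abelian_def T_def)
  thus ?thesis using TCC by (auto simp: T_def)
qed

text \<open>Maximise the number of orthogonal projections over pairs of an abelian subalgebra and a
  family in it. In a larger abelian subalgebra the same family is still of maximal size, so every
  element there is a combination of \<open>P\<close> and was in \<open>D\<close> already.\<close>

lemma maximal_abelian_exists:
  assumes fin: "finite_dimensional A"
  shows "\<exists>D. maximal_abelian D A"
proof -
  obtain n where n: "\<And>P. orth_projs P \<Longrightarrow> finite P \<and> card P \<le> n"
    using orth_projs_bound[OF fin] by blast
  define R where "R = (\<lambda>(D, P). abelian_subalgebra D A \<and> orth_projs P \<and> P \<subseteq> D)"
  have "cstar_subalgebra {\<zero>} A"
  proof (rule cstar_subalgebraI)
    fix f x assume f: "\<And>n. f n \<in> {\<zero>}" and x: "x \<in> carrier A" "tends f x"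
    hence "f = (\<lambda>_. \<zero>)" by auto
    hence "tends f \<zero>" by simp
    thus "x \<in> {\<zero>}" using limit_unique[of f x \<zero>] f x by simp
  qed auto
  hence "R ({\<zero>}, {})" by (auto simp: R_def abelian_subalgebra_def orth_projs_def)
  moreover have "\<forall>y. R y \<longrightarrow> card (snd y) < Suc n"
    using n by (auto simp: R_def less_Suc_eq_le)
  ultimately obtain y where y: "R y" "\<And>y'. R y' \<Longrightarrow> card (snd y') \<le> card (snd y)"
    using ex_has_greatest_nat[of R "({\<zero>}, {})" "\<lambda>y. card (snd y)" "Suc n"] by blast
  obtain D P where DP: "y = (D, P)" by (cases y)
  have D: "abelian_subalgebra D A" "orth_projs P" "P \<subseteq> D" using y DP by (auto simp: R_def)
  have fP: "finite P" using n D by auto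
  have "D' = D" if D': "abelian_subalgebra D' A" "D \<subseteq> D'" for D'
  proof
    have PD': "P \<subseteq> D'" using D D' by auto
    have max': "\<forall>Q. orth_projs Q \<and> Q \<subseteq> D' \<longrightarrow> card Q \<le> card P"
      using y(2)[of "(D', Q)" for Q] D' DP by (auto simp: R_def)
    note S = cstar_subalgebraD(1-7)[OF abelian_subalgebraD(1)[OF D(1)]]
    show "D' \<subseteq> D"
    proof
      fix d assume d: "d \<in> D'"
      note m = max_orth_projs[OF fin D'(1) D(2) PD' fP max' d]
      have "(\<Oplus>p\<in>Q. d \<otimes> p) \<in> D" if "Q \<subseteq> P" for Q
      proof -
        have "finite Q" using that fP finite_subset by auto
        thus ?thesis using that
        proof (induction Q rule: finite_induct)
          case (insert p Q)
          have pc: "p \<in> carrier A" if "p \<in> P" for p using D that orth_projsD by blast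
          have "(\<Oplus>p\<in>insert p Q. d \<otimes> p) = d \<otimes> p \<oplus> (\<Oplus>p\<in>Q. d \<otimes> p)"
            using insert d abelian_subalgebraD(3)[OF D'(1)] pc by (intro cs_finsum_insert) (auto simp: subset_iff)
          moreover obtain c where "d \<otimes> p = c \<odot> p" using m(1)[of p] insert by auto
          ultimately show ?case using insert S D(3) by auto
        qed (simp add: S)
      qed
      from this[of P] show "d \<in> D" using m(2) by simp
    qed
  qed (use D' in auto)
  thus ?thesis using D by (auto simp: maximal_abelian_def)
qed

text \<open>\<open>P\<close> consists of the minimal projections of the chosen maximal abelian
  subalgebra and is a basis of it. Self-adjoint corners p x p commute with the subalgebra and are
  absorbed by it, hence are multiples of p.\<close>

lemma cstar_rank_projs:
  assumes fin: "finite_dimensional A"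
  obtains P where "finite P" "card P = cstar_rank A" "orth_projs P"
    and "\<And>x p. \<lbrakk>x \<in> carrier A; p \<in> P\<rbrakk> \<Longrightarrow> \<exists>c. p \<otimes> x \<otimes> p = c \<odot> p"
    and "\<And>x. x \<in> carrier A \<Longrightarrow> x = (\<Oplus>p\<in>P. x \<otimes> p)"
proof -
  define D where "D = (SOME D. maximal_abelian D A)"
  have D: "maximal_abelian D A"
    unfolding D_def using maximal_abelian_exists[OF fin] by (rule someI_ex)
  have ab: "abelian_subalgebra D A" using D by (simp add: maximal_abelian_def)
  note S = cstar_subalgebraD(1-7)[OF abelian_subalgebraD(1)[OF ab]]
  note comm = abelian_subalgebraD(2)[OF ab]
  note cl = abelian_subalgebraD(3)[OF ab]
  obtain n where n: "\<And>P. orth_projs P \<Longrightarrow> finite P \<and> card P \<le> n"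
    using orth_projs_bound[OF fin] by blast
  have "orth_projs {} \<and> {} \<subseteq> D" by (auto simp: orth_projs_def)
  moreover have "\<forall>P. orth_projs P \<and> P \<subseteq> D \<longrightarrow> card P < Suc n" using n by (auto simp: less_Suc_eq_le)
  ultimately obtain P where P: "orth_projs P" "P \<subseteq> D"
    and max: "\<forall>Q. orth_projs Q \<and> Q \<subseteq> D \<longrightarrow> card Q \<le> card P"
    using ex_has_greatest_nat[of "\<lambda>P. orth_projs P \<and> P \<subseteq> D" "{}" card "Suc n"] by blast
  have fP: "finite P" using n P by auto
  note Pd = orth_projsD[OF P(1)]
  note m = max_orth_projs[OF fin ab P fP max]
  have corner: "\<exists>c. p \<otimes> x \<otimes> p = c \<odot> p" if x: "x \<in> carrier A" and p: "p \<in> P" for x p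
  proof -
    note pc = Pd(1)[OF p]
    have sa: "\<exists>c. p \<otimes> y \<otimes> p = c \<odot> p" if y: "y \<in> carrier A" "star A y = y" for y
    proof -
      define z where "z = p \<otimes> y \<otimes> p"
      have z: "z \<in> carrier A" "star A z = z" using pc y Pd(3)[OF p] by (auto simp: z_def star_mult mult_assoc)
      have "z \<in> D"
      proof (rule maximal_abelian_absorbs[OF D z])
        fix d assume d: "d \<in> D"
        obtain c where c: "d \<otimes> p = c \<odot> p" using m(1)[OF d p] by blast
        have c': "p \<otimes> d = c \<odot> p" using c comm[OF d] p P by auto
        have "d \<otimes> z = c \<odot> z" using c pc y cl[OF d] by (simp add: z_def mult_assoc[symmetric] smult_mult_left)
        moreover have "z \<otimes> d = c \<odot> z" using c' pc y cl[OF d] by (simp add: z_def mult_assoc smult_mult_right)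
        ultimately show "d \<otimes> z = z \<otimes> d" by simp
      qed
      moreover have "z \<otimes> p = z" using pc y Pd(4)[OF p] by (simp add: z_def mult_assoc)
      ultimately show ?thesis using m(1)[of z p] p by (auto simp: z_def)
    qed
    \<comment> \<open>Twice the real and imaginary parts, so that x = (a + i b) / 2.\<close>
    define a b where "a = x \<oplus> star A x" and "b = \<i> \<odot> (star A x \<ominus> x)"
    have ab': "a \<in> carrier A" "b \<in> carrier A" "star A a = a" "star A b = b"
      using x by (auto simp: a_def b_def star_add star_smult star_minus star_star cs_ac cs_minus cs_smult_add)
    have xe: "x = (1/2) \<odot> (a \<oplus> \<i> \<odot> b)"
    proof -
      have "\<i> \<odot> b = x \<ominus> star A x"
        using x by (simp add: b_def cs_minus cs_smult_add cs_ac)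
      hence "a \<oplus> \<i> \<odot> b = (x \<oplus> x) \<oplus> (star A x \<ominus> star A x)"
        using x by (simp only: a_def cs_minus cs_ac star_closed cs_smult_closed cs_add_closed)
      also have "\<dots> = 2 \<odot> x" using x cs_add_smult[of x 1 1] by simp
      finally show ?thesis using x by simp
    qed
    obtain ca cb where c: "p \<otimes> a \<otimes> p = ca \<odot> p" "p \<otimes> b \<otimes> p = cb \<odot> p"
      using sa ab' by meson
    have "p \<otimes> x \<otimes> p = (1/2) \<odot> (p \<otimes> a \<otimes> p \<oplus> \<i> \<odot> (p \<otimes> b \<otimes> p))"
      using ab' pc by (subst xe) (simp add: smult_mult_left smult_mult_right mult_add_left mult_add_right)
    also have "\<dots> = ((1/2) * (ca + \<i> * cb)) \<odot> p"
      using pc by (simp add: c cs_add_smult[symmetric] cs_smult_add distrib_left add_divide_distrib)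
    finally show ?thesis by blast
  qed
  have unit: "x = (\<Oplus>p\<in>P. x \<otimes> p)" if x: "x \<in> carrier A" for x
  proof -
    define z where "z = x \<ominus> (\<Oplus>p\<in>P. x \<otimes> p)"
    have sc: "(\<Oplus>p\<in>P. x \<otimes> p) \<in> carrier A" using x Pd by (intro cs_finsum_closed) auto
    have zc: "z \<in> carrier A" using x sc by (simp add: z_def)
    have zp: "z \<otimes> p = \<zero>" if p: "p \<in> P" for p
    proof -
      have "(\<Oplus>p\<in>P. x \<otimes> p) \<otimes> p = (\<Oplus>p'\<in>P. x \<otimes> p' \<otimes> p)"
        using x Pd fP p by (intro finsum_mult) auto
      also have "\<dots> = x \<otimes> p \<otimes> p"
        using x Pd fP p by (intro cs_finsum_single) (auto simp: mult_assoc)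
      also have "\<dots> = x \<otimes> p" using x Pd p by (simp add: mult_assoc)
      finally show ?thesis using x Pd p sc by (simp add: z_def cs_minus_mult)
    qed
    \<comment> \<open>The remainder z kills \<open>P\<close> on the right, so h = z* z annihilates
      \<open>D\<close> on both sides. It then commutes with \<open>D\<close>, is absorbed, and
      annihilates itself.\<close>
    define h where "h = star A z \<otimes> z"
    have h: "h \<in> carrier A" "star A h = h" using zc by (auto simp: h_def star_mult star_star)
    have hp: "h \<otimes> p = \<zero>" if "p \<in> P" for p using zp[OF that] zc Pd(1)[OF that] by (simp add: h_def mult_assoc)
    have hd: "h \<otimes> d = \<zero>" if d: "d \<in> D" for d
    proof -
      have "h \<otimes> d = h \<otimes> (\<Oplus>p\<in>P. d \<otimes> p)" using m(2)[OF d] by simp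
      also have "\<dots> = (\<Oplus>p\<in>P. h \<otimes> (d \<otimes> p))" using fP h cl[OF d] Pd by (intro mult_finsum) auto
      also have "\<dots> = \<zero>"
      proof (rule cs_finsum_zero)
        fix p assume p: "p \<in> P"
        have "d \<otimes> p = p \<otimes> d" using comm d p P by auto
        thus "h \<otimes> (d \<otimes> p) = \<zero>" using hp[OF p] h cl[OF d] Pd(1)[OF p] by (simp add: mult_assoc[symmetric])
      qed
      finally show ?thesis .
    qed
    have dh: "d \<otimes> h = \<zero>" if d: "d \<in> D" for d
    proof -
      have "star A (h \<otimes> star A d) = \<zero>" using hd[OF S(6)[OF d]] by simp
      thus ?thesis using h cl[OF d] by (simp add: star_mult star_star)
    qed
    have "h \<in> D" using hd dh by (intro maximal_abelian_absorbs[OF D h]) auto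
    hence "star A h \<otimes> h = \<zero>" using hd h by simp
    hence "h = \<zero>" by (rule star_mult_self_eq_0[OF h(1)])
    hence "z = \<zero>" using star_mult_self_eq_0[OF zc] by (simp only: h_def)
    thus ?thesis using x sc by (rule_tac cs_minus_eq_0) (auto simp: z_def)
  qed
  have card: "card P = cstar_rank A"
  proof -
    interpret S: cstar_algebra "A\<lparr>carrier := D\<rparr>"
      using abelian_subalgebraD(1)[OF ab] by (simp add: cstar_subalgebra_def)
    have lc: "S.lincomb a Q = (\<Oplus>p\<in>Q. a p \<odot> p)" if "finite Q" "Q \<subseteq> P" for a Q
      unfolding S.lincomb_def
      using finsum_subalgebra[OF abelian_subalgebraD(1)[OF ab], of Q "\<lambda>p. a p \<odot> p"] that P S(4)
      by auto
    have "S.lin_indpt P"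
    proof
      assume "S.lin_dep P"
      then obtain Q a v where Q: "finite Q" "Q \<subseteq> P" "S.lincomb a Q = \<zero>" "v \<in> Q" "a v \<noteq> 0"
        by (auto simp: S.lin_dep_def)
      hence "lin_dep P" unfolding lin_dep_def using lc[of Q a]
        by (intro exI[of _ Q] exI[of _ a] exI[of _ v]) (simp add: lincomb_def)
      thus False using orth_projs_indpt[OF P(1)] by simp
    qed
    moreover have "S.span P = D"
    proof
      have "S.span P \<subseteq> carrier (A\<lparr>carrier := D\<rparr>)"
        using P by (intro S.span_is_subset2) auto
      thus "S.span P \<subseteq> D" by simp
      show "D \<subseteq> S.span P"
      proof
        fix d assume d: "d \<in> D"
        obtain c where c: "\<And>p. p \<in> P \<Longrightarrow> d \<otimes> p = c p \<odot> p" using m(1)[OF d] by metis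
        have "d = (\<Oplus>p\<in>P. d \<otimes> p)" by (rule m(2)[OF d])
        also have "\<dots> = (\<Oplus>p\<in>P. c p \<odot> p)" using c Pd by (intro cs_finsum_cong) auto
        also have "\<dots> = S.lincomb c P" using lc[of P c] fP by simp
        finally show "d \<in> S.span P" unfolding S.span_def using fP by auto
      qed
    qed
    ultimately have "S.basis P" using P by (simp add: S.basis_def)
    hence "S.dim = card P" using S.dim_basis fP by blast
    thus ?thesis by (simp add: cstar_rank_def D_def)
  qed
  show ?thesis
    by (rule that[of P]; (rule fP card P(1) corner unit; assumption?))
qed

end

section \<open>Matrix subalgebras as approximating systems\<close>

lemma mat_posE:
  assumes "mat_pos F n x"
  obtains y where "\<And>i j. \<lbrakk>i < n; j < n\<rbrakk> \<Longrightarrow> y i j \<in> carrier F"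
    and "\<And>i j. \<lbrakk>i < n; j < n\<rbrakk> \<Longrightarrow> x i j = (\<Oplus>\<^bsub>F\<^esub>l\<in>{..<n}. star F (y l i) \<otimes>\<^bsub>F\<^esub> y l j)"
  using assms unfolding mat_pos_def by blast

text \<open>The type \<open>findim_alg\<close> fixes only the type of the elements, so a matrix subalgebra of \<open>A\<close> becomes
  an instance by transport along any injection into the complex matrices; it keeps the norm of \<open>A\<close>.\<close>

definition transport :: "('a \<Rightarrow> 'c) \<Rightarrow> 'a cstar_alg \<Rightarrow> 'c cstar_alg" where
  "transport c A = (let d = inv_into (carrier A) c in
    \<lparr>carrier = c ` carrier A, mult = (\<lambda>x y. c (d x \<otimes>\<^bsub>A\<^esub> d y)), one = c \<one>\<^bsub>A\<^esub>, zero = c \<zero>\<^bsub>A\<^esub>,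
     add = (\<lambda>x y. c (d x \<oplus>\<^bsub>A\<^esub> d y)), smult = (\<lambda>a x. c (a \<odot>\<^bsub>A\<^esub> d x)),
     star = (\<lambda>x. c (star A (d x))), nrm = (\<lambda>x. nrm A (d x))\<rparr>)"

locale cstar_transport = cstar_algebra A for A :: "'a cstar_alg" (structure) +
  fixes c :: "'a \<Rightarrow> 'c"
  assumes inj: "inj_on c (carrier A)"
begin

abbreviation T where "T \<equiv> transport c A"
abbreviation d where "d \<equiv> inv_into (carrier A) c"

lemma d_c [simp]: "x \<in> carrier A \<Longrightarrow> d (c x) = x"
  using inj by (rule inv_into_f_f)

lemma transport_simps:
  "carrier T = c ` carrier A" "\<zero>\<^bsub>T\<^esub> = c \<zero>"
  "\<lbrakk>x \<in> carrier A; y \<in> carrier A\<rbrakk> \<Longrightarrow> c x \<otimes>\<^bsub>T\<^esub> c y = c (x \<otimes> y)"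
  "\<lbrakk>x \<in> carrier A; y \<in> carrier A\<rbrakk> \<Longrightarrow> c x \<oplus>\<^bsub>T\<^esub> c y = c (x \<oplus> y)"
  "x \<in> carrier A \<Longrightarrow> a \<odot>\<^bsub>T\<^esub> c x = c (a \<odot> x)"
  "x \<in> carrier A \<Longrightarrow> star T (c x) = c (star A x)"
  "x \<in> carrier A \<Longrightarrow> nrm T (c x) = nrm A x"
  by (auto simp: transport_def Let_def)

lemma T_elim:
  assumes "y \<in> carrier T"
  obtains x where "x \<in> carrier A" "y = c x"
  using assms by (auto simp: transport_simps(1))

lemma c_eq_iff: "\<lbrakk>x \<in> carrier A; y \<in> carrier A\<rbrakk> \<Longrightarrow> c x = c y \<longleftrightarrow> x = y"
  using inj by (auto simp: inj_on_def)

lemma transport_vectorspace: "vectorspace complex_field T"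
proof (rule vs_criteria, goal_cases)
  case 1
  show ?case by (rule class_field)
next
  case 4
  have "x \<oplus> (-1) \<odot> x = \<zero>" if "x \<in> carrier A" for x
    using cs_minus[of x x] that by simp
  thus ?case by (auto simp: transport_simps intro!: bexI[of _ "(-1) \<odot> x" for x])
next
  case 6
  show ?case by (auto simp: transport_simps M.a_comm)
next
  case 7
  show ?case by (auto simp: transport_simps M.a_assoc)
qed (auto simp: transport_simps cs_smult_add cs_add_smult)

lemma transport_minus:
  assumes "x \<in> carrier A" "y \<in> carrier A"
  shows "c x \<ominus>\<^bsub>T\<^esub> c y = c (x \<ominus> y)"
proof -
  interpret V: vectorspace complex_field T by (rule transport_vectorspace)
  have "\<ominus>\<^bsub>T\<^esub> c y = c ((-1) \<odot> y)"
    using V.smult_l_minus[of 1 "c y"] V.smult_one[of "c y"] assms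
    by (simp add: class_ring_simps transport_simps)
  thus ?thesis
    using assms by (simp add: a_minus_def transport_simps cs_minus[unfolded a_minus_def])
qed

lemma transport_dist:
  "\<lbrakk>x \<in> carrier A; y \<in> carrier A\<rbrakk> \<Longrightarrow> cstar_dist T (c x) (c y) = cstar_dist A x y"
  by (simp add: cstar_dist_def transport_minus transport_simps)

lemma transport_cstar_algebra: "cstar_algebra T"
proof -
  have M: "Metric_space (carrier T) (cstar_dist T)"
  proof
    fix x y show "0 \<le> cstar_dist T x y"
      by (auto simp: cstar_dist_def transport_simps(1) transport_minus transport_simps(7) nrm_nonneg)
    show "cstar_dist T x y = cstar_dist T y x"
    proof (cases "x \<in> carrier T \<and> y \<in> carrier T")
      case True
      thus ?thesis by (auto elim!: T_elim simp: transport_dist metric.commute)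
    qed (auto simp: cstar_dist_def)
  next
    fix x y assume "x \<in> carrier T" "y \<in> carrier T"
    thus "cstar_dist T x y = 0 \<longleftrightarrow> x = y"
      by (auto elim!: T_elim simp: transport_dist c_eq_iff)
  next
    fix x y z assume "x \<in> carrier T" "y \<in> carrier T" "z \<in> carrier T"
    thus "cstar_dist T x z \<le> cstar_dist T x y + cstar_dist T y z"
      by (auto elim!: T_elim simp: transport_dist intro: metric.triangle)
  qed
  have c: "Metric_space.mcomplete (carrier T) (cstar_dist T)"
    unfolding Metric_space.mcomplete_def[OF M]
  proof (intro allI impI)
    fix f assume f: "Metric_space.MCauchy (carrier T) (cstar_dist T) f"
    define g where "g = (\<lambda>n. d (f n))"
    have fc: "f n \<in> carrier T" for n
      using f unfolding Metric_space.MCauchy_def[OF M] by auto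
    have g: "g n \<in> carrier A" "f n = c (g n)" for n
      using fc[of n] by (auto simp: g_def elim!: T_elim)
    have "metric.MCauchy g"
      using f g unfolding Metric_space.MCauchy_def[OF M] metric.MCauchy_def by (auto simp: transport_dist)
    then obtain x where x: "limitin metric.mtopology g x sequentially"
      using complete by (auto simp: metric.mcomplete_def)
    hence "x \<in> carrier A" "((\<lambda>n. cstar_dist A (g n) x) \<longlonglongrightarrow> 0)"
      by (auto simp: metric.limitin_metric_dist_null)
    hence "c x \<in> carrier T" "(\<lambda>n. cstar_dist T (f n) (c x)) \<longlonglongrightarrow> 0"
      using g by (simp_all add: transport_dist transport_simps(1))
    hence "limitin (Metric_space.mtopology (carrier T) (cstar_dist T)) f (c x) sequentially"
      unfolding Metric_space.limitin_metric_dist_null[OF M] using fc by simp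
    thus "\<exists>x. limitin (Metric_space.mtopology (carrier T) (cstar_dist T)) f x sequentially" ..
  qed
  have "cstar_algebra_axioms T"
    by (rule cstar_algebra_axioms.intro; (rule c)?; (elim T_elim)?;
      simp add: transport_simps mult_assoc mult_add_left mult_add_right smult_mult_left
        smult_mult_right star_star star_add star_smult star_mult nrm_nonneg nrm_eq_0_iff
        nrm_triangle nrm_smult nrm_mult cstar_identity c_eq_iff)
  thus ?thesis
    using transport_vectorspace by (simp add: cstar_algebra_def)
qed

lemma c_finsum:
  assumes "finite I" "\<And>i. i \<in> I \<Longrightarrow> f i \<in> carrier A"
  shows "c (\<Oplus>i\<in>I. f i) = (\<Oplus>\<^bsub>T\<^esub>i\<in>I. c (f i))"
  by (rule finsum_additive[OF transport_cstar_algebra])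
    (use assms in \<open>auto simp: transport_simps\<close>)

end

section \<open>Counting projections and encoding elements of a matrix subalgebra\<close>

context matrix_units
begin

lemma mspan_induct [consumes 1, case_names zero add smult]:
  assumes x: "x \<in> mspan" and "Q \<zero>"
    and add: "\<And>x y. \<lbrakk>x \<in> mspan; y \<in> mspan; Q x; Q y\<rbrakk> \<Longrightarrow> Q (x \<oplus> y)"
    and smult: "\<And>a i j. \<lbrakk>i \<in> W; j \<in> W\<rbrakk> \<Longrightarrow> Q (a \<odot> e i j)"
  shows "Q x"
proof -
  have *: "Q (\<Oplus>i\<in>I. f i)" if "finite I" "\<And>i. i \<in> I \<Longrightarrow> f i \<in> mspan" "\<And>i. i \<in> I \<Longrightarrow> Q (f i)"
    for I :: "'w set" and f
    using that
  proof (induction I rule: finite_induct)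
    case (insert j I)
    have "(\<Oplus>i\<in>insert j I. f i) = f j \<oplus> (\<Oplus>i\<in>I. f i)"
      using insert mspan_closed by (intro cs_finsum_insert) auto
    thus ?case using insert add[of "f j" "\<Oplus>i\<in>I. f i"] by (simp add: mspan_finsum)
  qed (simp add: assms)
  have "Q (synth (coord x))"
    unfolding synth_def by (intro * smult mspan_finsum mspan_smult e_mspan finite_W)
  thus ?thesis using x by (simp add: synth_coord)
qed

text \<open>Compare unnormalised traces. Since p is the sum of the p e_ii p, whose norms are the
  diagonal coordinates of p, each nonzero projection has trace at least 1; the sum of
  \<open>P\<close> is a projection, with diagonal coordinates at most 1.\<close>

lemma card_orth_projs_le:
  assumes P: "orth_projs P" "finite P" "P \<subseteq> mspan"
  shows "card P \<le> card W"
proof -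
  note Pd = orth_projsD[OF P(1)]
  have coord_p: "coord p i i = of_real (\<Sum>k\<in>W. (cmod (coord p k i))\<^sup>2)" if p: "p \<in> P" "i \<in> W" for p i
  proof -
    have pm: "p \<in> mspan" using P p by auto
    have "coord p i i = coord (star A p \<otimes> p) i i" using Pd p by simp
    also have "\<dots> = (\<Sum>k\<in>W. cnj (coord p k i) * coord p k i)"
      using p pm by (simp only: coord_mult[OF mspan_star[OF pm] pm p(2) p(2)]) (simp add: coord_star)
    also have "\<dots> = (\<Sum>k\<in>W. of_real ((cmod (coord p k i))\<^sup>2))"
      by (intro sum.cong refl) (simp only: complex_norm_square mult.commute)
    finally show ?thesis by simp
  qed
  have one_le: "1 \<le> (\<Sum>i\<in>W. Re (coord p i i))" if p: "p \<in> P" for p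
  proof -
    have pm: "p \<in> mspan" "p \<in> carrier A" using P p Pd by auto
    have "p = p \<otimes> (\<Oplus>i\<in>W. e i i) \<otimes> p"
      using pm Pd[OF p] by (simp add: sum_e)
    also have "p \<otimes> (\<Oplus>i\<in>W. e i i) = (\<Oplus>i\<in>W. p \<otimes> e i i)"
      using pm by (intro mult_finsum) auto
    also have "\<dots> \<otimes> p = (\<Oplus>i\<in>W. p \<otimes> e i i \<otimes> p)"
      using pm by (intro finsum_mult) auto
    finally have pe: "p = (\<Oplus>i\<in>W. p \<otimes> e i i \<otimes> p)" .
    have "1 = nrm A p" using Pd[OF p] by (simp add: nrm_proj)
    also have "\<dots> \<le> (\<Sum>i\<in>W. nrm A (p \<otimes> e i i \<otimes> p))"
      by (subst pe, rule nrm_finsum) (use pm in auto)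
    also have "\<dots> = (\<Sum>i\<in>W. Re (coord p i i))"
    proof (rule sum.cong[OF refl])
      fix i assume i: "i \<in> W"
      have s: "star A (p \<otimes> e i i) = e i i \<otimes> p" using pm i Pd(3)[OF p] by (simp add: star_mult star_e)
      have "p \<otimes> e i i \<otimes> p = (p \<otimes> e i i) \<otimes> star A (p \<otimes> e i i)"
        using pm i e_mult[of i i i i] unfolding s
        by (metis e_closed mult_assoc mult_closed)
      hence "nrm A (p \<otimes> e i i \<otimes> p) = (nrm A (p \<otimes> e i i))\<^sup>2"
        using pm i nrm_mult_star[of "p \<otimes> e i i"] by simp
      also have "\<dots> = nrm A (star A (p \<otimes> e i i) \<otimes> (p \<otimes> e i i))"
        using pm i by (intro cstar_identity[symmetric]) auto
      also have "star A (p \<otimes> e i i) \<otimes> (p \<otimes> e i i) = e i i \<otimes> p \<otimes> e i i"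
        using pm i Pd(4)[OF p] unfolding s by (metis e_closed mult_assoc mult_closed)
      also have "nrm A \<dots> = cmod (coord p i i)"
        using pm i by (simp add: mspan_coord nrm_smult nrm_e)
      also have "\<dots> = Re (coord p i i)"
        unfolding coord_p[OF p i] by (simp del: of_real_sum of_real_power add: sum_nonneg)
      finally show "nrm A (p \<otimes> e i i \<otimes> p) = Re (coord p i i)" .
    qed
    finally show ?thesis .
  qed
  \<comment> \<open>The sum of the family is again a projection, so its norm is at most 1 however
    many members there are.\<close>
  define s where "s = (\<Oplus>p\<in>P. p)"
  have sm: "s \<in> mspan" unfolding s_def using P by (intro mspan_finsum) auto
  have sc: "s \<in> carrier A" using sm by (rule mspan_closed)
  have sq: "s \<otimes> q = q" if "q \<in> P" for q
  proof -
    have "s \<otimes> q = (\<Oplus>p\<in>P. p \<otimes> q)"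
      unfolding s_def using P Pd that by (intro finsum_mult) auto
    also have "\<dots> = q \<otimes> q" using P Pd that by (intro cs_finsum_single) auto
    finally show ?thesis using Pd that by simp
  qed
  have ss: "s \<otimes> s = s"
  proof -
    have "s \<otimes> s = (\<Oplus>p\<in>P. s \<otimes> p)"
      by (subst (2) s_def) (use P Pd sc in \<open>auto intro: mult_finsum\<close>)
    also have "\<dots> = s" using sq Pd unfolding s_def by (intro cs_finsum_cong) (auto simp: s_def)
    finally show ?thesis .
  qed
  have star_s: "star A s = s"
  proof -
    have "star A s = (\<Oplus>p\<in>P. star A p)"
      unfolding s_def using P Pd by (intro star_finsum) auto
    thus ?thesis unfolding s_def using Pd by (simp cong: cs_finsum_cong)
  qed
  have nrm_s: "nrm A s \<le> 1"
  proof (cases "s = \<zero>")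
    case False
    thus ?thesis using nrm_proj[OF sc star_s ss] by simp
  qed simp
  have coord_s: "coord (\<Oplus>p\<in>Q. p) i i = (\<Sum>p\<in>Q. coord p i i)" if "Q \<subseteq> P" "i \<in> W" for Q i
  proof -
    have "finite Q" using that P finite_subset by auto
    thus ?thesis using that(1)
    proof (induction Q rule: finite_induct)
      case empty
      show ?case by (simp, rule coord_eqI) (use that in auto)
    next
      case (insert p Q)
      have "(\<Oplus>p\<in>insert p Q. p) = p \<oplus> (\<Oplus>p\<in>Q. p)"
        using insert Pd by (intro cs_finsum_insert) auto
      moreover have "(\<Oplus>p\<in>Q. p) \<in> mspan" using insert P by (intro mspan_finsum) auto
      ultimately show ?case using insert P that by (auto simp: coord_add)
    qed
  qed
  have "real (card P) = (\<Sum>p\<in>P. 1)" by simp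
  also have "\<dots> \<le> (\<Sum>p\<in>P. \<Sum>i\<in>W. Re (coord p i i))"
    by (intro sum_mono one_le)
  also have "\<dots> = (\<Sum>i\<in>W. \<Sum>p\<in>P. Re (coord p i i))" by (rule sum.swap)
  also have "\<dots> = (\<Sum>i\<in>W. Re (coord s i i))"
    by (intro sum.cong refl) (simp add: coord_s s_def)
  also have "\<dots> \<le> (\<Sum>i\<in>W. 1)"
  proof (rule sum_mono)
    fix i assume "i \<in> W"
    thus "Re (coord s i i) \<le> 1"
      using coord_le_nrm[OF sm, of i i] nrm_s complex_Re_le_cmod[of "coord s i i"] by linarith
  qed
  finally show ?thesis by simp
qed

text \<open>Coordinates along an enumeration of \<open>W\<close> are an injection, which is what
  \<open>transport\<close> asks for.\<close>

lemma mspan_code: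
  obtains c :: "'a \<Rightarrow> complex mat" where "inj_on c mspan"
proof -
  obtain h where h: "bij_betw h {0..<card W} W"
    using ex_bij_betw_nat_finite[OF finite_W] by blast
  define c where "c = (\<lambda>x. mat (card W) (card W) (\<lambda>(i, j). coord x (h i) (h j)))"
  have "inj_on c mspan"
  proof (rule inj_onI, rule mspan_eqI)
    fix x y i j assume xy: "x \<in> mspan" "y \<in> mspan" "c x = c y" and ij: "i \<in> W" "j \<in> W"
    obtain k l where kl: "k < card W" "l < card W" "i = h k" "j = h l"
    proof -
      have "i \<in> h ` {0..<card W}" "j \<in> h ` {0..<card W}"
        using h ij by (auto simp: bij_betw_def)
      thus ?thesis using that by auto
    qed
    have "c x $$ (k, l) = c y $$ (k, l)" using xy by simp
    thus "coord x i j = coord y i j" using kl by (simp add: c_def)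
  qed auto
  thus ?thesis using that by blast
qed

end

context matrix_units_trace
begin

text \<open>\<open>\<psi>\<close> is the expectation and \<open>\<phi>\<close> the inclusion of a
  copy of the matrix subalgebra; the inclusion is multiplicative, hence order zero with a single
  colour. As the expectation fixes x, the error a - x occurs twice, which explains \<epsilon> / 2.
  The rank is bounded by counting the projections of \<open>F\<close> inside the matrix
  subalgebra.\<close>

lemma system_exists:
  assumes \<F>: "\<And>a. a \<in> \<F> \<Longrightarrow> a \<in> carrier A \<and> (\<exists>x\<in>mspan. nrm A (a \<ominus> x) \<le> \<epsilon> / 2)"
  obtains F J \<psi> \<phi> where "decomposable_system A 0 \<F> \<epsilon> F J \<psi> \<phi>" "contractive F A \<phi>"
    "cstar_rank F \<le> card W"
proof -
  obtain c :: "'a \<Rightarrow> complex mat" where inj: "inj_on c mspan" using mspan_code by blast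
  let ?S = "A\<lparr>carrier := mspan\<rparr>"
  interpret S: cstar_algebra ?S
    using mspan_subalgebra by (simp add: cstar_subalgebra_def)
  interpret S: cstar_transport ?S c
    by unfold_locales (use inj in simp)
  define F where "F = transport c ?S"
  note ts = S.transport_simps[folded F_def, simplified]
  interpret F: cstar_algebra F unfolding F_def by (rule S.transport_cstar_algebra)
  define \<phi> where "\<phi> = inv_into mspan c"
  define \<psi> where "\<psi> = (\<lambda>a. c (cexp a))"
  have \<phi>c [simp]: "\<phi> (c x) = x" if "x \<in> mspan" for x
    using that inj by (simp add: \<phi>_def)
  have Felim: thesis if "y \<in> carrier F" "\<And>x. \<lbrakk>x \<in> mspan; y = c x\<rbrakk> \<Longrightarrow> thesis" for y thesis
    using that by (auto simp: ts)
  have \<phi>A: "\<phi> y \<in> carrier A" if "y \<in> carrier F" for y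
    using that by (auto elim!: Felim simp: mspan_closed)
  have fin: "finite_dimensional F"
  proof -
    let ?E = "(\<lambda>(i, j). c (e i j)) ` (W \<times> W)"
    have E: "?E \<subseteq> carrier F" by (auto simp: ts)
    have sub: "subspace complex_field (F.span ?E) F" using E by (rule F.span_is_subspace)
    have sm: "submodule complex_field (F.span ?E) F" using sub by (simp add: subspace_def)
    have "c x \<in> F.span ?E" if "x \<in> mspan" for x
      using that
    proof (induction x rule: mspan_induct)
      case zero
      show ?case using submodule.zero_closed[OF sm] by (simp add: ts)
    next
      case (add x y)
      thus ?case using submodule.m_closed[OF sm, of "c x" "c y"] by (simp add: ts)
    next
      case (smult a i j)
      have "c (e i j) \<in> F.span ?E" using smult E by (intro F.span_mem) auto
      thus ?case using submodule.smult_closed[OF sm, of a "c (e i j)"] smult by (simp add: ts e_mspan)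
    qed
    hence "F.span ?E = carrier F"
      using submodule.subset[OF sm] by (auto simp: ts)
    thus ?thesis
      unfolding finite_dimensional_def F.fin_dim_def using E by (intro exI[of _ ?E]) auto
  qed
  have hom\<phi>: "\<phi> \<in> module_hom complex_field F A"
    unfolding module_hom_def
    by (auto simp: ts mspan_add mspan_smult mspan_closed)
  have fin_c: "c (\<Oplus>i\<in>I. f i) = (\<Oplus>\<^bsub>F\<^esub>i\<in>I. c (f i))" if "finite I" "\<And>i. i \<in> I \<Longrightarrow> f i \<in> mspan"
    for I :: "nat set" and f
    using S.c_finsum[of I f] finsum_subalgebra[OF mspan_subalgebra that] that by (simp add: F_def)
  have \<phi>_fin: "\<phi> (\<Oplus>\<^bsub>F\<^esub>i\<in>I. g i) = (\<Oplus>i\<in>I. \<phi> (g i))" if "finite I" "\<And>i. i \<in> I \<Longrightarrow> g i \<in> carrier F"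
    for I :: "nat set" and g
    using that \<phi>A hom\<phi>
    by (intro F.finsum_additive[OF cstar_algebra_axioms])
      (auto simp: module_hom_def ts cstar_subalgebraD(2)[OF mspan_subalgebra])
  have cpc\<phi>: "cpc F A \<phi>"
    unfolding cpc_def completely_positive_def
  proof (intro conjI allI impI hom\<phi>)
    fix n x assume "mat_pos F n x"
    then obtain y where y: "\<And>i j. \<lbrakk>i < n; j < n\<rbrakk> \<Longrightarrow> y i j \<in> carrier F"
      and x: "\<And>i j. \<lbrakk>i < n; j < n\<rbrakk> \<Longrightarrow> x i j = (\<Oplus>\<^bsub>F\<^esub>l\<in>{..<n}. star F (y l i) \<otimes>\<^bsub>F\<^esub> y l j)"
      by (rule mat_posE) blast
    have mult: "\<phi> (star F u \<otimes>\<^bsub>F\<^esub> v) = star A (\<phi> u) \<otimes> \<phi> v" if "u \<in> carrier F" "v \<in> carrier F" for u v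
      using that by (auto elim!: Felim simp: ts mspan_star mspan_mult)
    have "\<phi> (x i j) = (\<Oplus>l\<in>{..<n}. star A (\<phi> (y l i)) \<otimes> \<phi> (y l j))" if "i < n" "j < n" for i j
    proof -
      have "\<phi> (x i j) = (\<Oplus>l\<in>{..<n}. \<phi> (star F (y l i) \<otimes>\<^bsub>F\<^esub> y l j))"
        unfolding x[OF that] using y that by (intro \<phi>_fin) auto
      also have "\<dots> = (\<Oplus>l\<in>{..<n}. star A (\<phi> (y l i)) \<otimes> \<phi> (y l j))"
        using y that \<phi>A by (intro cs_finsum_cong) (auto simp: mult)
      finally show ?thesis .
    qed
    thus "mat_pos A n (\<lambda>i j. \<phi> (x i j))"
      unfolding mat_pos_def using y \<phi>A by (intro exI[of _ "\<lambda>i j. \<phi> (y i j)"]) auto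
  next
    show "contractive F A \<phi>" by (auto simp: contractive_def ts)
  qed
  have cpc\<psi>: "cpc A F \<psi>"
    unfolding cpc_def completely_positive_def
  proof (intro conjI allI impI)
    show "\<psi> \<in> module_hom complex_field A F"
      unfolding module_hom_def by (auto simp: ts \<psi>_def cexp_add cexp_smult)
    fix n x assume "mat_pos A n x"
    then obtain y where y: "\<And>i j. \<lbrakk>i < n; j < n\<rbrakk> \<Longrightarrow> y i j \<in> carrier A"
      and x: "\<And>i j. \<lbrakk>i < n; j < n\<rbrakk> \<Longrightarrow> x i j = (\<Oplus>l\<in>{..<n}. star A (y l i) \<otimes> y l j)"
      by (rule mat_posE) blast
    obtain z where z: "\<And>i j. z i j \<in> mspan"
      and zx: "\<And>i j. \<lbrakk>i < n; j < n\<rbrakk> \<Longrightarrow> cexp (x i j) = (\<Oplus>l\<in>{..<n}. star A (z l i) \<otimes> z l j)"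
      by (rule cexp_mat_pos[of n y x], rule y, assumption+, rule x, assumption+) blast
    have "\<psi> (x i j) = (\<Oplus>\<^bsub>F\<^esub>l\<in>{..<n}. star F (c (z l i)) \<otimes>\<^bsub>F\<^esub> c (z l j))" if "i < n" "j < n" for i j
      using z fin_c[of "{..<n}" "\<lambda>l. star A (z l i) \<otimes> z l j"]
      by (simp add: \<psi>_def zx[OF that] ts mspan_star mspan_mult)
    thus "mat_pos F n (\<lambda>i j. \<psi> (x i j))"
      unfolding mat_pos_def using z by (intro exI[of _ "\<lambda>i j. c (z i j)"]) (auto simp: ts)
  next
    show "contractive A F \<psi>" by (auto simp: contractive_def ts \<psi>_def nrm_cexp_le)
  qed
  have approx: "nrm A (\<phi> (\<psi> a) \<ominus> a) \<le> \<epsilon>" if a: "a \<in> \<F>" for a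
  proof -
    obtain x where x: "a \<in> carrier A" "x \<in> mspan" "nrm A (a \<ominus> x) \<le> \<epsilon> / 2" using \<F>[OF a] by blast
    have xc: "x \<in> carrier A" using x mspan_closed by simp
    have "cexp (a \<ominus> x) = cexp a \<ominus> x"
      using x xc by (simp add: cs_minus cexp_add cexp_smult cexp_id)
    hence "nrm A (cexp a \<ominus> x) \<le> \<epsilon> / 2"
      using nrm_cexp_le[of "a \<ominus> x"] x xc by simp
    moreover have "nrm A (cexp a \<ominus> a) \<le> nrm A (cexp a \<ominus> x) + nrm A (x \<ominus> a)"
      using x xc by (intro nrm_minus_triangle) auto
    ultimately show ?thesis
      using x xc nrm_minus_commute[of a x] by (simp add: \<psi>_def)
  qed
  have "decomposable_system A 0 \<F> \<epsilon> F (\<lambda>_. carrier F) \<psi> \<phi>"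
    unfolding decomposable_system_def
  proof (intro conjI allI impI ballI approx fin F.cstar_algebra_axioms cpc\<psi> hom\<phi>)
    show "direct_sum_decomp F 0 (\<lambda>_. carrier F)"
      unfolding direct_sum_decomp_def
    proof (intro conjI allI impI ballI)
      show "cstar_subalgebra (carrier F) F"
        by (simp add: cstar_subalgebra_def F.cstar_algebra_axioms)
      fix x assume x: "x \<in> carrier F"
      show "\<exists>!f. f \<in> (\<Pi>\<^sub>E i\<in>{..0::nat}. carrier F) \<and> x = (\<Oplus>\<^bsub>F\<^esub>i\<in>{..0}. f i)"
      proof (rule ex1I[of _ "\<lambda>i\<in>{..0}. x"])
        fix f assume f: "f \<in> (\<Pi>\<^sub>E i\<in>{..0::nat}. carrier F) \<and> x = (\<Oplus>\<^bsub>F\<^esub>i\<in>{..0}. f i)"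
        hence f0: "f 0 = x" by (auto simp: PiE_def)
        have f1: "f i = undefined" if "i \<noteq> 0" for i
          using PiE_arb[OF conjunct1[OF f], of i] that by simp
        show "f = (\<lambda>i\<in>{..0}. x)" using f0 f1 by (intro ext) simp
      qed (use x in auto)
    qed auto
    show "cpc (F\<lparr>carrier := carrier F\<rparr>) A \<phi>" using cpc\<phi> by simp
    show "order_zero (F\<lparr>carrier := carrier F\<rparr>) A \<phi>"
      unfolding order_zero_def
    proof (intro ballI impI, elim conjE)
      fix a b assume "a \<in> carrier (F\<lparr>carrier := carrier F\<rparr>)" "b \<in> carrier (F\<lparr>carrier := carrier F\<rparr>)"
        and 0: "a \<otimes>\<^bsub>F\<lparr>carrier := carrier F\<rparr>\<^esub> b = \<zero>\<^bsub>F\<lparr>carrier := carrier F\<rparr>\<^esub>"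
      then obtain u v where uv: "u \<in> mspan" "v \<in> mspan" "a = c u" "b = c v"
        by (auto elim!: Felim)
      have "\<phi> (c (u \<otimes> v)) = \<phi> (c \<zero>)" using 0 uv by (simp add: ts)
      thus "\<phi> a \<otimes> \<phi> b = \<zero>"
        using uv by (simp add: mspan_mult cstar_subalgebraD(2)[OF mspan_subalgebra])
    qed
  qed
  moreover have "contractive F A \<phi>" using cpc\<phi> by (simp add: cpc_def)
  moreover have "cstar_rank F \<le> card W"
  proof -
    obtain P where P: "finite P" "card P = cstar_rank F" "F.orth_projs P"
      by (rule F.cstar_rank_projs[OF fin]) blast
    note Pd = F.orth_projsD[OF P(3)]
    have m: "\<phi> p \<in> mspan" "c (\<phi> p) = p" if "p \<in> P" for p
      using Pd(1)[OF that] by (auto elim!: Felim)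
    have inj\<phi>: "inj_on \<phi> P"
      by (rule inj_on_inverseI[of _ c]) (rule m(2))
    have mm: "\<phi> (x \<otimes>\<^bsub>F\<^esub> y) = \<phi> x \<otimes> \<phi> y" if "x \<in> P" "y \<in> P" for x y
      using Pd(1)[OF that(1)] Pd(1)[OF that(2)] by (auto elim!: Felim simp: ts mspan_mult)
    have ms: "\<phi> (star F x) = star A (\<phi> x)" if "x \<in> P" for x
      using Pd(1)[OF that] by (auto elim!: Felim simp: ts mspan_star)
    have z: "\<phi> \<zero>\<^bsub>F\<^esub> = \<zero>" by (simp add: ts cstar_subalgebraD(2)[OF mspan_subalgebra])
    have "orth_projs (\<phi> ` P)"
      unfolding orth_projs_def
    proof (intro conjI ballI)
      show "\<phi> ` P \<subseteq> carrier A" using \<phi>A Pd(1) by auto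
      show "\<zero> \<notin> \<phi> ` P"
      proof
        assume "\<zero> \<in> \<phi> ` P"
        then obtain p where p: "p \<in> P" "\<phi> p = \<zero>" by auto
        hence "p = \<zero>\<^bsub>F\<^esub>" using m(2)[OF p(1)] by (simp add: ts)
        thus False using Pd(2) p by simp
      qed
      show "star A p = p" if "p \<in> \<phi> ` P" for p using that ms Pd(3) by force
      fix p q assume "p \<in> \<phi> ` P" "q \<in> \<phi> ` P"
      then obtain p' q' where pq: "p' \<in> P" "q' \<in> P" "p = \<phi> p'" "q = \<phi> q'" by auto
      show "p \<otimes> q = (if p = q then p else \<zero>)"
      proof (cases "p' = q'")
        case True
        thus ?thesis using mm[of p' q'] pq Pd(4) by simp
      next
        case False
        hence "p \<noteq> q" using inj_onD[OF inj\<phi>, of p' q'] pq by auto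
        thus ?thesis using mm[of p' q'] pq Pd(5) z False by simp
      qed
    qed
    hence "card (\<phi> ` P) \<le> card W" using P m by (intro card_orth_projs_le) auto
    thus ?thesis using card_image[OF inj\<phi>] P by simp
  qed
  ultimately show ?thesis using that by blast
qed

end

text \<open>For d = 0 the single summand is all of \<open>F\<close>, so being cpc on the summand is
  being cpc.\<close>

lemma decomposable_system_0:
  assumes "decomposable_system A 0 \<F> \<epsilon> F J \<psi> \<phi>"
  shows "cpc_approximation A \<F> \<epsilon> F \<psi> \<phi>"
proof -
  have F: "cstar_algebra F" and ds: "direct_sum_decomp F 0 J"
    using assms by (auto simp: decomposable_system_def)
  interpret F: cstar_algebra F by fact
  have "J 0 = carrier F"
  proof
    show sub: "J 0 \<subseteq> carrier F" using ds by (simp add: direct_sum_decomp_def cstar_subalgebra_def)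
    show "carrier F \<subseteq> J 0"
    proof
      fix x assume "x \<in> carrier F"
      then obtain f where f: "f \<in> (\<Pi>\<^sub>E i\<in>{..0}. J i)" "x = (\<Oplus>\<^bsub>F\<^esub>i\<in>{..0}. f i)"
        using ds by (auto simp: direct_sum_decomp_def)
      have "f 0 \<in> J 0" using f by auto
      thus "x \<in> J 0" using f sub by (auto simp: Pi_def)
    qed
  qed
  thus ?thesis
    using assms by (auto simp: decomposable_system_def cpc_approximation_def)
qed

section \<open>Endomorphisms are contractive\<close>

context matrix_unit_sequence
begin

lemma trace_units: "matrix_units_trace A (W n) (e n) tau"
  by (intro matrix_units_trace.intro units matrix_units_trace_axioms.intro tracial_state_tau)

definition sq :: "'a \<Rightarrow> real" where
  "sq x = Re (tau (star A x \<otimes> x))"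

lemmas tau_lin = linear_functionalD[OF tracial_state_linear[OF tracial_state_tau]]

text \<open>\<open>sq2\<close> refers to the trace but not to the units, so results from every level
  \<open>D n\<close> apply to the same function.\<close>

lemma sq_eq: "sq = matrix_units_trace.sq2 A tau"
  using matrix_units_trace.sq2_def[OF trace_units] by (simp add: fun_eq_iff sq_def)

lemmas sq_nonneg = matrix_units_trace.sq2_nonneg[OF trace_units, folded sq_eq]
lemmas sq_mult_le = matrix_units_trace.sq2_mult_le[OF trace_units, folded sq_eq]

text \<open>Expand \<open>sq\<close> of s x - y / s, which is nonnegative, with s^2 = r. The weight
  r keeps the factor of \<open>sq x\<close> close to 1.\<close>

lemma sq_add_le:
  assumes "x \<in> carrier A" "y \<in> carrier A" "0 < r"
  shows "sq (x \<oplus> y) \<le> (1 + r) * sq x + (1 + 1 / r) * sq y"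
proof -
  define s where "s = sqrt r"
  have s: "s > 0" "s * s = r" using assms by (auto simp: s_def)
  define u where "u = complex_of_real s \<odot> x \<oplus> complex_of_real (- 1 / s) \<odot> y"
  have "u \<in> carrier A" using assms by (simp add: u_def)
  hence "0 \<le> sq u" by (rule sq_nonneg)
  also have "sq u = r * sq x + sq y / r - Re (tau (star A x \<otimes> y)) - Re (tau (star A y \<otimes> x))"
    using assms(1,2) s(1) unfolding u_def sq_def s(2)[symmetric]
    by (simp add: star_add star_smult mult_add_left mult_add_right smult_mult_left smult_mult_right
        tau_lin field_simps)
  finally have "Re (tau (star A x \<otimes> y)) + Re (tau (star A y \<otimes> x)) \<le> r * sq x + sq y / r" by simp
  moreover have "sq (x \<oplus> y) = sq x + sq y + (Re (tau (star A x \<otimes> y)) + Re (tau (star A y \<otimes> x)))"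
    using assms by (simp add: sq_def star_add mult_add_left mult_add_right tau_lin)
  ultimately show ?thesis by (simp add: algebra_simps)
qed

text \<open>The matrix version is applied to some y within r of x. Replacing x by y costs the factor
  1 + r and the term (1 + 1 / r) r^2 = r (r + 1), both harmless as r tends to 0.\<close>

lemma nrm_le_if_sq_le:
  assumes x: "x \<in> carrier A" and C: "0 \<le> C"
    and le: "\<And>b. b \<in> carrier A \<Longrightarrow> sq (x \<otimes> b) \<le> C\<^sup>2 * sq b"
  shows "nrm A x \<le> C"
proof -
  have *: "nrm A x \<le> sqrt ((1 + r) * C\<^sup>2 + (1 + 1 / r) * r\<^sup>2) + r" if r: "0 < r" for r
  proof -
    obtain n y where y: "y \<in> D n" "nrm A (y \<ominus> x) < r" using dense[OF x r] by blast
    have yc: "y \<in> carrier A" using y D_closed(1) by blast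
    let ?C = "sqrt ((1 + r) * C\<^sup>2 + (1 + 1 / r) * r\<^sup>2)"
    have "nrm A y \<le> ?C"
    proof (rule matrix_units_trace.nrm_le_if_sq2_le[OF trace_units, folded sq_eq D_def])
      fix b assume "b \<in> D n"
      hence b: "b \<in> carrier A" using D_closed(1) by blast
      have "y \<otimes> b = x \<otimes> b \<oplus> (y \<ominus> x) \<otimes> b"
        using x yc b by (simp add: mult_add_left[symmetric])
      hence "sq (y \<otimes> b) \<le> (1 + r) * sq (x \<otimes> b) + (1 + 1 / r) * sq ((y \<ominus> x) \<otimes> b)"
        using sq_add_le[of "x \<otimes> b" "(y \<ominus> x) \<otimes> b" r] x yc b r by simp
      also have "sq ((y \<ominus> x) \<otimes> b) \<le> (nrm A (y \<ominus> x))\<^sup>2 * sq b"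
        using x yc b by (intro sq_mult_le) auto
      also have "(nrm A (y \<ominus> x))\<^sup>2 * sq b \<le> r\<^sup>2 * sq b"
        using y x yc b by (intro mult_right_mono power_mono sq_nonneg nrm_nonneg) auto
      also have "sq (x \<otimes> b) \<le> C\<^sup>2 * sq b" by (rule le[OF b])
      finally have "sq (y \<otimes> b) \<le> (1 + r) * (C\<^sup>2 * sq b) + (1 + 1 / r) * (r\<^sup>2 * sq b)"
        using r by (simp add: mult_left_mono)
      also have "\<dots> = ?C\<^sup>2 * sq b"
        using r C by (subst real_sqrt_pow2) (auto simp: algebra_simps)
      finally show "sq (y \<otimes> b) \<le> ?C\<^sup>2 * sq b" .
    qed (use y r in auto)
    thus ?thesis
      using nrm_le_minus[of x y] nrm_minus_commute[of x y] x yc y by simp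
  qed
  have "(\<lambda>n. sqrt ((1 + r n) * C\<^sup>2 + (r n + 1) * r n) + r n) \<longlonglongrightarrow> sqrt ((1 + 0) * C\<^sup>2 + (0 + 1) * 0) + 0"
    if "r \<longlonglongrightarrow> 0" for r :: "nat \<Rightarrow> real"
    by (intro tendsto_intros that)
  from this[OF LIMSEQ_inverse_real_of_nat]
  have "(\<lambda>n. sqrt ((1 + inverse (real (Suc n))) * C\<^sup>2 + (inverse (real (Suc n)) + 1) * inverse (real (Suc n)))
      + inverse (real (Suc n))) \<longlonglongrightarrow> C"
    using C by simp
  moreover have "nrm A x \<le> sqrt ((1 + inverse (real (Suc n))) * C\<^sup>2
      + (inverse (real (Suc n)) + 1) * inverse (real (Suc n))) + inverse (real (Suc n))" for n
  proof -
    define r where "r = inverse (real (Suc n))"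
    have r: "r > 0" by (simp add: r_def)
    have "(1 + 1 / r) * r\<^sup>2 = (r + 1) * r" using r by (simp add: field_simps power2_eq_square)
    thus ?thesis using *[OF r] unfolding r_def[symmetric] by simp
  qed
  ultimately show ?thesis by (rule_tac LIMSEQ_le_const) auto
qed

text \<open>In place of spectra: x -> tau (b* h(x) b) is a positive functional with value
  \<open>sq b\<close> at \<one>, so \<open>positive_functional_bound\<close> estimates
  \<open>sq (h a b)\<close>, and \<open>nrm_le_if_sq_le\<close> turns this into the norm.\<close>

lemma star_hom_contractive:
  assumes h: "star_hom A A h" "h \<one> = \<one>" and a: "a \<in> carrier A"
  shows "nrm A (h a) \<le> nrm A a"
proof (rule nrm_le_if_sq_le)
  have hc: "h x \<in> carrier A" if "x \<in> carrier A" for x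
    using h that by (auto simp: star_hom_def module_hom_def)
  show "h a \<in> carrier A" using hc a .
  show "0 \<le> nrm A a" using a by (rule nrm_nonneg)
  fix b assume b: "b \<in> carrier A"
  define f where "f = (\<lambda>x. tau (star A b \<otimes> h x \<otimes> b))"
  have f: "linear_functional A f"
    using b h hc unfolding star_hom_def module_hom_def linear_functional_def f_def
    by (auto simp: mult_add_left mult_add_right smult_mult_left smult_mult_right tau_lin)
  have eq: "Re (f (star A y \<otimes> y)) = sq (h y \<otimes> b)" if y: "y \<in> carrier A" for y
  proof -
    have "h (star A y \<otimes> y) = star A (h y) \<otimes> h y" using h y by (simp add: star_hom_def)
    thus ?thesis using hc[OF y] b by (simp add: f_def sq_def star_mult mult_assoc)
  qed
  have "Re (f (star A a \<otimes> a)) \<le> (nrm A a)\<^sup>2 * Re (f \<one>)"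
    using eq sq_nonneg hc b by (intro positive_functional_bound[OF f _ a]) auto
  thus "sq (h a \<otimes> b) \<le> (nrm A a)\<^sup>2 * sq b"
    using a b h by (simp add: eq) (simp add: f_def sq_def)
qed

end

section \<open>Matrix units in UHF-algebras\<close>

definition unit_mat :: "nat \<Rightarrow> nat \<Rightarrow> nat \<Rightarrow> complex mat" where
  "unit_mat k i j = mat k k (\<lambda>(a, b). if a = i \<and> b = j then 1 else 0)"

lemma unit_mat_carrier [simp]: "unit_mat k i j \<in> carrier_mat k k"
  by (simp add: unit_mat_def)

lemma unit_mat_mult_left:
  assumes "X \<in> carrier_mat k k" "i < k" "j < k"
  shows "unit_mat k i j * X = mat k k (\<lambda>(a, b). if a = i then X $$ (j, b) else 0)"
proof (rule eq_matI)
  fix a b assume ab: "a < dim_row (mat k k (\<lambda>(a, b). if a = i then X $$ (j, b) else 0))"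
    "b < dim_col (mat k k (\<lambda>(a, b). if a = i then X $$ (j, b) else 0))"
  have "(unit_mat k i j * X) $$ (a, b) = (\<Sum>l<k. unit_mat k i j $$ (a, l) * X $$ (l, b))"
    using assms ab by (simp add: scalar_prod_def atLeast0LessThan unit_mat_def)
  also have "\<dots> = (\<Sum>l<k. if l = j then (if a = i then X $$ (j, b) else 0) else 0)"
    using assms ab by (intro sum.cong refl) (auto simp: unit_mat_def)
  finally show "(unit_mat k i j * X) $$ (a, b) = mat k k (\<lambda>(a, b). if a = i then X $$ (j, b) else 0) $$ (a, b)"
    using assms ab by (simp add: sum.delta)
qed (use assms in \<open>auto simp: unit_mat_def\<close>)

lemma unit_mat_mult:
  assumes "i < k" "j < k" "a < k" "b < k"
  shows "unit_mat k i j * unit_mat k a b = (if j = a then unit_mat k i b else 0\<^sub>m k k)"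
  using assms by (subst unit_mat_mult_left) (auto simp: unit_mat_def intro!: eq_matI)

lemma unit_mat_cut:
  assumes X: "X \<in> carrier_mat k k" and "i < k" "j < k"
  shows "unit_mat k i i * X * unit_mat k j j = X $$ (i, j) \<cdot>\<^sub>m unit_mat k i j"
proof (rule eq_matI)
  let ?Y = "mat k k (\<lambda>(a, b). if a = i then X $$ (i, b) else 0)"
  fix a b assume ab: "a < dim_row (X $$ (i, j) \<cdot>\<^sub>m unit_mat k i j)" "b < dim_col (X $$ (i, j) \<cdot>\<^sub>m unit_mat k i j)"
  hence ab': "a < k" "b < k" by (auto simp: unit_mat_def)
  have "(unit_mat k i i * X * unit_mat k j j) $$ (a, b) = (?Y * unit_mat k j j) $$ (a, b)"
    using assms by (simp add: unit_mat_mult_left)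
  also have "\<dots> = (\<Sum>l<k. ?Y $$ (a, l) * unit_mat k j j $$ (l, b))"
    using ab' by (simp add: scalar_prod_def atLeast0LessThan unit_mat_def)
  also have "\<dots> = (\<Sum>l<k. if l = j then (if a = i \<and> b = j then X $$ (i, j) else 0) else 0)"
    using ab' assms by (intro sum.cong refl) (auto simp: unit_mat_def)
  finally show "(unit_mat k i i * X * unit_mat k j j) $$ (a, b) = (X $$ (i, j) \<cdot>\<^sub>m unit_mat k i j) $$ (a, b)"
    using assms ab' by (auto simp: sum.delta unit_mat_def)
qed (use assms in \<open>auto simp: unit_mat_def\<close>)

lemma unit_mat_adjoint:
  assumes "i < k" "j < k"
  shows "mat_adjoint (unit_mat k i j) = unit_mat k j i"
  by (rule eq_matI) (use assms in \<open>auto simp: mat_adjoint_def mat_of_rows_index unit_mat_def\<close>)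

text \<open>The units are the preimages of the standard matrix units; cutting x with them reads off
  the entries of \<open>f x\<close>, which identifies the span with \<open>S\<close>.\<close>

lemma matrix_units_of_iso:
  assumes A: "unital_cstar_algebra A" "\<one>\<^bsub>A\<^esub> \<noteq> \<zero>\<^bsub>A\<^esub>"
    and S: "cstar_subalgebra S A" "\<one>\<^bsub>A\<^esub> \<in> S"
    and iso: "cstar_isomorphic (A\<lparr>carrier := S\<rparr>) (matrix_algebra k)"
  obtains e where "matrix_units A {..<k} e" "matrix_units.mspan A {..<k} e = S"
proof -
  interpret unital_cstar_algebra A by fact
  note Sc = cstar_subalgebraD(1-6)[OF S(1)]
  obtain f where f: "star_iso (A\<lparr>carrier := S\<rparr>) (matrix_algebra k) f"
    using iso by (auto simp: cstar_isomorphic_def)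
  have bij: "bij_betw f S (carrier_mat k k)"
    using f by (simp add: star_iso_def matrix_algebra_def)
  have fadd: "f (x \<oplus>\<^bsub>A\<^esub> y) = f x + f y" if "x \<in> S" "y \<in> S" for x y
    using f that by (auto simp: star_iso_def star_hom_def module_hom_def matrix_algebra_def)
  have fsmult: "f (c \<odot>\<^bsub>A\<^esub> x) = c \<cdot>\<^sub>m f x" if "x \<in> S" for c x
    using f that by (auto simp: star_iso_def star_hom_def module_hom_def matrix_algebra_def)
  have fmult: "f (x \<otimes>\<^bsub>A\<^esub> y) = f x * f y" if "x \<in> S" "y \<in> S" for x y
    using f that by (auto simp: star_iso_def star_hom_def matrix_algebra_def)
  have fstar: "f (star A x) = mat_adjoint (f x)" if "x \<in> S" for x
    using f that by (auto simp: star_iso_def star_hom_def matrix_algebra_def)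
  have fc: "f x \<in> carrier_mat k k" if "x \<in> S" for x
    using bij that by (auto simp: bij_betw_def)
  have finj: "x = y" if "f x = f y" "x \<in> S" "y \<in> S" for x y
    using bij that by (auto simp: bij_betw_def inj_on_def)
  have f0: "f \<zero>\<^bsub>A\<^esub> = 0\<^sub>m k k"
  proof -
    have "f (0 \<odot>\<^bsub>A\<^esub> \<zero>\<^bsub>A\<^esub>) = 0 \<cdot>\<^sub>m f \<zero>\<^bsub>A\<^esub>" using Sc by (intro fsmult)
    also have "\<dots> = 0\<^sub>m k k" using fc[of "\<zero>\<^bsub>A\<^esub>"] Sc(2) by (intro eq_matI) auto
    finally show ?thesis by simp
  qed
  define e where "e = (\<lambda>i j. inv_into S f (unit_mat k i j))"
  have e: "e i j \<in> S" "f (e i j) = unit_mat k i j" for i j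
    using bij_betw_inv_into_right[OF bij, of "unit_mat k i j"] bij_betwE[OF bij_betw_inv_into[OF bij]]
    by (auto simp: e_def)
  have ec: "e i j \<in> carrier A" for i j using e Sc(1) by blast
  have partial: "(\<Oplus>\<^bsub>A\<^esub>i\<in>{..<m}. e i i) \<in> S \<and>
      f (\<Oplus>\<^bsub>A\<^esub>i\<in>{..<m}. e i i) = mat k k (\<lambda>(a, b). if a = b \<and> a < m then 1 else 0)" if "m \<le> k" for m
    using that
  proof (induction m)
    case 0
    show ?case using Sc f0 by (auto intro!: eq_matI)
  next
    case (Suc m)
    have "(\<Oplus>\<^bsub>A\<^esub>i\<in>{..<Suc m}. e i i) = e m m \<oplus>\<^bsub>A\<^esub> (\<Oplus>\<^bsub>A\<^esub>i\<in>{..<m}. e i i)"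
      unfolding lessThan_Suc using ec by (intro cs_finsum_insert) auto
    thus ?case using Suc Sc(3) e
      by (auto simp: fadd unit_mat_def intro!: eq_matI)
  qed
  have one: "(\<Oplus>\<^bsub>A\<^esub>i\<in>{..<k}. e i i) = \<one>\<^bsub>A\<^esub>"
  proof (rule finj)
    let ?s = "\<Oplus>\<^bsub>A\<^esub>i\<in>{..<k}. e i i"
    have s: "?s \<in> S" "f ?s = 1\<^sub>m k"
      using partial[of k] by (auto intro!: eq_matI)
    \<comment> \<open>That f preserves units is derived here: ?s goes to the identity matrix, and
      inserting the factor \<one> of \<open>A\<close> shows that \<one> does too.\<close>
    have "f ?s = f (?s \<otimes>\<^bsub>A\<^esub> \<one>\<^bsub>A\<^esub>)" using s Sc(1) by (auto simp: subset_iff)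
    also have "\<dots> = 1\<^sub>m k * f \<one>\<^bsub>A\<^esub>" using s S(2) by (simp add: fmult)
    also have "\<dots> = f \<one>\<^bsub>A\<^esub>" using fc[OF S(2)] by simp
    finally show "f ?s = f \<one>\<^bsub>A\<^esub>" .
  qed (use partial[of k] S in auto)
  have mu: "matrix_units A {..<k} e"
  proof
    show "star A (e i j) = e j i" if "i \<in> {..<k}" "j \<in> {..<k}" for i j
      using that e Sc(6) by (intro finj) (auto simp: fstar unit_mat_adjoint)
    show "e i j \<otimes>\<^bsub>A\<^esub> e a b = (if j = a then e i b else \<zero>\<^bsub>A\<^esub>)"
      if "i \<in> {..<k}" "j \<in> {..<k}" "a \<in> {..<k}" "b \<in> {..<k}" for i j a b
      using that e Sc(2,5) by (intro finj) (auto simp: fmult unit_mat_mult f0)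
  qed (use ec one A in auto)
  interpret mu: matrix_units A "{..<k}" e by fact
  have "mu.mspan = S"
  proof
    show "mu.mspan \<subseteq> S" using S e by (intro mu.mspan_subset) auto
    show "S \<subseteq> mu.mspan"
    proof
      fix x assume x: "x \<in> S"
      show "x \<in> mu.mspan"
      proof (rule mu.mspanI)
        show "x \<in> carrier A" using x Sc by auto
        fix i j assume ij: "i \<in> {..<k}" "j \<in> {..<k}"
        show "e i i \<otimes>\<^bsub>A\<^esub> x \<otimes>\<^bsub>A\<^esub> e j j = f x $$ (i, j) \<odot>\<^bsub>A\<^esub> e i j"
          using x ij e Sc(4,5) fc[OF x]
          by (intro finj) (auto simp: fmult fsmult unit_mat_cut)
      qed
    qed
  qed
  thus ?thesis using that mu by blast
qed

lemma (in matrix_units) orth_projs_diag: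
  "orth_projs ((\<lambda>i. e i i) ` W)" "card ((\<lambda>i. e i i) ` W) = card W"
proof -
  have neq: "e i i \<noteq> e j j" if "i \<in> W" "j \<in> W" "i \<noteq> j" for i j
    using that e_mult[of i i j j] e_mult[of i i i i] e_nonzero[of i i] by auto
  show "orth_projs ((\<lambda>i. e i i) ` W)"
    unfolding orth_projs_def
  proof (intro conjI)
    show "\<zero> \<notin> (\<lambda>i. e i i) ` W" using e_nonzero by force
  qed (use neq in \<open>auto simp: star_e e_mult\<close>)
  show "card ((\<lambda>i. e i i) ` W) = card W"
    using neq by (intro card_image inj_onI) blast
qed

text \<open>The matrix units of the smaller algebra are linearly independent, hence a basis of the larger
  one.\<close>

lemma mspan_eq_if_card_eq:
  assumes "matrix_units A W e" "matrix_units A W e'"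
    and sub: "matrix_units.mspan A W e \<subseteq> matrix_units.mspan A W e'"
  shows "matrix_units.mspan A W e = matrix_units.mspan A W e'"
proof -
  interpret m: matrix_units A W e by fact
  interpret m': matrix_units A W e' by fact
  let ?V = "A\<lparr>carrier := m'.mspan\<rparr>"
  interpret V: cstar_algebra ?V
    using m'.mspan_subalgebra by (simp add: cstar_subalgebra_def)
  define X where "X = (\<lambda>(i, j). e i j) ` (W \<times> W)"
  define Y where "Y = (\<lambda>(i, j). e' i j) ` (W \<times> W)"
  have neq: "e i j \<noteq> e k l" if "i \<in> W" "j \<in> W" "k \<in> W" "l \<in> W" "(i, j) \<noteq> (k, l)" for i j k l
  proof
    assume "e i j = e k l"
    hence "m.coord (e i j) i j = m.coord (e k l) i j" by simp
    thus False using that by (auto simp: m.coord_e)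
  qed
  have inj: "inj_on (\<lambda>(i, j). e i j) (W \<times> W)"
    using neq by (auto intro!: inj_onI)
  have X: "finite X" "X \<subseteq> m'.mspan" "card X = card (W \<times> W)"
    using sub m.e_mspan card_image[OF inj] by (auto simp: X_def)
  have Y: "finite Y" "Y \<subseteq> m'.mspan" "card Y \<le> card (W \<times> W)"
    using m'.e_mspan card_image_le[of "W \<times> W" "\<lambda>(i, j). e' i j"] by (auto simp: Y_def)
  have lc: "V.lincomb a Q = (\<Oplus>\<^bsub>A\<^esub>x\<in>Q. a x \<odot>\<^bsub>A\<^esub> x)" if "finite Q" "Q \<subseteq> m'.mspan" for a Q
    unfolding V.lincomb_def
    using m.finsum_subalgebra[OF m'.mspan_subalgebra, of Q "\<lambda>x. a x \<odot>\<^bsub>A\<^esub> x"] that m'.mspan_smult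
    by auto
  have "V.lin_indpt X"
  proof
    assume "V.lin_dep X"
    then obtain Q a v where Q: "finite Q" "Q \<subseteq> X" "V.lincomb a Q = \<zero>\<^bsub>A\<^esub>" "v \<in> Q" "a v \<noteq> 0"
      by (auto simp: V.lin_dep_def)
    obtain i j where ij: "i \<in> W" "j \<in> W" "v = e i j" using Q by (auto simp: X_def)
    have Qc: "x \<in> carrier A" if "x \<in> Q" for x using that Q X m'.mspan_closed by blast
    have cut: "e i i \<otimes>\<^bsub>A\<^esub> x \<otimes>\<^bsub>A\<^esub> e j j = (if x = v then v else \<zero>\<^bsub>A\<^esub>)" if x: "x \<in> Q" for x
    proof -
      obtain k l where "k \<in> W" "l \<in> W" "x = e k l" using x Q by (auto simp: X_def)
      thus ?thesis using ij neq[of i j k l] by (auto simp: m.e_mult)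
    qed
    have "\<zero>\<^bsub>A\<^esub> = e i i \<otimes>\<^bsub>A\<^esub> (\<Oplus>\<^bsub>A\<^esub>x\<in>Q. a x \<odot>\<^bsub>A\<^esub> x) \<otimes>\<^bsub>A\<^esub> e j j"
      using Q lc[of Q a] X ij by simp
    also have "e i i \<otimes>\<^bsub>A\<^esub> (\<Oplus>\<^bsub>A\<^esub>x\<in>Q. a x \<odot>\<^bsub>A\<^esub> x) = (\<Oplus>\<^bsub>A\<^esub>x\<in>Q. e i i \<otimes>\<^bsub>A\<^esub> (a x \<odot>\<^bsub>A\<^esub> x))"
      using Q Qc ij by (intro m.mult_finsum) auto
    also have "\<dots> \<otimes>\<^bsub>A\<^esub> e j j = (\<Oplus>\<^bsub>A\<^esub>x\<in>Q. e i i \<otimes>\<^bsub>A\<^esub> (a x \<odot>\<^bsub>A\<^esub> x) \<otimes>\<^bsub>A\<^esub> e j j)"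
      using Q Qc ij by (intro m.finsum_mult) auto
    also have "\<dots> = e i i \<otimes>\<^bsub>A\<^esub> (a v \<odot>\<^bsub>A\<^esub> v) \<otimes>\<^bsub>A\<^esub> e j j"
      using Q Qc ij cut by (intro m.cs_finsum_single) (auto simp: m.smult_mult_left m.smult_mult_right)
    also have "\<dots> = a v \<odot>\<^bsub>A\<^esub> v"
      using Q Qc[of v] ij cut[of v] by (simp add: m.smult_mult_left m.smult_mult_right)
    finally show False
      using m.cs_smult_eq_0[of "a v" v] Q ij m.e_nonzero[of i j] by auto
  qed
  have span_sub: "subspace complex_field (V.span Z) ?V" if "Z \<subseteq> m'.mspan" for Z
    using V.span_is_subspace[of Z] that by simp
  have genY: "V.span Y = carrier ?V"
  proof -
    have sm: "submodule complex_field (V.span Y) ?V" using span_sub Y by (simp add: subspace_def)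
    have "x \<in> V.span Y" if "x \<in> m'.mspan" for x
      using that
    proof (induction x rule: m'.mspan_induct)
      case zero
      show ?case using submodule.zero_closed[OF sm] by simp
    next
      case (add x y)
      thus ?case using submodule.m_closed[OF sm, of x y] by simp
    next
      case (smult a i j)
      have "e' i j \<in> V.span Y" using smult Y by (intro V.span_mem) (auto simp: Y_def)
      thus ?case using submodule.smult_closed[OF sm, of a "e' i j"] by simp
    qed
    thus ?thesis using submodule.subset[OF sm] by auto
  qed
  have "m'.mspan \<subseteq> m.mspan"
  proof
    fix x assume x: "x \<in> m'.mspan"
    have "x \<in> V.span X"
    proof (rule ccontr)
      assume nx: "x \<notin> V.span X"
      hence nX: "x \<notin> X" using X V.span_mem[of X x] by auto
      have "V.lin_indpt (X \<union> {x})"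
        using V.lin_dep_iff_in_span[of X x] X x nX nx \<open>V.lin_indpt X\<close> by auto
      hence "card (X \<union> {x}) \<le> card Y"
        using X Y x genY by (intro V.li_smaller_than_gen) auto
      thus False using X Y nX by simp
    qed
    then obtain a Q where Q: "finite Q" "Q \<subseteq> X" "x = V.lincomb a Q" by (auto simp: V.span_def)
    hence "x = (\<Oplus>\<^bsub>A\<^esub>x\<in>Q. a x \<odot>\<^bsub>A\<^esub> x)" using lc[of Q a] X by auto
    moreover have "Q \<subseteq> m.mspan" using Q m.e_mspan by (auto simp: X_def)
    ultimately show "x \<in> m.mspan" using Q by (auto intro!: m.mspan_finsum m.mspan_smult)
  qed
  thus ?thesis using sub by auto
qed

section \<open>Infinite tensor powers\<close>

lemma (in cstar_algebra) finsum_Times: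
  assumes "finite I" "finite J" "\<And>i j. \<lbrakk>i \<in> I; j \<in> J\<rbrakk> \<Longrightarrow> f i j \<in> carrier A"
  shows "(\<Oplus>p\<in>I \<times> J. f (fst p) (snd p)) = (\<Oplus>i\<in>I. \<Oplus>j\<in>J. f i j)"
  using assms(1,3)
proof (induction I rule: finite_induct)
  case (insert a I)
  have eq: "insert a I \<times> J = Pair a ` J \<union> I \<times> J" by auto
  have "(\<Oplus>p\<in>insert a I \<times> J. f (fst p) (snd p))
      = (\<Oplus>p\<in>Pair a ` J. f (fst p) (snd p)) \<oplus> (\<Oplus>p\<in>I \<times> J. f (fst p) (snd p))"
    unfolding eq using insert assms(2) by (intro M.finsum_Un_disjoint) auto
  also have "(\<Oplus>p\<in>Pair a ` J. f (fst p) (snd p)) = (\<Oplus>j\<in>J. f a j)"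
    using insert by (subst M.finsum_reindex) (auto simp: inj_on_def)
  also have "(\<Oplus>p\<in>I \<times> J. f (fst p) (snd p)) = (\<Oplus>i\<in>I. \<Oplus>j\<in>J. f i j)"
    using insert by simp
  also have "(\<Oplus>j\<in>J. f a j) \<oplus> \<dots> = (\<Oplus>i\<in>insert a I. \<Oplus>j\<in>J. f i j)"
    using insert assms(2) by (intro cs_finsum_insert[symmetric] cs_finsum_closed) auto
  finally show ?case .
qed simp

text \<open>Indexing by the list of positions lets inductions on \<open>L\<close> remove a letter
  together with its position.\<close>

definition words :: "nat \<Rightarrow> 'i list \<Rightarrow> nat list set" where
  "words k L = {w. length w = length L \<and> set w \<subseteq> {..<k}}"

lemma words_Nil [simp]: "words k [] = {[]}"
  by (auto simp: words_def)

lemma words_Cons: "words k (i # L) = (\<lambda>p. fst p # snd p) ` ({..<k} \<times> words k L)"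
proof -
  have "w \<in> (\<lambda>p. fst p # snd p) ` ({..<k} \<times> words k L)" if "w \<in> words k (i # L)" for w
    using that by (cases w) (auto simp: words_def intro!: image_eqI[of _ _ "(hd w, tl w)"])
  thus ?thesis by (auto simp: words_def)
qed

lemma finite_words [simp]: "finite (words k L)"
  using finite_lists_length_eq[of "{..<k}" "length L"] by (simp add: words_def conj_commute)

lemma card_words: "card (words k L) = k ^ length L"
  using card_lists_length_eq[of "{..<k}" "length L"] by (simp add: words_def conj_commute)

locale tensor_power = unital_cstar_algebra A + B: unital_cstar_algebra B
  for A :: "'a cstar_alg" (structure) and B :: "'b cstar_alg" +
  fixes \<iota> :: "int \<Rightarrow> 'b \<Rightarrow> 'a"
  assumes itp: "infinite_tensor_power B A \<iota>"
begin

lemma \<iota>_closed [simp, intro]: "x \<in> carrier B \<Longrightarrow> \<iota> i x \<in> carrier A"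
  using itp by (auto simp: infinite_tensor_power_def star_hom_def module_hom_def)

lemma \<iota>_add: "\<lbrakk>x \<in> carrier B; y \<in> carrier B\<rbrakk> \<Longrightarrow> \<iota> i (x \<oplus>\<^bsub>B\<^esub> y) = \<iota> i x \<oplus> \<iota> i y"
  using itp by (auto simp: infinite_tensor_power_def star_hom_def module_hom_def)

lemma \<iota>_smult: "x \<in> carrier B \<Longrightarrow> \<iota> i (c \<odot>\<^bsub>B\<^esub> x) = c \<odot> \<iota> i x"
  using itp by (auto simp: infinite_tensor_power_def star_hom_def module_hom_def)

lemma \<iota>_mult: "\<lbrakk>x \<in> carrier B; y \<in> carrier B\<rbrakk> \<Longrightarrow> \<iota> i (x \<otimes>\<^bsub>B\<^esub> y) = \<iota> i x \<otimes> \<iota> i y"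
  using itp by (auto simp: infinite_tensor_power_def star_hom_def)

lemma \<iota>_star: "x \<in> carrier B \<Longrightarrow> \<iota> i (star B x) = star A (\<iota> i x)"
  using itp by (auto simp: infinite_tensor_power_def star_hom_def)

lemma \<iota>_one [simp]: "\<iota> i \<one>\<^bsub>B\<^esub> = \<one>"
  using itp by (auto simp: infinite_tensor_power_def)

lemma \<iota>_commute:
  "\<lbrakk>i \<noteq> j; x \<in> carrier B; y \<in> carrier B\<rbrakk> \<Longrightarrow> \<iota> i x \<otimes> \<iota> j y = \<iota> j y \<otimes> \<iota> i x"
  using itp by (auto simp: infinite_tensor_power_def)

lemma \<iota>_zero [simp]: "\<iota> i \<zero>\<^bsub>B\<^esub> = \<zero>"
  using \<iota>_smult[of "\<zero>\<^bsub>B\<^esub>" i 0] by simp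

lemma nrm_tensor_eval:
  "\<lbrakk>finite I; x \<in> tensors B I\<rbrakk> \<Longrightarrow> nrm A (tensor_eval A \<iota> I x) = spatial_norm B I x"
  using itp by (auto simp: infinite_tensor_power_def)

text \<open>By the norm formula over the empty set of positions, \<open>\<one>\<close> has norm \<open>1\<close>.\<close>

lemma A_nontrivial: "\<one> \<noteq> \<zero>"
proof
  assume 0: "\<one> = \<zero>"
  \<comment> \<open>Over no positions every family is admissible and products are empty, so only the
    number of summands counts; a single summand represents the unit.\<close>
  define x :: "(int \<Rightarrow> 'b) list" where "x = [\<lambda>_. undefined]"
  have len: "product_state_sq B {} f z = of_nat (length z * length z)" for f z
    by (simp add: product_state_sq_def sum_list_triv)
  have "nrm A (tensor_eval A \<iota> {} x) = spatial_norm B {} x"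
    by (rule nrm_tensor_eval) (auto simp: tensors_def)
  moreover have "tensor_eval A \<iota> {} x = \<zero>" by (simp add: tensor_eval_def x_def 0)
  moreover have "{sqrt (Re (product_state_sq B {} f (tensor_mult B x y))) | f y.
      (\<forall>i\<in>{}. state B (f i)) \<and> y \<in> tensors B {} \<and> product_state_sq B {} f y = 1} = {1}"
    (is "?X = _")
  proof -
    have lm: "length (tensor_mult B x y) = length y" for y
      by (simp add: tensor_mult_def x_def)
    have "r = 1" if "r \<in> ?X" for r
      using that by (auto simp: len lm simp del: of_nat_mult)
    moreover have "1 \<in> ?X"
      using lm[of x] by (auto simp: len tensors_def x_def intro!: exI[of _ x])
    ultimately show ?thesis by blast
  qed
  ultimately show False by (simp add: spatial_norm_def)
qed

lemma B_nontrivial: "\<one>\<^bsub>B\<^esub> \<noteq> \<zero>\<^bsub>B\<^esub>"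
  using \<iota>_one[of 0] \<iota>_zero[of 0] A_nontrivial by metis

text \<open>Each vector state in the spatial norm over one position is a positive functional on \<open>B\<close>. If
  there were no states at all, the supremum would not depend on \<open>b\<close> and hence vanish.\<close>

lemma \<iota>_contractive:
  assumes b: "b \<in> carrier B"
  shows "nrm A (\<iota> i b) \<le> nrm B b"
proof -
  define x where "x = (\<lambda>b :: 'b. [\<lambda>_ :: int. b])"
  define X where "X = (\<lambda>b. {sqrt (Re (product_state_sq B {i} f (tensor_mult B (x b) y))) | f y.
      (\<forall>j\<in>{i}. state B (f j)) \<and> y \<in> tensors B {i} \<and> product_state_sq B {i} f y = 1})"
  have eq: "nrm A (\<iota> i c) = Sup (X c)" if c: "c \<in> carrier B" for c
  proof -
    have "nrm A (tensor_eval A \<iota> {i} (x c)) = spatial_norm B {i} (x c)"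
      using c by (intro nrm_tensor_eval) (auto simp: tensors_def x_def)
    moreover have "tensor_eval A \<iota> {i} (x c) = \<iota> i c"
      using c by (simp add: tensor_eval_def x_def)
    ultimately show ?thesis by (simp add: spatial_norm_def X_def)
  qed
  \<comment> \<open>At a single position a formal sum of tensors collapses to one element of
    \<open>B\<close>, and the product state becomes f at that element.\<close>
  define Z where "Z = (\<lambda>z. foldr (\<lambda>u s. u i \<oplus>\<^bsub>B\<^esub> s) z \<zero>\<^bsub>B\<^esub>)"
  have Zc: "Z z \<in> carrier B" if "z \<in> tensors B {i}" for z
    using that by (induction z) (auto simp: Z_def tensors_def)
  have ps: "product_state_sq B {i} f z = f i (star B (Z z) \<otimes>\<^bsub>B\<^esub> Z z)"
    if f: "state B (f i)" and z: "z \<in> tensors B {i}" for f z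
  proof -
    have fl: "linear_functional B (f i)" using f by (simp add: state_def linear_functional_def)
    note fl = B.linear_functionalD[OF fl]
    have inner: "(\<Sum>v\<leftarrow>w. f i (a \<otimes>\<^bsub>B\<^esub> v i)) = f i (a \<otimes>\<^bsub>B\<^esub> Z w)"
      if "a \<in> carrier B" "w \<in> tensors B {i}" for a w
      using that(2)
    proof (induction w)
      case (Cons v w)
      have "w \<in> tensors B {i}" "v i \<in> carrier B" using Cons.prems by (auto simp: tensors_def)
      thus ?case using Cons.IH Zc[of w] that(1)
        by (simp add: Z_def fl B.mult_add_right)
    qed (use that fl in \<open>simp add: Z_def\<close>)
    have outer: "(\<Sum>u\<leftarrow>w. f i (star B (u i) \<otimes>\<^bsub>B\<^esub> a)) = f i (star B (Z w) \<otimes>\<^bsub>B\<^esub> a)"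
      if "a \<in> carrier B" "w \<in> tensors B {i}" for a w
      using that(2)
    proof (induction w)
      case (Cons v w)
      have w: "w \<in> tensors B {i}" "v i \<in> carrier B" using Cons.prems by (auto simp: tensors_def)
      have "Z (v # w) = v i \<oplus>\<^bsub>B\<^esub> Z w" by (simp add: Z_def)
      thus ?case using Cons.IH[OF w(1)] Zc[OF w(1)] w that(1)
        by (simp add: fl B.mult_add_left B.star_add)
    qed (use that fl in \<open>simp add: Z_def\<close>)
    have "product_state_sq B {i} f z = (\<Sum>u\<leftarrow>z. \<Sum>v\<leftarrow>z. f i (star B (u i) \<otimes>\<^bsub>B\<^esub> v i))"
      by (simp add: product_state_sq_def)
    also have "\<dots> = (\<Sum>u\<leftarrow>z. f i (star B (u i) \<otimes>\<^bsub>B\<^esub> Z z))"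
    proof (rule arg_cong[of _ _ sum_list], rule map_cong[OF refl])
      fix u assume "u \<in> set z"
      hence "u i \<in> carrier B" using z by (auto simp: tensors_def)
      thus "(\<Sum>v\<leftarrow>z. f i (star B (u i) \<otimes>\<^bsub>B\<^esub> v i)) = f i (star B (u i) \<otimes>\<^bsub>B\<^esub> Z z)"
        using z by (intro inner) auto
    qed
    also have "\<dots> = f i (star B (Z z) \<otimes>\<^bsub>B\<^esub> Z z)"
      using z Zc by (intro outer)
    finally show ?thesis .
  qed
  have le: "r \<le> nrm B b" if r: "r \<in> X b" for r
  proof -
    obtain f y where fy: "r = sqrt (Re (product_state_sq B {i} f (tensor_mult B (x b) y)))"
      "state B (f i)" "y \<in> tensors B {i}" "product_state_sq B {i} f y = 1"
      using r by (auto simp: X_def)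
    have tm: "tensor_mult B (x b) y \<in> tensors B {i}"
      using fy b by (auto simp: tensor_mult_def x_def tensors_def)
    have Ztm: "Z (tensor_mult B (x b) w) = b \<otimes>\<^bsub>B\<^esub> Z w" if "w \<in> tensors B {i}" for w
      using that
    proof (induction w)
      case (Cons v w)
      have w: "w \<in> tensors B {i}" "v i \<in> carrier B" using Cons.prems by (auto simp: tensors_def)
      have "Z (tensor_mult B (x b) (v # w)) = b \<otimes>\<^bsub>B\<^esub> v i \<oplus>\<^bsub>B\<^esub> Z (tensor_mult B (x b) w)"
        by (simp add: Z_def tensor_mult_def x_def)
      also have "\<dots> = b \<otimes>\<^bsub>B\<^esub> Z (v # w)"
        unfolding Cons.IH[OF w(1)] using Zc[OF w(1)] w b by (simp add: Z_def B.mult_add_right)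
      finally show ?case .
    qed (use b in \<open>simp add: Z_def tensor_mult_def x_def\<close>)
    define Y where "Y = Z y"
    have Y: "Y \<in> carrier B" using Zc fy by (simp add: Y_def)
    define g where "g = (\<lambda>a. f i (star B Y \<otimes>\<^bsub>B\<^esub> a \<otimes>\<^bsub>B\<^esub> Y))"
    have fl: "linear_functional B (f i)" using fy by (simp add: state_def linear_functional_def)
    have g: "linear_functional B g"
      using Y unfolding linear_functional_def g_def
      by (auto simp: B.mult_add_left B.mult_add_right B.smult_mult_left B.smult_mult_right
          B.linear_functionalD[OF fl])
    have geq: "g (star B a \<otimes>\<^bsub>B\<^esub> a) = f i (star B (a \<otimes>\<^bsub>B\<^esub> Y) \<otimes>\<^bsub>B\<^esub> (a \<otimes>\<^bsub>B\<^esub> Y))"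
      if "a \<in> carrier B" for a
      using that Y by (simp add: g_def B.star_mult B.mult_assoc)
    have fpos: "0 \<le> Re (f i (star B a \<otimes>\<^bsub>B\<^esub> a))" if "a \<in> carrier B" for a
      using fy(2) that by (auto simp: state_def complex_nonneg_Reals_iff)
    have "Re (g (star B b \<otimes>\<^bsub>B\<^esub> b)) \<le> (nrm B b)\<^sup>2 * Re (g \<one>\<^bsub>B\<^esub>)"
      using Y fpos by (intro B.positive_functional_bound[OF g _ b]) (simp add: geq)
    also have "g \<one>\<^bsub>B\<^esub> = 1" using ps[of f, OF fy(2,3)] fy(4) Y by (simp add: g_def Y_def)
    also have "g (star B b \<otimes>\<^bsub>B\<^esub> b) = product_state_sq B {i} f (tensor_mult B (x b) y)"
      using ps[of f, OF fy(2) tm] Ztm[OF fy(3)] geq[OF b] by (simp add: Y_def)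
    finally have "Re (product_state_sq B {i} f (tensor_mult B (x b) y)) \<le> (nrm B b)\<^sup>2" by simp
    hence "r \<le> sqrt ((nrm B b)\<^sup>2)" unfolding fy(1) by (rule real_sqrt_le_mono)
    thus ?thesis using B.nrm_nonneg[OF b] by simp
  qed
  show ?thesis
  proof (cases "X b = {}")
    case False
    thus ?thesis unfolding eq[OF b] using le by (rule cSup_least)
  next
    case True
    have "X \<zero>\<^bsub>B\<^esub> = {}" using True by (auto simp: X_def)
    hence "Sup {} = (0 :: real)" using eq[of "\<zero>\<^bsub>B\<^esub>"] by simp
    thus ?thesis using eq[OF b] True B.nrm_nonneg[OF b] by simp
  qed
qed

subsection \<open>Tensor products of matrix units\<close>

primrec Em :: "(nat \<Rightarrow> nat \<Rightarrow> 'b) \<Rightarrow> int list \<Rightarrow> nat list \<Rightarrow> nat list \<Rightarrow> 'a" where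
  "Em e [] v w = \<one>"
| "Em e (i # L) v w = \<iota> i (e (hd v) (hd w)) \<otimes> Em e L (tl v) (tl w)"

end

locale tensor_units = tensor_power + BM: matrix_units B "{..<k}" e for k :: nat and e
begin

lemma Em_closed [simp, intro]: "\<lbrakk>v \<in> words k L; w \<in> words k L\<rbrakk> \<Longrightarrow> Em e L v w \<in> carrier A"
  by (induction L arbitrary: v w) (auto simp: words_Cons)

lemma Em_commute:
  assumes "i \<notin> set L" "x \<in> carrier B" "v \<in> words k L" "w \<in> words k L"
  shows "\<iota> i x \<otimes> Em e L v w = Em e L v w \<otimes> \<iota> i x"
  using assms(1,3,4)
proof (induction L arbitrary: v w)
  case (Cons j L)
  obtain a v' b w' where vw: "v = a # v'" "w = b # w'" "a < k" "b < k" "v' \<in> words k L" "w' \<in> words k L"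
    using Cons.prems by (auto simp: words_Cons)
  have 1: "\<iota> i x \<otimes> \<iota> j (e a b) = \<iota> j (e a b) \<otimes> \<iota> i x"
    using Cons.prems vw assms by (intro \<iota>_commute) auto
  have 2: "\<iota> i x \<otimes> Em e L v' w' = Em e L v' w' \<otimes> \<iota> i x"
    using Cons vw by auto
  note cl = \<iota>_closed[OF assms(2), of i] \<iota>_closed[OF BM.e_closed, of a b j] Em_closed[OF vw(5,6)]
  have "\<iota> i x \<otimes> (\<iota> j (e a b) \<otimes> Em e L v' w') = \<iota> j (e a b) \<otimes> (\<iota> i x \<otimes> Em e L v' w')"
    using 1 cl vw by (metis lessThan_iff mult_assoc)
  also have "\<dots> = \<iota> j (e a b) \<otimes> Em e L v' w' \<otimes> \<iota> i x"
    unfolding 2 using cl vw by (simp add: mult_assoc)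
  finally show ?case by (simp add: vw)
qed (use assms in auto)

text \<open>Distinct positions let the head factor pass the tail, so products are computed factor by
  factor and the sum over words splits into a sum over letters and a sum over shorter words.\<close>

lemma matrix_units_Em:
  assumes "distinct L"
  shows "matrix_units A (words k L) (Em e L)"
  using assms
proof (induction L)
  case Nil
  show ?case
    by unfold_locales (auto simp: A_nontrivial)
next
  case (Cons i L)
  interpret m: matrix_units A "words k L" "Em e L" using Cons by simp
  have i: "i \<notin> set L" using Cons by simp
  have swap: "\<iota> i x \<otimes> Em e L v w = Em e L v w \<otimes> \<iota> i x"
    if "x \<in> carrier B" "v \<in> words k L" "w \<in> words k L" for x v w
    using that by (intro Em_commute i)
  have mm: "(\<iota> i x \<otimes> Em e L v w) \<otimes> (\<iota> i y \<otimes> Em e L v' w') = \<iota> i (x \<otimes>\<^bsub>B\<^esub> y) \<otimes> (Em e L v w \<otimes> Em e L v' w')"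
    if "x \<in> carrier B" "y \<in> carrier B" "v \<in> words k L" "w \<in> words k L" "v' \<in> words k L" "w' \<in> words k L"
    for x y v w v' w'
  proof -
    note cl = \<iota>_closed[OF that(1), of i] \<iota>_closed[OF that(2), of i] Em_closed[OF that(3,4)] Em_closed[OF that(5,6)]
    have "(\<iota> i x \<otimes> Em e L v w) \<otimes> (\<iota> i y \<otimes> Em e L v' w') = \<iota> i x \<otimes> (Em e L v w \<otimes> \<iota> i y) \<otimes> Em e L v' w'"
      using cl by (simp add: mult_assoc)
    also have "\<dots> = \<iota> i x \<otimes> (\<iota> i y \<otimes> Em e L v w) \<otimes> Em e L v' w'"
      using that by (simp add: swap)
    finally show ?thesis using cl that by (simp add: mult_assoc \<iota>_mult)
  qed
  show ?case
  proof
    fix v w assume "v \<in> words k (i # L)" "w \<in> words k (i # L)"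
    then obtain a v' b w' where vw: "v = a # v'" "w = b # w'" "a < k" "b < k" "v' \<in> words k L" "w' \<in> words k L"
      by (auto simp: words_Cons)
    show "Em e (i # L) v w \<in> carrier A" using vw by auto
    have "star A (\<iota> i (e a b) \<otimes> Em e L v' w') = Em e L w' v' \<otimes> \<iota> i (e b a)"
      using vw by (simp add: star_mult m.star_e \<iota>_star[symmetric] BM.star_e)
    thus "star A (Em e (i # L) v w) = Em e (i # L) w v"
      using vw swap[of "e b a" w' v'] by simp
  next
    fix v w x y assume "v \<in> words k (i # L)" "w \<in> words k (i # L)" "x \<in> words k (i # L)" "y \<in> words k (i # L)"
    then obtain a v' b w' c x' d y' where
      vw: "v = a # v'" "w = b # w'" "a < k" "b < k" "v' \<in> words k L" "w' \<in> words k L"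
      and xy: "x = c # x'" "y = d # y'" "c < k" "d < k" "x' \<in> words k L" "y' \<in> words k L"
      by (auto simp: words_Cons)
    have "Em e (i # L) v w \<otimes> Em e (i # L) x y
        = \<iota> i (e a b \<otimes>\<^bsub>B\<^esub> e c d) \<otimes> (Em e L v' w' \<otimes> Em e L x' y')"
      using vw xy mm[of "e a b" "e c d" v' w' x' y'] by simp
    also have "\<dots> = (if w = x then Em e (i # L) v y else \<zero>)"
      using vw xy by (auto simp: BM.e_mult m.e_mult)
    finally show "Em e (i # L) v w \<otimes> Em e (i # L) x y = (if w = x then Em e (i # L) v y else \<zero>)" .
  next
    have inj: "inj_on (\<lambda>p. fst p # snd p) ({..<k} \<times> words k L)" by (auto simp: inj_on_def)
    have "(\<Oplus>v\<in>words k (i # L). Em e (i # L) v v)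
        = (\<Oplus>p\<in>{..<k} \<times> words k L. \<iota> i (e (fst p) (fst p)) \<otimes> Em e L (snd p) (snd p))"
      unfolding words_Cons by (subst M.finsum_reindex[OF _ inj]) auto
    also have "\<dots> = (\<Oplus>a\<in>{..<k}. \<Oplus>v\<in>words k L. \<iota> i (e a a) \<otimes> Em e L v v)"
      by (rule finsum_Times) auto
    also have "\<dots> = (\<Oplus>a\<in>{..<k}. \<iota> i (e a a) \<otimes> (\<Oplus>v\<in>words k L. Em e L v v))"
      by (intro cs_finsum_cong mult_finsum[symmetric]) (auto intro!: cs_finsum_closed mult_closed)
    also have "\<dots> = (\<Oplus>a\<in>{..<k}. \<iota> i (e a a))"
      by (intro cs_finsum_cong) (auto simp: m.sum_e)
    also have "\<dots> = \<iota> i (\<Oplus>\<^bsub>B\<^esub>a\<in>{..<k}. e a a)"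
      by (rule B.finsum_additive[OF cstar_algebra_axioms, symmetric]) (auto simp: \<iota>_add)
    finally show "(\<Oplus>v\<in>words k (i # L). Em e (i # L) v v) = \<one>" by (simp add: BM.sum_e)
  qed (auto simp: A_nontrivial)
qed

abbreviation Dm :: "int list \<Rightarrow> 'a set" where
  "Dm L \<equiv> matrix_units.mspan A (words k L) (Em e L)"

text \<open>Scalar corners are the membership criterion of \<open>mspan\<close>; an element at one
  position is thus placed in the tensor product without expanding it in units.\<close>

lemma Em_cut:
  assumes "distinct L" "i \<in> set L" "x \<in> BM.mspan" "v \<in> words k L" "w \<in> words k L"
  shows "\<exists>c. Em e L v v \<otimes> \<iota> i x \<otimes> Em e L w w = c \<odot> Em e L v w"
  using assms(1,2,4,5)
proof (induction L arbitrary: v w)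
  case (Cons j L)
  interpret m: matrix_units A "words k L" "Em e L" using Cons matrix_units_Em by simp
  note xc = BM.mspan_closed[OF assms(3)]
  obtain a v' b w' where vw: "v = a # v'" "w = b # w'" "a < k" "b < k" "v' \<in> words k L" "w' \<in> words k L"
    using Cons.prems by (auto simp: words_Cons)
  have j: "j \<notin> set L" using Cons by simp
  note cl = \<iota>_closed[OF xc, of i] \<iota>_closed[OF BM.e_closed, of a a j] \<iota>_closed[OF BM.e_closed, of b b j]
    Em_closed[OF vw(5,5)] Em_closed[OF vw(6,6)]
  have cl': "\<iota> j (e a a) \<in> carrier A" "\<iota> j (e b b) \<in> carrier A" using cl vw by auto
  show ?case
  proof (cases "i = j")
    case True
    obtain c where c: "e a a \<otimes>\<^bsub>B\<^esub> x \<otimes>\<^bsub>B\<^esub> e b b = c \<odot>\<^bsub>B\<^esub> e a b"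
      using BM.mspan_coord[OF assms(3)] vw by auto
    have s1: "Em e L v' v' \<otimes> \<iota> j y = \<iota> j y \<otimes> Em e L v' v'" if "y \<in> carrier B" for y
      using that vw j by (intro Em_commute[symmetric]) auto
    have "(\<iota> j (e a a) \<otimes> Em e L v' v') \<otimes> \<iota> j x \<otimes> (\<iota> j (e b b) \<otimes> Em e L w' w')
        = \<iota> j (e a a) \<otimes> (Em e L v' v' \<otimes> \<iota> j (x \<otimes>\<^bsub>B\<^esub> e b b)) \<otimes> Em e L w' w'"
      using cl cl' xc vw True by (simp add: mult_assoc \<iota>_mult)
    also have "\<dots> = \<iota> j (e a a \<otimes>\<^bsub>B\<^esub> x \<otimes>\<^bsub>B\<^esub> e b b) \<otimes> (Em e L v' v' \<otimes> Em e L w' w')"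
      unfolding s1[OF B.mult_closed[OF xc BM.e_closed, of b b, simplified, OF vw(4)]]
      using cl cl' xc vw True by (simp add: mult_assoc \<iota>_mult B.mult_assoc)
    also have "\<dots> = (if v' = w' then c else 0) \<odot> Em e (j # L) v w"
      using vw cl by (simp add: c \<iota>_smult m.e_mult smult_mult_left)
    finally have "Em e (j # L) v v \<otimes> \<iota> i x \<otimes> Em e (j # L) w w = (if v' = w' then c else 0) \<odot> Em e (j # L) v w"
      by (simp only: vw(1,2) True Em.simps list.sel)
    thus ?thesis ..
  next
    case False
    hence iL: "i \<in> set L" using Cons by simp
    obtain c where c: "Em e L v' v' \<otimes> \<iota> i x \<otimes> Em e L w' w' = c \<odot> Em e L v' w'"
      using Cons.IH[of v' w'] Cons.prems iL vw by auto
    have s1: "Em e L v' v' \<otimes> \<iota> j y = \<iota> j y \<otimes> Em e L v' v'" if "y \<in> carrier B" for y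
      using that vw j by (intro Em_commute[symmetric]) auto
    have s2: "\<iota> i x \<otimes> \<iota> j y = \<iota> j y \<otimes> \<iota> i x" if "y \<in> carrier B" for y
      using False that xc by (intro \<iota>_commute)
    have ebc: "e b b \<in> carrier B" using vw by simp
    have "(\<iota> j (e a a) \<otimes> Em e L v' v') \<otimes> \<iota> i x \<otimes> (\<iota> j (e b b) \<otimes> Em e L w' w')
        = \<iota> j (e a a) \<otimes> (Em e L v' v' \<otimes> (\<iota> i x \<otimes> \<iota> j (e b b))) \<otimes> Em e L w' w'"
      using cl cl' by (simp add: mult_assoc)
    also have "\<iota> i x \<otimes> \<iota> j (e b b) = \<iota> j (e b b) \<otimes> \<iota> i x" by (rule s2[OF ebc])
    also have "\<iota> j (e a a) \<otimes> (Em e L v' v' \<otimes> (\<iota> j (e b b) \<otimes> \<iota> i x)) \<otimes> Em e L w' w'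
        = \<iota> j (e a a) \<otimes> (Em e L v' v' \<otimes> \<iota> j (e b b)) \<otimes> \<iota> i x \<otimes> Em e L w' w'"
      using cl cl' by (simp add: mult_assoc)
    also have "\<dots> = \<iota> j (e a a \<otimes>\<^bsub>B\<^esub> e b b) \<otimes> (Em e L v' v' \<otimes> \<iota> i x \<otimes> Em e L w' w')"
      unfolding s1[OF ebc] using cl cl' vw by (simp add: mult_assoc \<iota>_mult)
    also have "\<dots> = (if a = b then c else 0) \<odot> Em e (j # L) v w"
      unfolding c using vw by (auto simp: BM.e_mult smult_mult_right)
    finally have "Em e (j # L) v v \<otimes> \<iota> i x \<otimes> Em e (j # L) w w = (if a = b then c else 0) \<odot> Em e (j # L) v w"
      by (simp only: vw(1,2) Em.simps list.sel)
    thus ?thesis ..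
  qed
qed simp

lemma \<iota>_Dm:
  assumes "distinct L" "i \<in> set L" "x \<in> BM.mspan"
  shows "\<iota> i x \<in> Dm L"
  using Em_cut[OF assms] BM.mspan_closed[OF assms(3)]
  by (simp add: matrix_units.mspan_def[OF matrix_units_Em[OF assms(1)]])

lemma Dm_subset:
  assumes "distinct L" and S: "cstar_subalgebra S A" "\<one> \<in> S"
    and sub: "\<And>i a b. \<lbrakk>i \<in> set L; a < k; b < k\<rbrakk> \<Longrightarrow> \<iota> i (e a b) \<in> S"
  shows "Dm L \<subseteq> S"
proof (rule matrix_units.mspan_subset[OF matrix_units_Em[OF assms(1)] S(1)])
  fix v w assume "v \<in> words k L" "w \<in> words k L"
  thus "Em e L v w \<in> S" using sub
  proof (induction L arbitrary: v w)
    case (Cons i L)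
    obtain a v' b w' where vw: "v = a # v'" "w = b # w'" "a < k" "b < k" "v' \<in> words k L" "w' \<in> words k L"
      using Cons.prems by (auto simp: words_Cons)
    have "Em e L v' w' \<in> S" using Cons.IH[of v' w'] Cons.prems(3) vw by auto
    moreover have "\<iota> i (e a b) \<in> S" using Cons.prems(3) vw by simp
    ultimately show ?case using vw cstar_subalgebraD(5)[OF S(1)] by simp
  qed (use S in simp)
qed

text \<open>The letter projection selects the words with letter s at position i. Through this,
  marginals of word weights become values at single-letter projections.\<close>

lemma \<iota>_nth_mult:
  assumes "distinct L" "i < length L" "s < k" "v \<in> words k L"
  shows "\<iota> (L ! i) (e s s) \<otimes> Em e L v v = (if v ! i = s then Em e L v v else \<zero>)"
  using assms
proof (induction L arbitrary: i v)
  case (Cons j L)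
  obtain a v' where v: "v = a # v'" "a < k" "v' \<in> words k L"
    using Cons.prems by (auto simp: words_Cons)
  show ?case
  proof (cases i)
    case 0
    have "\<iota> j (e s s) \<otimes> (\<iota> j (e a a) \<otimes> Em e L v' v') = \<iota> j (e s s \<otimes>\<^bsub>B\<^esub> e a a) \<otimes> Em e L v' v'"
      using v Cons.prems by (simp add: mult_assoc \<iota>_mult)
    thus ?thesis using 0 v Cons.prems by (auto simp: BM.e_mult)
  next
    case (Suc i')
    have ne: "L ! i' \<noteq> j" using Cons.prems Suc by auto
    have "\<iota> (L ! i') (e s s) \<otimes> (\<iota> j (e a a) \<otimes> Em e L v' v')
        = (\<iota> (L ! i') (e s s) \<otimes> \<iota> j (e a a)) \<otimes> Em e L v' v'"
      using v Cons.prems by (simp add: mult_assoc)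
    also have "\<dots> = (\<iota> j (e a a) \<otimes> \<iota> (L ! i') (e s s)) \<otimes> Em e L v' v'"
      using v Cons.prems ne by (simp add: \<iota>_commute)
    also have "\<dots> = \<iota> j (e a a) \<otimes> (\<iota> (L ! i') (e s s) \<otimes> Em e L v' v')"
      using v Cons.prems by (simp add: mult_assoc)
    also have "\<iota> (L ! i') (e s s) \<otimes> Em e L v' v' = (if v' ! i' = s then Em e L v' v' else \<zero>)"
      using Cons.IH[of i' v'] Cons.prems Suc v by auto
    finally show ?thesis using Suc v by auto
  qed
qed simp

end

section \<open>The lower bound for the rank\<close>

lemma module_homD:
  assumes "f \<in> module_hom complex_field A B"
  shows "x \<in> carrier A \<Longrightarrow> f x \<in> carrier B"
    and "\<lbrakk>x \<in> carrier A; y \<in> carrier A\<rbrakk> \<Longrightarrow> f (x \<oplus>\<^bsub>A\<^esub> y) = f x \<oplus>\<^bsub>B\<^esub> f y"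
    and "x \<in> carrier A \<Longrightarrow> f (c \<odot>\<^bsub>A\<^esub> x) = c \<odot>\<^bsub>B\<^esub> f x"
  using assms by (auto simp: module_hom_def)

lemma cpcD:
  assumes "cpc A B f"
  shows "f \<in> module_hom complex_field A B"
    and "x \<in> carrier A \<Longrightarrow> nrm B (f x) \<le> nrm A x"
  using assms by (auto simp: cpc_def completely_positive_def contractive_def)

text \<open>The case of 1 x 1 matrices in the definition of complete positivity.\<close>

lemma cpc_square:
  assumes "cstar_algebra A" "cstar_algebra B" "cpc A B f" "y \<in> carrier A"
  obtains z where "z \<in> carrier B" "f (star A y \<otimes>\<^bsub>A\<^esub> y) = star B z \<otimes>\<^bsub>B\<^esub> z"
proof -
  interpret A: cstar_algebra A by fact
  interpret B: cstar_algebra B by fact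
  have "mat_pos A (Suc 0) (\<lambda>_ _. star A y \<otimes>\<^bsub>A\<^esub> y)"
    unfolding mat_pos_def using assms(4) by (intro exI[of _ "\<lambda>_ _. y"]) (simp add: lessThan_Suc)
  hence "mat_pos B (Suc 0) (\<lambda>_ _. f (star A y \<otimes>\<^bsub>A\<^esub> y))"
    using assms(3) unfolding cpc_def completely_positive_def by blast
  then obtain z where z: "\<And>i j. \<lbrakk>i < Suc 0; j < Suc 0\<rbrakk> \<Longrightarrow> z i j \<in> carrier B"
    and f: "\<And>i j. \<lbrakk>i < Suc 0; j < Suc 0\<rbrakk> \<Longrightarrow> f (star A y \<otimes>\<^bsub>A\<^esub> y)
      = (\<Oplus>\<^bsub>B\<^esub>l\<in>{..<Suc 0}. star B (z l i) \<otimes>\<^bsub>B\<^esub> z l j)"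
    by (rule mat_posE) blast
  have "z 0 0 \<in> carrier B" by (rule z) auto
  moreover have "f (star A y \<otimes>\<^bsub>A\<^esub> y) = star B (z 0 0) \<otimes>\<^bsub>B\<^esub> z 0 0"
    using f[of 0 0] \<open>z 0 0 \<in> carrier B\<close> by (simp add: lessThan_Suc)
  ultimately show ?thesis by (rule that)
qed

text \<open>For a positive \<open>y* y\<close> in \<open>F\<close> and the minimal projections \<open>p\<close> of a maximal abelian subalgebra,
  \<open>\<parallel>y* y\<parallel> = \<parallel>y y*\<parallel> \<le> \<Sum>\<^sub>p \<parallel>y p y*\<parallel> = \<Sum>\<^sub>p \<parallel>p y* y p\<parallel>\<close>; each functional \<open>x \<mapsto> p x p\<close> is contractive.\<close>

lemma (in matrix_units) sum_nrm_diag_le_rank: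
  assumes F: "cstar_algebra F" "finite_dimensional F" and \<psi>: "cpc A F \<psi>"
  shows "(\<Sum>v\<in>W. nrm F (\<psi> (e v v))) \<le> real (cstar_rank F)"
proof -
  interpret F: cstar_algebra F by fact
  note \<psi>h = module_homD[OF cpcD(1)[OF \<psi>]]
  obtain P where P: "finite P" "card P = cstar_rank F" "F.orth_projs P"
    and ex: "\<And>x p. \<lbrakk>x \<in> carrier F; p \<in> P\<rbrakk> \<Longrightarrow> \<exists>c. p \<otimes>\<^bsub>F\<^esub> x \<otimes>\<^bsub>F\<^esub> p = c \<odot>\<^bsub>F\<^esub> p"
    and unit: "\<And>x. x \<in> carrier F \<Longrightarrow> x = (\<Oplus>\<^bsub>F\<^esub>p\<in>P. x \<otimes>\<^bsub>F\<^esub> p)"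
    by (rule F.cstar_rank_projs[OF F(2)]) blast
  note Pd = F.orth_projsD[OF P(3)]
  have Pn: "nrm F p = 1" if "p \<in> P" for p using Pd[OF that] by (simp add: F.nrm_proj)
  define l where "l = (\<lambda>p v. SOME c. p \<otimes>\<^bsub>F\<^esub> \<psi> (e v v) \<otimes>\<^bsub>F\<^esub> p = c \<odot>\<^bsub>F\<^esub> p)"
  have l: "p \<otimes>\<^bsub>F\<^esub> \<psi> (e v v) \<otimes>\<^bsub>F\<^esub> p = l p v \<odot>\<^bsub>F\<^esub> p" if "p \<in> P" "v \<in> W" for p v
    unfolding l_def by (rule someI_ex, rule ex) (use that \<psi>h in auto)
  have up: "nrm F (\<psi> (e v v)) \<le> (\<Sum>p\<in>P. cmod (l p v))" if v: "v \<in> W" for v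
  proof -
    have ee: "star A (e v v) \<otimes> e v v = e v v" using v by (simp add: star_e e_mult)
    obtain y where y: "y \<in> carrier F" "\<psi> (e v v) = star F y \<otimes>\<^bsub>F\<^esub> y"
      using cpc_square[OF cstar_algebra_axioms F(1) \<psi> e_closed[OF v v]] unfolding ee by blast
    have "nrm F (\<psi> (e v v)) = nrm F (y \<otimes>\<^bsub>F\<^esub> star F y)"
      using y F.cstar_identity[of y] F.nrm_mult_star[of y] by simp
    also have "y \<otimes>\<^bsub>F\<^esub> star F y = (\<Oplus>\<^bsub>F\<^esub>p\<in>P. y \<otimes>\<^bsub>F\<^esub> p) \<otimes>\<^bsub>F\<^esub> star F y"
      using unit[OF y(1)] by simp
    also have "\<dots> = (\<Oplus>\<^bsub>F\<^esub>p\<in>P. y \<otimes>\<^bsub>F\<^esub> p \<otimes>\<^bsub>F\<^esub> star F y)"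
      using y P Pd by (intro F.finsum_mult) auto
    also have "nrm F \<dots> \<le> (\<Sum>p\<in>P. nrm F (y \<otimes>\<^bsub>F\<^esub> p \<otimes>\<^bsub>F\<^esub> star F y))"
      using y P Pd by (intro F.nrm_finsum) auto
    also have "\<dots> = (\<Sum>p\<in>P. cmod (l p v))"
    proof (rule sum.cong[OF refl])
      fix p assume p: "p \<in> P"
      note pc = Pd(1)[OF p]
      have s: "star F (y \<otimes>\<^bsub>F\<^esub> p) = p \<otimes>\<^bsub>F\<^esub> star F y" using y pc Pd(3)[OF p] by (simp add: F.star_mult)
      have pp: "p \<otimes>\<^bsub>F\<^esub> (p \<otimes>\<^bsub>F\<^esub> star F y) = p \<otimes>\<^bsub>F\<^esub> star F y"
        using y pc Pd(4)[OF p] F.mult_assoc[of p p "star F y"] by simp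
      have "y \<otimes>\<^bsub>F\<^esub> p \<otimes>\<^bsub>F\<^esub> star F y = (y \<otimes>\<^bsub>F\<^esub> p) \<otimes>\<^bsub>F\<^esub> star F (y \<otimes>\<^bsub>F\<^esub> p)"
        unfolding s using y pc by (simp add: F.mult_assoc pp)
      hence "nrm F (y \<otimes>\<^bsub>F\<^esub> p \<otimes>\<^bsub>F\<^esub> star F y) = nrm F (star F (y \<otimes>\<^bsub>F\<^esub> p) \<otimes>\<^bsub>F\<^esub> (y \<otimes>\<^bsub>F\<^esub> p))"
        using y pc F.nrm_mult_star[of "y \<otimes>\<^bsub>F\<^esub> p"] F.cstar_identity[of "y \<otimes>\<^bsub>F\<^esub> p"] by simp
      also have "star F (y \<otimes>\<^bsub>F\<^esub> p) \<otimes>\<^bsub>F\<^esub> (y \<otimes>\<^bsub>F\<^esub> p) = p \<otimes>\<^bsub>F\<^esub> \<psi> (e v v) \<otimes>\<^bsub>F\<^esub> p"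
        unfolding s y(2) using y pc by (simp add: F.mult_assoc)
      finally show "nrm F (y \<otimes>\<^bsub>F\<^esub> p \<otimes>\<^bsub>F\<^esub> star F y) = cmod (l p v)"
        using p v pc Pn by (simp add: l F.nrm_smult)
    qed
    finally show ?thesis .
  qed
  have col: "(\<Sum>v\<in>W. cmod (l p v)) \<le> 1" if p: "p \<in> P" for p
  proof -
    note pc = Pd(1)[OF p]
    \<comment> \<open>Phases that align all \<open>l p v\<close>; the diagonal element a built from
      them satisfies a* a = \<one> and so has norm 1. This converts contractivity of
      \<open>\<psi>\<close> into a bound for the sum of absolute values.\<close>
    define c where "c = (\<lambda>v. if l p v = 0 then 1 else of_real (cmod (l p v)) / l p v)"
    have c: "cmod (c v) = 1" "c v * l p v = of_real (cmod (l p v))" for v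
      by (auto simp: c_def norm_divide)
    define a where "a = (\<Oplus>v\<in>W. c v \<odot> e v v)"
    have ac: "a \<in> carrier A" unfolding a_def by (intro cs_finsum_closed) auto
    have eq: "star A a \<otimes> a = \<one>"
    proof -
      have "star A a \<otimes> a = (\<Oplus>v\<in>W. star A a \<otimes> (c v \<odot> e v v))"
        using ac by (subst (2) a_def, intro mult_finsum) auto
      also have "\<dots> = (\<Oplus>v\<in>W. e v v)"
      proof (rule cs_finsum_cong)
        fix v assume v: "v \<in> W"
        have "star A a = (\<Oplus>u\<in>W. cnj (c u) \<odot> e u u)"
        proof -
          have "star A a = (\<Oplus>u\<in>W. star A (c u \<odot> e u u))"
            unfolding a_def by (intro star_finsum) auto
          also have "\<dots> = (\<Oplus>u\<in>W. cnj (c u) \<odot> e u u)"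
            by (intro cs_finsum_cong) (auto simp: star_smult star_e)
          finally show ?thesis .
        qed
        hence "star A a \<otimes> (c v \<odot> e v v) = (\<Oplus>u\<in>W. (cnj (c u) \<odot> e u u) \<otimes> (c v \<odot> e v v))"
          using v by (simp only:) (intro finsum_mult, auto)
        also have "\<dots> = (cnj (c v) \<odot> e v v) \<otimes> (c v \<odot> e v v)"
          using v by (intro cs_finsum_single) (auto simp: smult_mult_left smult_mult_right e_mult)
        also have "\<dots> = (cnj (c v) * c v) \<odot> e v v"
          using v by (simp add: smult_mult_left smult_mult_right e_mult mult.commute)
        also have "cnj (c v) * c v = 1"
          using c(1)[of v] complex_norm_square[of "c v"] by (simp add: mult.commute)
        finally show "star A a \<otimes> (c v \<odot> e v v) = e v v" using v by simp
      qed auto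
      finally show ?thesis by (simp add: sum_e)
    qed
    have "(nrm A a)\<^sup>2 = 1"
      using cstar_identity[OF ac] nrm_one[OF one_neq_zero] by (simp add: eq)
    hence na: "nrm A a = 1" using nrm_nonneg[OF ac] by (simp add: power2_eq_1_iff)
    have "p \<otimes>\<^bsub>F\<^esub> \<psi> a \<otimes>\<^bsub>F\<^esub> p = (\<Sum>v\<in>W. c v * l p v) \<odot>\<^bsub>F\<^esub> p"
    proof -
      have "p \<otimes>\<^bsub>F\<^esub> \<psi> (\<Oplus>v\<in>I. c v \<odot> e v v) \<otimes>\<^bsub>F\<^esub> p = (\<Sum>v\<in>I. c v * l p v) \<odot>\<^bsub>F\<^esub> p" if "I \<subseteq> W" for I
      proof -
        have "finite I" using that finite_subset finite_W by blast
        thus ?thesis using that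
        proof (induction I rule: finite_induct)
          case empty
          have "\<psi> \<zero> = \<zero>\<^bsub>F\<^esub>" using \<psi>h(3)[of \<zero> 0] \<psi>h(1)[of \<zero>] by simp
          thus ?case using pc by simp
        next
          case (insert u I)
          have sc: "(\<Oplus>v\<in>I. c v \<odot> e v v) \<in> carrier A" using insert by (intro cs_finsum_closed) auto
          have "(\<Oplus>v\<in>insert u I. c v \<odot> e v v) = c u \<odot> e u u \<oplus> (\<Oplus>v\<in>I. c v \<odot> e v v)"
            using insert by (intro cs_finsum_insert) auto
          thus ?case
            using insert pc sc \<psi>h(1)[OF sc] \<psi>h(1)[of "e u u"]
            by (simp add: \<psi>h(2,3) F.mult_add_left F.mult_add_right F.smult_mult_left
                F.smult_mult_right l[OF p] F.cs_add_smult)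
        qed
      qed
      thus ?thesis unfolding a_def by blast
    qed
    hence "nrm F (p \<otimes>\<^bsub>F\<^esub> \<psi> a \<otimes>\<^bsub>F\<^esub> p) = cmod (\<Sum>v\<in>W. c v * l p v)"
      using pc Pn[OF p] by (simp add: F.nrm_smult)
    also have "\<dots> = (\<Sum>v\<in>W. cmod (l p v))"
      unfolding c(2) of_real_sum[symmetric] norm_of_real by (simp add: sum_nonneg)
    finally have "(\<Sum>v\<in>W. cmod (l p v)) = nrm F (p \<otimes>\<^bsub>F\<^esub> \<psi> a \<otimes>\<^bsub>F\<^esub> p)" by simp
    also have "\<dots> \<le> nrm F (p \<otimes>\<^bsub>F\<^esub> \<psi> a) * nrm F p"
      using pc \<psi>h ac by (intro F.nrm_mult) auto
    also have "\<dots> \<le> (nrm F p * nrm F (\<psi> a)) * nrm F p"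
      using pc \<psi>h ac F.nrm_nonneg by (intro mult_right_mono F.nrm_mult) auto
    also have "\<dots> \<le> 1" using Pn[OF p] cpcD(2)[OF \<psi> ac] na by simp
    finally show ?thesis .
  qed
  have "(\<Sum>v\<in>W. nrm F (\<psi> (e v v))) \<le> (\<Sum>v\<in>W. \<Sum>p\<in>P. cmod (l p v))"
    by (intro sum_mono up)
  also have "\<dots> = (\<Sum>p\<in>P. \<Sum>v\<in>W. cmod (l p v))" by (rule sum.swap)
  also have "\<dots> \<le> (\<Sum>p\<in>P. 1)" by (intro sum_mono col)
  finally show ?thesis using P by simp
qed

section \<open>Hamming distance and the counting argument\<close>

fun hamming :: "nat list \<Rightarrow> nat list \<Rightarrow> nat" where
  "hamming (a # v) (b # w) = (if a = b then 0 else 1) + hamming v w"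
| "hamming _ _ = 0"

lemma hamming_eq_sum:
  "length v = length w \<Longrightarrow> hamming v w = (\<Sum>i<length v. if v ! i = w ! i then 0 else 1)"
  by (induction v w rule: list_induct2) (auto simp: sum.lessThan_Suc_shift simp del: sum.lessThan_Suc)

text \<open>The generating function factorises over positions: one letter agrees and k - 1
  differ.\<close>

lemma sum_hamming:
  fixes x :: real
  assumes "v \<in> words k L"
  shows "(\<Sum>w\<in>words k L. x ^ hamming v w) = (1 + (real k - 1) * x) ^ length L"
  using assms
proof (induction L arbitrary: v)
  case (Cons i L)
  obtain a v' where v: "v = a # v'" "a < k" "v' \<in> words k L"
    using Cons.prems by (auto simp: words_Cons)
  have inj: "inj_on (\<lambda>p. fst p # snd p) ({..<k} \<times> words k L)" by (auto simp: inj_on_def)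
  have "(\<Sum>w\<in>words k (i # L). x ^ hamming v w)
      = (\<Sum>p\<in>{..<k} \<times> words k L. (if a = fst p then 1 else x) * x ^ hamming v' (snd p))"
    unfolding words_Cons by (subst sum.reindex[OF inj]) (auto simp: v intro!: sum.cong)
  also have "\<dots> = (\<Sum>b<k. (if a = b then 1 else x)) * (\<Sum>w\<in>words k L. x ^ hamming v' w)"
    by (simp add: sum_product sum.cartesian_product split_def)
  also have "(\<Sum>b<k. (if a = b then 1 else x)) = 1 + (real k - 1) * x"
  proof -
    have "(\<Sum>b<k. (if a = b then 1 else x)) = 1 + (\<Sum>b\<in>{..<k} - {a}. x)"
      using v by (subst sum.remove[of "{..<k}" a]) (auto intro!: sum.cong)
    thus ?thesis using v by (simp add: of_nat_diff)
  qed
  finally show ?case using Cons.IH[OF v(3)] by simp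
qed simp

text \<open>Decoding by the approximately fixed letters: for a word \<open>w\<close>, the weights
  \<open>q v\<close> obtained from the state at \<open>w\<close> have small mean Hamming distance to \<open>w\<close>, whence by convexity
  \<open>\<Sum>\<^sub>v q v x\<^bsup>d(v,w)\<^esup>\<close> is not much less than \<open>1\<close>. The sum over \<open>w\<close> is controlled by the rank.\<close>

lemma (in tensor_units) rank_lower_bound:
  fixes x \<epsilon> :: real
  assumes t: "tracial_state A t" and n: "n > 0" and x: "0 < x" "x \<le> 1" and \<epsilon>: "0 < \<epsilon>" "\<epsilon> \<le> 1/2"
    and F: "cstar_algebra F" "finite_dimensional F" and \<psi>: "cpc A F \<psi>" and \<phi>: "cpc F A \<phi>"
    and approx: "\<And>i s. \<lbrakk>i < n; s < k\<rbrakk>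
      \<Longrightarrow> nrm A (\<phi> (\<psi> (\<iota> (int i) (e s s))) \<ominus> \<iota> (int i) (e s s)) \<le> \<epsilon>"
  shows "real k ^ n * x powr (2 * real k * \<epsilon> * real n) / 2 \<le> real (cstar_rank F) * (1 + (real k - 1) * x) ^ n"
proof -
  define L where "L = map int [0..<n]"
  have L: "distinct L" "length L = n" "\<And>i. i < n \<Longrightarrow> L ! i = int i"
    by (auto simp: L_def distinct_map)
  let ?W = "words k L" and ?E = "Em e L"
  interpret F: cstar_algebra F by fact
  interpret E: matrix_units A ?W ?E by (rule matrix_units_Em[OF L(1)])
  interpret E: matrix_units_trace A ?W ?E t by unfold_locales (rule t)
  note \<psi>h = module_homD[OF cpcD(1)[OF \<psi>]]
  note \<phi>h = module_homD[OF cpcD(1)[OF \<phi>]]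
  have k: "k > 0" using BM.card_W_pos by simp
  \<comment> \<open>The real part of the state at the word w, carried from the matrix subalgebra to
    \<open>A\<close> by the expectation.\<close>
  define g where "g = (\<lambda>w a. Re (E.coord (E.cexp a) w w))"
  have g_add: "g w (a \<oplus> b) = g w a + g w b" if "w \<in> ?W" "a \<in> carrier A" "b \<in> carrier A" for w a b
    using that by (simp add: g_def E.cexp_add E.coord_add)
  have g_minus: "g w (a \<ominus> b) = g w a - g w b" if "w \<in> ?W" "a \<in> carrier A" "b \<in> carrier A" for w a b
    using that by (simp add: g_def cs_minus E.cexp_add E.cexp_smult E.coord_add E.coord_smult E.mspan_smult)
  have g_le: "\<bar>g w a\<bar> \<le> nrm A a" if "w \<in> ?W" "a \<in> carrier A" for w a
    using abs_Re_le_cmod[of "E.coord (E.cexp a) w w"] E.coord_le_nrm[of "E.cexp a" w w]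
      E.nrm_cexp_le[of a] that unfolding g_def by force
  have g_pos: "0 \<le> g w (star A y \<otimes> y)" if w: "w \<in> ?W" and y: "y \<in> carrier A" for w y
  proof -
    have "E.coord (E.cexp (star A y \<otimes> y)) w w = of_nat (card ?W) * t (star A (y \<otimes> ?E w w) \<otimes> (y \<otimes> ?E w w))"
    proof -
      have "t (?E w w \<otimes> (star A y \<otimes> y)) = t ((?E w w \<otimes> star A y \<otimes> y) \<otimes> ?E w w)"
      proof -
        have "?E w w \<otimes> (star A y \<otimes> y) = ?E w w \<otimes> (?E w w \<otimes> star A y \<otimes> y)"
          using w y E.e_mult[of w w w w] by (simp add: mult_assoc[symmetric])
        thus ?thesis using w y E.t_commute[of "?E w w" "?E w w \<otimes> star A y \<otimes> y"] by simp
      qed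
      also have "(?E w w \<otimes> star A y \<otimes> y) \<otimes> ?E w w = star A (y \<otimes> ?E w w) \<otimes> (y \<otimes> ?E w w)"
        using w y by (simp add: star_mult E.star_e mult_assoc)
      finally show ?thesis using w by (simp add: E.coord_cexp)
    qed
    thus ?thesis
      using E.t_pos[of "y \<otimes> ?E w w"] w y by (simp add: g_def)
  qed
  \<comment> \<open>The weights of the decoding. They are nonnegative because both maps preserve
    squares, and are bounded by the norms of the \<open>\<psi>\<close>-images, independently of
    w.\<close>
  define Q where "Q = (\<lambda>w v. g w (\<phi> (\<psi> (?E v v))))"
  have Ec: "\<phi> (\<psi> a) \<in> carrier A" if "a \<in> carrier A" for a using \<phi>h \<psi>h that by simp
  have Q_pos: "0 \<le> Q w v" if w: "w \<in> ?W" and v: "v \<in> ?W" for w v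
  proof -
    have ee: "star A (?E v v) \<otimes> ?E v v = ?E v v" using v by (simp add: E.star_e E.e_mult)
    obtain z where z: "z \<in> carrier F" "\<psi> (?E v v) = star F z \<otimes>\<^bsub>F\<^esub> z"
      using cpc_square[OF cstar_algebra_axioms F(1) \<psi> E.e_closed[OF v v]] unfolding ee by blast
    obtain y where y: "y \<in> carrier A" "\<phi> (\<psi> (?E v v)) = star A y \<otimes> y"
      using cpc_square[OF F(1) cstar_algebra_axioms \<phi> z(1)] unfolding z(2) by blast
    thus ?thesis unfolding Q_def using g_pos[OF w y(1)] by simp
  qed
  have Q_le: "Q w v \<le> nrm F (\<psi> (?E v v))" if "w \<in> ?W" "v \<in> ?W" for w v
    using g_le[of w "\<phi> (\<psi> (?E v v))"] cpcD(2)[OF \<phi>, of "\<psi> (?E v v)"] \<psi>h that Ec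
    unfolding Q_def by force
  \<comment> \<open>A letter projection is the sum of the word projections carrying that letter, so
    the marginals of \<open>Q\<close> are values at elements that the approximation almost
    fixes.\<close>
  have marg: "(\<Sum>v\<in>?W. if v ! i = s then Q w v else 0) = g w (\<phi> (\<psi> (\<iota> (int i) (e s s))))"
    if w: "w \<in> ?W" and js: "i < n" "s < k" for w i s
  proof -
    have c: "\<iota> (int i) (e s s) \<in> carrier A" using js by simp
    have "\<iota> (int i) (e s s) = \<iota> (int i) (e s s) \<otimes> (\<Oplus>v\<in>?W. ?E v v)"
      using c by (simp add: E.sum_e)
    also have "\<dots> = (\<Oplus>v\<in>?W. \<iota> (int i) (e s s) \<otimes> ?E v v)"
      using c by (intro mult_finsum) auto
    also have "\<dots> = (\<Oplus>v\<in>?W. if v ! i = s then ?E v v else \<zero>)"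
      using \<iota>_nth_mult[OF L(1), of i s] L js by (intro cs_finsum_cong) auto
    finally have eq: "\<iota> (int i) (e s s) = (\<Oplus>v\<in>?W. if v ! i = s then ?E v v else \<zero>)" .
    have z: "\<phi> (\<psi> \<zero>) = \<zero>"
      using \<psi>h(3)[of \<zero> 0] \<psi>h(1)[of \<zero>] \<phi>h(3)[of "\<zero>\<^bsub>F\<^esub>" 0] \<phi>h(1)[of "\<zero>\<^bsub>F\<^esub>"] by simp
    have "g w \<zero> = 0" using g_minus[of w \<zero> \<zero>] w by simp
    hence "g w (\<phi> (\<psi> (\<Oplus>v\<in>?W. if v ! i = s then ?E v v else \<zero>)))
        = (\<Sum>v\<in>?W. g w (\<phi> (\<psi> (if v ! i = s then ?E v v else \<zero>))))"
      using w Ec by (intro additive_finsum[where g = "\<lambda>a. g w (\<phi> (\<psi> a))"])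
        (auto simp: z g_add \<psi>h \<phi>h)
    also have "\<dots> = (\<Sum>v\<in>?W. if v ! i = s then Q w v else 0)"
      using \<open>g w \<zero> = 0\<close> z by (intro sum.cong refl) (auto simp: Q_def)
    finally show ?thesis using eq by simp
  qed
  have g_e: "g w (\<iota> (int i) (e s s)) = (if w ! i = s then 1 else 0)"
    if w: "w \<in> ?W" and js: "i < n" "s < k" for w i s
  proof -
    have D: "\<iota> (int i) (e s s) \<in> E.mspan"
      using L js BM.e_mspan[of s s] by (intro \<iota>_Dm) (auto simp: L_def)
    have c: "\<iota> (int i) (e s s) \<in> carrier A" using js by simp
    have "?E w w \<otimes> \<iota> (int i) (e s s) \<otimes> ?E w w = ?E w w \<otimes> (\<iota> (L ! i) (e s s) \<otimes> ?E w w)"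
      using w c L js by (simp add: mult_assoc)
    also have "\<dots> = (if w ! i = s then 1 else 0) \<odot> ?E w w"
      using \<iota>_nth_mult[OF L(1), of i s w] L js w by (simp add: E.e_mult)
    finally have "E.coord (\<iota> (int i) (e s s)) w w = (if w ! i = s then 1 else 0)"
      using w by (intro E.coord_eqI)
    thus ?thesis by (simp add: g_def E.cexp_id[OF D])
  qed
  have close: "\<bar>g w (\<phi> (\<psi> (\<iota> (int i) (e s s)))) - (if w ! i = s then 1 else 0)\<bar> \<le> \<epsilon>"
    if w: "w \<in> ?W" and js: "i < n" "s < k" for w i s
  proof -
    have c: "\<iota> (int i) (e s s) \<in> carrier A" using js by simp
    have "\<bar>g w (\<phi> (\<psi> (\<iota> (int i) (e s s))) \<ominus> \<iota> (int i) (e s s))\<bar> \<le> \<epsilon>"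
      using g_le[of w "\<phi> (\<psi> (\<iota> (int i) (e s s))) \<ominus> \<iota> (int i) (e s s)"] approx[OF js] w c Ec by force
    thus ?thesis using w c Ec g_e[OF w js] by (simp add: g_minus)
  qed
  have letters: "w ! i < k" if "w \<in> ?W" "i < n" for w i
  proof -
    have w: "length w = n" "set w \<subseteq> {..<k}" using that L by (auto simp: words_def)
    have "w ! i \<in> set w" by (rule nth_mem) (use w that in simp)
    thus ?thesis using w(2) by blast
  qed
  \<comment> \<open>Twice the bound \<open>k * \<epsilon> * n\<close> for the mean distance; the
    factor 2 compensates for a total mass known only to be at least 1/2.\<close>
  define m where "m = 2 * real k * \<epsilon> * real n"
  have lower: "x powr m / 2 \<le> (\<Sum>v\<in>?W. Q w v * x ^ hamming v w)" if w: "w \<in> ?W" for w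
  proof -
    define M where "M = (\<Sum>v\<in>?W. Q w v)"
    \<comment> \<open>The marginal at one position suffices: the correct letter there has weight at
      least 1 - \<epsilon>.\<close>
    have M: "M \<ge> 1/2"
    proof -
      have "1 - \<epsilon> \<le> g w (\<phi> (\<psi> (\<iota> (int 0) (e (w ! 0) (w ! 0)))))"
        using close[OF w n letters[OF w n]] by simp
      also have "\<dots> = (\<Sum>v\<in>?W. if v ! 0 = w ! 0 then Q w v else 0)"
        using marg[OF w n letters[OF w n]] by simp
      also have "\<dots> \<le> M" unfolding M_def using Q_pos[OF w] by (intro sum_mono) auto
      finally show ?thesis using \<epsilon> by simp
    qed
    have mean: "(\<Sum>v\<in>?W. Q w v * real (hamming v w)) \<le> real n * (real k * \<epsilon>)"
    proof -
      have "(\<Sum>v\<in>?W. Q w v * real (hamming v w)) = (\<Sum>v\<in>?W. \<Sum>i<n. if v ! i = w ! i then 0 else Q w v)"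
      proof (rule sum.cong[OF refl])
        fix v assume v: "v \<in> ?W"
        have "real (hamming v w) = (\<Sum>i<n. if v ! i = w ! i then 0 else 1)"
          using v w L by (subst hamming_eq_sum) (auto simp: words_def intro!: sum.cong)
        thus "Q w v * real (hamming v w) = (\<Sum>i<n. if v ! i = w ! i then 0 else Q w v)"
          by (simp only: sum_distrib_left) (intro sum.cong refl, simp)
      qed
      also have "\<dots> = (\<Sum>i<n. \<Sum>v\<in>?W. if v ! i = w ! i then 0 else Q w v)" by (rule sum.swap)
      also have "\<dots> \<le> (\<Sum>i<n. real k * \<epsilon>)"
      proof (rule sum_mono)
        fix i assume "i \<in> {..<n}"
        hence i: "i < n" by simp
        have "(\<Sum>v\<in>?W. if v ! i = w ! i then 0 else Q w v)
            = (\<Sum>v\<in>?W. \<Sum>s\<in>{..<k} - {w ! i}. if v ! i = s then Q w v else 0)"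
          using letters[OF _ i] by (intro sum.cong refl) (auto simp: sum.delta')
        also have "\<dots> = (\<Sum>s\<in>{..<k} - {w ! i}. \<Sum>v\<in>?W. if v ! i = s then Q w v else 0)" by (rule sum.swap)
        also have "\<dots> = (\<Sum>s\<in>{..<k} - {w ! i}. g w (\<phi> (\<psi> (\<iota> (int i) (e s s)))))"
          using marg[OF w i] by (intro sum.cong refl) auto
        also have "\<dots> \<le> (\<Sum>s\<in>{..<k} - {w ! i}. \<epsilon>)"
        proof (rule sum_mono)
          fix s assume "s \<in> {..<k} - {w ! i}"
          thus "g w (\<phi> (\<psi> (\<iota> (int i) (e s s)))) \<le> \<epsilon>"
            using close[OF w i, of s] by auto
        qed
        also have "\<dots> \<le> real k * \<epsilon>"
          using \<epsilon> card_mono[of "{..<k}" "{..<k} - {w ! i}"] by (simp add: mult_right_mono)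
        finally show "(\<Sum>v\<in>?W. if v ! i = w ! i then 0 else Q w v) \<le> real k * \<epsilon>" .
      qed
      finally show ?thesis by simp
    qed
    \<comment> \<open>The convex function h -> x^h lies above its tangent at m.\<close>
    have tangent: "x powr m * (1 + (real (hamming v w) - m) * ln x) \<le> x ^ hamming v w" for v
    proof -
      have "1 + (real (hamming v w) - m) * ln x \<le> x powr (real (hamming v w) - m)"
        using x exp_ge_add_one_self[of "(real (hamming v w) - m) * ln x"] by (simp add: powr_def)
      hence "x powr m * (1 + (real (hamming v w) - m) * ln x) \<le> x powr m * x powr (real (hamming v w) - m)"
        by (intro mult_left_mono) auto
      also have "\<dots> = x ^ hamming v w" using x by (simp add: powr_add[symmetric] powr_realpow)
      finally show ?thesis .
    qed
    \<comment> \<open>Since M is at least 1/2, \<open>m * M\<close> dominates the mean;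
      multiplication by the nonpositive ln x then makes the linear correction nonnegative.\<close>
    have "(\<Sum>v\<in>?W. Q w v * real (hamming v w)) - m * M \<le> 0"
    proof -
      have "m * (1/2) \<le> m * M" using M \<epsilon> by (intro mult_left_mono) (auto simp: m_def)
      thus ?thesis using mean by (simp add: m_def mult_ac)
    qed
    hence "0 \<le> ((\<Sum>v\<in>?W. Q w v * real (hamming v w)) - m * M) * ln x"
      using x by (intro mult_nonpos_nonpos) auto
    hence "x powr m * (1/2) \<le> x powr m * (M + ((\<Sum>v\<in>?W. Q w v * real (hamming v w)) - m * M) * ln x)"
      using M by (intro mult_left_mono) auto
    also have "\<dots> = (\<Sum>v\<in>?W. Q w v * (x powr m * (1 + (real (hamming v w) - m) * ln x)))"
      by (simp add: M_def algebra_simps sum_distrib_left sum_distrib_right sum.distrib sum_subtractf)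
    also have "\<dots> \<le> (\<Sum>v\<in>?W. Q w v * x ^ hamming v w)"
      using Q_pos[OF w] by (intro sum_mono mult_left_mono tangent) auto
    finally show ?thesis by simp
  qed
  have "real k ^ n * x powr m / 2 = (\<Sum>w\<in>?W. x powr m / 2)"
    using L by (simp add: card_words)
  also have "\<dots> \<le> (\<Sum>w\<in>?W. \<Sum>v\<in>?W. Q w v * x ^ hamming v w)"
    by (intro sum_mono lower)
  also have "\<dots> \<le> (\<Sum>w\<in>?W. \<Sum>v\<in>?W. nrm F (\<psi> (?E v v)) * x ^ hamming v w)"
    using Q_le x by (intro sum_mono mult_right_mono) auto
  also have "\<dots> = (\<Sum>v\<in>?W. nrm F (\<psi> (?E v v)) * (\<Sum>w\<in>?W. x ^ hamming v w))"
    by (subst sum.swap) (simp add: sum_distrib_left)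
  also have "\<dots> = (\<Sum>v\<in>?W. nrm F (\<psi> (?E v v))) * (1 + (real k - 1) * x) ^ n"
    using L by (simp add: sum_hamming sum_distrib_right)
  also have "\<dots> \<le> real (cstar_rank F) * (1 + (real k - 1) * x) ^ n"
    using x k by (intro mult_right_mono E.sum_nrm_diag_le_rank F \<psi>) auto
  finally show ?thesis by (simp add: m_def)
qed

section \<open>The tensor shift\<close>

text \<open>Contractivity makes the preimage closed under limits. Inclusions under h can then be
  checked on generators.\<close>

lemma (in cstar_algebra) hom_preimage_subalgebra:
  assumes h: "star_hom A A h" and le: "\<And>a. a \<in> carrier A \<Longrightarrow> nrm A (h a) \<le> nrm A a"
    and T: "cstar_subalgebra T A"
  shows "cstar_subalgebra {x \<in> carrier A. h x \<in> T} A"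
proof -
  note hm = module_homD[OF conjunct1[OF h[unfolded star_hom_def]]]
  have hx: "h (x \<otimes> y) = h x \<otimes> h y" "h (star A x) = star A (h x)"
    if "x \<in> carrier A" "y \<in> carrier A" for x y
    using h that by (auto simp: star_hom_def)
  note Tc = cstar_subalgebraD(1-7)[OF T]
  have h0: "h \<zero> = \<zero>" using hm(3)[of \<zero> 0] hm(1)[of \<zero>] by simp
  show ?thesis
  proof (rule cstar_subalgebraI)
    fix f x assume f: "\<And>n. f n \<in> {x \<in> carrier A. h x \<in> T}" and x: "x \<in> carrier A" "tends f x"
    have "tends (\<lambda>n. h (f n)) (h x)"
    proof (rule Lim_null_comparison[OF _ x(2)])
      have "nrm A (h (f n) \<ominus> h x) \<le> nrm A (f n \<ominus> x)" for n
        using le[of "f n \<ominus> x"] f[of n] x hm(1)[of "f n"] hm(1)[of x] by (simp add: cs_minus hm(2,3))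
      thus "\<forall>\<^sub>F n in sequentially. norm (nrm A (h (f n) \<ominus> h x)) \<le> nrm A (f n \<ominus> x)"
        using f x hm(1) by (intro always_eventually) (simp add: nrm_nonneg)
    qed
    hence "h x \<in> T"
      by (rule_tac cstar_subalgebraD(8)[OF T, of "\<lambda>n. h (f n)"]) (use f x hm(1) in auto)
    thus "x \<in> {x \<in> carrier A. h x \<in> T}" using x by simp
  qed (auto simp: h0 Tc hm hx)
qed

text \<open>The sequence may be constant: the two cases of the theorem are two instances of this
  locale.\<close>

locale uhf_tensor_shift = tensor_power +
  fixes \<alpha> :: "'a \<Rightarrow> 'a" and k :: "nat \<Rightarrow> nat" and e :: "nat \<Rightarrow> nat \<Rightarrow> nat \<Rightarrow> 'b" and S :: "nat \<Rightarrow> 'b set"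
  assumes shift: "tensor_shift B A \<iota> \<alpha>"
    and units: "matrix_units B {..<k n} (e n)"
    and S_eq: "S n = matrix_units.mspan B {..<k n} (e n)"
    and S_Suc: "S n \<subseteq> S (Suc n)"
    and dense: "\<lbrakk>b \<in> carrier B; 0 < r\<rbrakk> \<Longrightarrow> \<exists>n. \<exists>y\<in>S n. nrm B (y \<ominus>\<^bsub>B\<^esub> b) < r"
begin

lemma tu: "tensor_units A B \<iota> (k n) (e n)"
  by (intro tensor_units.intro units tensor_power_axioms)

lemma S_mono: "m \<le> n \<Longrightarrow> S m \<subseteq> S n"
  using lift_Suc_mono_le[of S m n] S_Suc by blast

definition LL :: "nat \<Rightarrow> int list" where "LL n = [- int n..int n]"

lemma LL: "distinct (LL n)" "set (LL n) = {- int n..int n}"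
  by (simp_all add: LL_def)

abbreviation DL :: "nat \<Rightarrow> int list \<Rightarrow> 'a set" where
  "DL n L \<equiv> matrix_units.mspan A (words (k n) L) (Em (e n) L)"

text \<open>One index serves as the level in \<open>B\<close> and as the radius of the window of
  positions, so that a single increasing sequence exhausts \<open>A\<close>.\<close>

definition DD :: "nat \<Rightarrow> 'a set" where "DD n = DL n (LL n)"

lemma DL_subalgebra: "distinct L \<Longrightarrow> cstar_subalgebra (DL n L) A"
  by (rule matrix_units.mspan_subalgebra[OF tensor_units.matrix_units_Em[OF tu]])

lemma DL_one: "distinct L \<Longrightarrow> \<one> \<in> DL n L"
  by (rule matrix_units.mspan_one[OF tensor_units.matrix_units_Em[OF tu]])

lemma e_S: "\<lbrakk>a < k n; b < k n\<rbrakk> \<Longrightarrow> e n a b \<in> S n"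
  unfolding S_eq by (rule matrix_units.e_mspan[OF units]) auto

lemma S_closed: "x \<in> S n \<Longrightarrow> x \<in> carrier B"
  unfolding S_eq by (rule matrix_units.mspan_closed[OF units])

lemma \<iota>_DL: "\<lbrakk>distinct L; i \<in> set L; x \<in> S n\<rbrakk> \<Longrightarrow> \<iota> i x \<in> DL n L"
  unfolding S_eq by (rule tensor_units.\<iota>_Dm[OF tu])

lemma DL_mono:
  assumes "distinct L" "distinct L'" "set L \<subseteq> set L'" "m \<le> n"
  shows "DL m L \<subseteq> DL n L'"
proof (rule tensor_units.Dm_subset[OF tu assms(1) DL_subalgebra[OF assms(2)] DL_one[OF assms(2)]])
  fix i a b assume "i \<in> set L" "a < k m" "b < k m"
  thus "\<iota> i (e m a b) \<in> DL n L'"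
    using assms S_mono[OF assms(4)] e_S[of a m b] by (intro \<iota>_DL) auto
qed

lemma DD_mono: "m \<le> n \<Longrightarrow> DD m \<subseteq> DD n"
  unfolding DD_def by (intro DL_mono) (auto simp: LL)

lemma DD_subalgebra: "cstar_subalgebra (DD n) A"
  unfolding DD_def by (intro DL_subalgebra LL)

definition UU :: "'a set" where "UU = (\<Union>n. DD n)"

text \<open>The norm closure of \<open>UU\<close>, described by sequences. It is closed under sums
  and products, which brings tensors with arbitrary entries from \<open>B\<close> into it.\<close>

definition Ubar :: "'a set" where
  "Ubar = {x \<in> carrier A. \<exists>f. (\<forall>n. f n \<in> UU) \<and> tends f x}"

lemma UU_closed: "x \<in> UU \<Longrightarrow> x \<in> carrier A"
  using cstar_subalgebraD(1)[OF DD_subalgebra] by (auto simp: UU_def)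

lemma UU_ops:
  assumes "x \<in> UU" "y \<in> UU"
  shows "x \<oplus> y \<in> UU" "x \<otimes> y \<in> UU"
proof -
  obtain i j where "x \<in> DD i" "y \<in> DD j" using assms by (auto simp: UU_def)
  hence "x \<in> DD (max i j)" "y \<in> DD (max i j)"
    using DD_mono[of i "max i j"] DD_mono[of j "max i j"] by auto
  hence "x \<oplus> y \<in> DD (max i j)" "x \<otimes> y \<in> DD (max i j)"
    by (auto intro: cstar_subalgebraD(3,5)[OF DD_subalgebra])
  thus "x \<oplus> y \<in> UU" "x \<otimes> y \<in> UU" by (auto simp: UU_def)
qed

lemma UU_Ubar: "x \<in> UU \<Longrightarrow> x \<in> Ubar"
  using UU_closed unfolding Ubar_def by (auto intro!: exI[of _ "\<lambda>_. x"])

lemma Ubar_ops: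
  assumes "x \<in> Ubar" "y \<in> Ubar"
  shows "x \<oplus> y \<in> Ubar" "x \<otimes> y \<in> Ubar"
proof -
  obtain f g where f: "x \<in> carrier A" "\<And>n. f n \<in> UU" "tends f x"
    and g: "y \<in> carrier A" "\<And>n. g n \<in> UU" "tends g y"
    using assms unfolding Ubar_def by blast
  have fc: "f n \<in> carrier A" and gc: "g n \<in> carrier A" for n using f(2) g(2) UU_closed by auto
  have "tends (\<lambda>n. f n \<oplus> g n) (x \<oplus> y)" by (rule tends_add[OF fc f(1,3) gc g(1,3)])
  thus "x \<oplus> y \<in> Ubar"
    unfolding Ubar_def using f(1,2) g(1,2) UU_ops(1) by (auto intro!: exI[of _ "\<lambda>n. f n \<oplus> g n"])
  have "tends (\<lambda>n. f n \<otimes> g n) (x \<otimes> y)" by (rule tends_mult[OF fc f(1,3) gc g(1,3)])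
  thus "x \<otimes> y \<in> Ubar"
    unfolding Ubar_def using f(1,2) g(1,2) UU_ops(2) by (auto intro!: exI[of _ "\<lambda>n. f n \<otimes> g n"])
qed

lemma \<iota>_UU: "x \<in> S n \<Longrightarrow> \<iota> i x \<in> UU"
proof -
  assume x: "x \<in> S n"
  define m where "m = max n (nat \<bar>i\<bar>)"
  have "\<iota> i x \<in> DD m"
    unfolding DD_def using x S_mono[of n m] by (intro \<iota>_DL) (auto simp: LL m_def)
  thus ?thesis by (auto simp: UU_def)
qed

text \<open>Contractivity of the embedding carries an approximation in \<open>B\<close> over to
  \<open>A\<close>.\<close>

lemma \<iota>_Ubar:
  assumes b: "b \<in> carrier B"
  shows "\<iota> i b \<in> Ubar"
proof -
  have "\<exists>y. (\<exists>m. y \<in> S m) \<and> nrm B (y \<ominus>\<^bsub>B\<^esub> b) < inverse (real (Suc n))" for n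
    using dense[OF b, of "inverse (real (Suc n))"] by auto
  then obtain f where f: "\<And>n. \<exists>m. f n \<in> S m" "\<And>n. nrm B (f n \<ominus>\<^bsub>B\<^esub> b) < inverse (real (Suc n))"
    by metis
  have fc: "f n \<in> carrier B" for n using f(1) S_closed by blast
  have "tends (\<lambda>n. \<iota> i (f n)) (\<iota> i b)"
  proof (rule Lim_null_comparison[OF _ LIMSEQ_inverse_real_of_nat])
    have "nrm A (\<iota> i (f n) \<ominus> \<iota> i b) \<le> inverse (real (Suc n))" for n
    proof -
      have "\<iota> i (f n) \<ominus> \<iota> i b = \<iota> i (f n \<ominus>\<^bsub>B\<^esub> b)"
        using fc b by (simp add: cs_minus B.cs_minus \<iota>_add \<iota>_smult)
      thus ?thesis using \<iota>_contractive[of "f n \<ominus>\<^bsub>B\<^esub> b" i] f(2)[of n] fc b by simp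
    qed
    thus "\<forall>\<^sub>F n in sequentially. norm (nrm A (\<iota> i (f n) \<ominus> \<iota> i b)) \<le> inverse (real (Suc n))"
      using fc b by (intro always_eventually) (simp add: nrm_nonneg)
  qed
  moreover have "\<iota> i (f n) \<in> UU" for n using f(1)[of n] \<iota>_UU by blast
  ultimately show ?thesis
    unfolding Ubar_def using b by (auto intro!: exI[of _ "\<lambda>n. \<iota> i (f n)"])
qed

lemma tensor_eval_Ubar:
  assumes "finite I" "x \<in> tensors B I"
  shows "tensor_eval A \<iota> I x \<in> Ubar"
proof -
  have one: "\<one> \<in> Ubar" using DL_one[OF LL(1)] by (intro UU_Ubar) (auto simp: UU_def DD_def)
  have zero: "\<zero> \<in> Ubar" using cstar_subalgebraD(2)[OF DD_subalgebra] by (intro UU_Ubar) (auto simp: UU_def)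
  have *: "foldr (\<lambda>i p. \<iota> i (u i) \<otimes> p) l \<one> \<in> Ubar" if "\<And>i. i \<in> set l \<Longrightarrow> u i \<in> carrier B" for u l
    using that by (induction l) (auto simp: one intro!: Ubar_ops \<iota>_Ubar)
  have "foldr (\<lambda>u s. foldr (\<lambda>i p. \<iota> i (u i) \<otimes> p) (sorted_list_of_set I) \<one> \<oplus> s) z \<zero> \<in> Ubar"
    if "set z \<subseteq> set x" for z
    using that by (induction z) (use assms in \<open>auto simp: zero tensors_def intro!: Ubar_ops *\<close>)
  thus ?thesis by (simp add: tensor_eval_def)
qed

lemma DD_dense:
  assumes x: "x \<in> carrier A" and r: "0 < r"
  shows "\<exists>n. \<exists>y\<in>DD n. nrm A (y \<ominus> x) < r"
proof -
  have "x \<in> cstar_topology A closure_of (\<Union>I\<in>Collect finite. tensor_eval A \<iota> I ` tensors B I)"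
    using itp x by (simp add: infinite_tensor_power_def)
  moreover have "r / 2 > 0" using r by simp
  ultimately obtain z where z: "z \<in> Ubar" "z \<in> carrier A" "nrm A (x \<ominus> z) < r / 2"
    unfolding cs_closure_iff using tensor_eval_Ubar by blast
  then obtain f where f: "\<And>n. f n \<in> UU" "tends f z" unfolding Ubar_def by blast
  have "\<forall>\<^sub>F n in sequentially. nrm A (f n \<ominus> z) < r / 2"
    using f(2) r by (intro order_tendstoD(2)[of _ 0]) auto
  then obtain n where n: "nrm A (f n \<ominus> z) < r / 2" by (auto simp: eventually_sequentially)
  have "nrm A (f n \<ominus> x) < r"
    using nrm_minus_triangle[of "f n" z x] n z nrm_minus_commute[of x z] UU_closed[OF f(1)] x by simp
  thus ?thesis using f(1)[of n] by (auto simp: UU_def)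
qed

lemma unit_sequence:
  "matrix_unit_sequence A (\<lambda>n. words (k n) (LL n)) (\<lambda>n. Em (e n) (LL n)) DD"
  by (intro matrix_unit_sequence.intro matrix_unit_sequence_axioms.intro unital_cstar_algebra_axioms
      tensor_units.matrix_units_Em[OF tu LL(1)] DD_def DD_mono DD_dense) auto

sublocale seq: matrix_unit_sequence A "\<lambda>n. words (k n) (LL n)" "\<lambda>n. Em (e n) (LL n)" DD
  by (rule unit_sequence)

section \<open>Powers of the shift and the systems for its orbits\<close>

lemma \<alpha>_hom: "star_hom A A \<alpha>"
  using shift by (simp add: tensor_shift_def star_iso_def)

lemma \<alpha>_\<iota>: "b \<in> carrier B \<Longrightarrow> \<alpha> (\<iota> i b) = \<iota> (i + 1) b"
  using shift by (simp add: tensor_shift_def)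

lemma \<alpha>_one: "\<alpha> \<one> = \<one>"
  using \<alpha>_\<iota>[OF B.one_closed, of 0] by simp

lemma \<alpha>_pow_hom: "star_hom A A (\<alpha> ^^ j)"
  by (induction j) (use \<alpha>_hom in \<open>auto simp: star_hom_def module_hom_def Pi_def\<close>)

lemmas \<alpha>_pow = module_homD[OF conjunct1[OF \<alpha>_pow_hom[unfolded star_hom_def]]]

lemma \<alpha>_pow_one: "(\<alpha> ^^ j) \<one> = \<one>"
  by (induction j) (auto simp: \<alpha>_one)

lemma \<alpha>_pow_contractive: "a \<in> carrier A \<Longrightarrow> nrm A ((\<alpha> ^^ j) a) \<le> nrm A a"
  by (rule seq.star_hom_contractive[OF \<alpha>_pow_hom \<alpha>_pow_one])

lemma \<alpha>_pow_\<iota>: "b \<in> carrier B \<Longrightarrow> (\<alpha> ^^ j) (\<iota> i b) = \<iota> (i + int j) b"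
  by (induction j) (auto simp: \<alpha>_\<iota> add_ac)

text \<open>The preimage of the target is a subalgebra containing the generators
  \<open>\<iota> i (e n a b)\<close>, hence all of the source.\<close>

lemma \<alpha>_pow_DL:
  assumes L: "distinct L" "distinct L'" and sub: "\<And>i. i \<in> set L \<Longrightarrow> i + int j \<in> set L'" and x: "x \<in> DL n L"
  shows "(\<alpha> ^^ j) x \<in> DL n L'"
proof -
  have "DL n L \<subseteq> {x \<in> carrier A. (\<alpha> ^^ j) x \<in> DL n L'}"
  proof (rule tensor_units.Dm_subset[OF tu L(1)])
    show "cstar_subalgebra {x \<in> carrier A. (\<alpha> ^^ j) x \<in> DL n L'} A"
      by (intro hom_preimage_subalgebra \<alpha>_pow_hom \<alpha>_pow_contractive DL_subalgebra L)
    show "\<one> \<in> {x \<in> carrier A. (\<alpha> ^^ j) x \<in> DL n L'}"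
      using DL_one[OF L(2)] by (simp add: \<alpha>_pow_one)
    fix i a b assume "i \<in> set L" "a < k n" "b < k n"
    thus "\<iota> i (e n a b) \<in> {x \<in> carrier A. (\<alpha> ^^ j) x \<in> DL n L'}"
      using e_S[of a n b] S_closed L sub by (auto simp: \<alpha>_pow_\<iota> intro!: \<iota>_DL)
  qed
  thus ?thesis using x by blast
qed

text \<open>One level m approximates all of \<open>\<F>\<close>. Powers of the shift are contractive
  and only translate the window, so one enlarged window serves the orbit; m does not depend on n,
  and the rank grows by a factor \<open>k m\<close> per step.\<close>

lemma systems_exist:
  assumes F: "finite \<F>" "\<F> \<subseteq> carrier A" and \<epsilon>: "0 < \<epsilon>"
  shows "\<exists>m. \<forall>n. \<exists>F J \<psi> \<phi>. decomposable_system A 0 (orbit_union \<alpha> \<F> n) \<epsilon> F J \<psi> \<phi> \<and>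
    contractive F A \<phi> \<and> cstar_rank F \<le> k m ^ (2 * m + 1 + n)"
proof -
  have "\<exists>m. \<forall>a\<in>\<F>. \<exists>x\<in>DD m. nrm A (a \<ominus> x) \<le> \<epsilon> / 2"
    using F
  proof (induction \<F> rule: finite_induct)
    case (insert a \<F>)
    obtain m1 where m1: "\<forall>a\<in>\<F>. \<exists>x\<in>DD m1. nrm A (a \<ominus> x) \<le> \<epsilon> / 2" using insert by auto
    obtain m2 x where m2: "x \<in> DD m2" "nrm A (x \<ominus> a) < \<epsilon> / 2"
      using DD_dense[of a "\<epsilon> / 2"] insert \<epsilon> by auto
    have "x \<in> carrier A" using m2 cstar_subalgebraD(1)[OF DD_subalgebra] by auto
    hence "nrm A (a \<ominus> x) \<le> \<epsilon> / 2" using m2 insert nrm_minus_commute[of a x] by simp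
    moreover have "DD m1 \<subseteq> DD (max m1 m2)" "DD m2 \<subseteq> DD (max m1 m2)" by (auto intro!: DD_mono)
    ultimately show ?case using m1 m2 by (intro exI[of _ "max m1 m2"]) blast
  qed auto
  then obtain m where m: "\<And>a. a \<in> \<F> \<Longrightarrow> \<exists>x\<in>DD m. nrm A (a \<ominus> x) \<le> \<epsilon> / 2" by blast
  have "\<exists>F J \<psi> \<phi>. decomposable_system A 0 (orbit_union \<alpha> \<F> n) \<epsilon> F J \<psi> \<phi> \<and>
    contractive F A \<phi> \<and> cstar_rank F \<le> k m ^ (2 * m + 1 + n)" for n
  proof -
    \<comment> \<open>It contains every translate of [-m, m] by i < n, and has 2m + 1 + n
      positions.\<close>
    define L where "L = [- int m..int m + int n]"
    have L: "distinct L" "set L = {- int m..int m + int n}" "length L = 2 * m + 1 + n"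
      by (auto simp: L_def)
    interpret E: matrix_units A "words (k m) L" "Em (e m) L"
      by (rule tensor_units.matrix_units_Em[OF tu L(1)])
    interpret E: matrix_units_trace A "words (k m) L" "Em (e m) L" seq.tau
      by unfold_locales (rule seq.tracial_state_tau)
    have approx: "b \<in> carrier A \<and> (\<exists>x\<in>E.mspan. nrm A (b \<ominus> x) \<le> \<epsilon> / 2)" if b: "b \<in> orbit_union \<alpha> \<F> n" for b
    proof -
      obtain i a where ia: "i < n" "a \<in> \<F>" "b = (\<alpha> ^^ i) a" using b by (auto simp: orbit_union_def)
      obtain x where x: "x \<in> DD m" "nrm A (a \<ominus> x) \<le> \<epsilon> / 2" using m[OF ia(2)] by blast
      have c: "a \<in> carrier A" "x \<in> carrier A"
        using ia F x cstar_subalgebraD(1)[OF DD_subalgebra] by auto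
      have "(\<alpha> ^^ i) x \<in> E.mspan"
        using x(1) ia(1) unfolding DD_def by (rule_tac \<alpha>_pow_DL[OF LL(1) L(1)]) (auto simp: LL L)
      moreover have "nrm A (b \<ominus> (\<alpha> ^^ i) x) \<le> \<epsilon> / 2"
      proof -
        have "b \<ominus> (\<alpha> ^^ i) x = (\<alpha> ^^ i) (a \<ominus> x)"
          using c \<alpha>_pow(1) unfolding ia(3) by (simp add: cs_minus \<alpha>_pow(2,3))
        thus ?thesis using \<alpha>_pow_contractive[of "a \<ominus> x" i] c x(2) by simp
      qed
      ultimately show ?thesis using \<alpha>_pow(1)[OF c(1)] ia by blast
    qed
    obtain F J \<psi> \<phi> where "decomposable_system A 0 (orbit_union \<alpha> \<F> n) \<epsilon> F J \<psi> \<phi>" "contractive F A \<phi>"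
      "cstar_rank F \<le> card (words (k m) L)"
      by (rule E.system_exists[OF approx]) blast
    thus ?thesis using L by (auto simp: card_words)
  qed
  thus ?thesis by blast
qed

lemma dims: "dim_nuc A = 0" "decomposition_rank A = 0"
proof -
  have ex: "\<exists>F J \<psi> \<phi>. decomposable_system A 0 \<F> \<epsilon> F J \<psi> \<phi> \<and> contractive F A \<phi>"
    if fin: "finite \<F>" "\<F> \<subseteq> carrier A" "0 < \<epsilon>" for \<F> \<epsilon>
  proof -
    obtain m where m: "\<And>n. \<exists>F J \<psi> \<phi>. decomposable_system A 0 (orbit_union \<alpha> \<F> n) \<epsilon> F J \<psi> \<phi> \<and>
        contractive F A \<phi> \<and> cstar_rank F \<le> k m ^ (2 * m + 1 + n)"
      using systems_exist[OF fin] by blast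
    \<comment> \<open>One step of the orbit is \<open>\<F>\<close> itself.\<close>
    have "orbit_union \<alpha> \<F> 1 = \<F>" by (auto simp: orbit_union_def)
    thus ?thesis using m[of 1] by auto
  qed
  have "dim_nuc A \<le> enat 0"
    unfolding dim_nuc_def
  proof (intro Inf_lower CollectI exI[of _ 0] conjI refl allI impI, elim conjE)
    fix \<F> \<epsilon> assume "finite \<F>" "\<F> \<subseteq> carrier A" "(0::real) < \<epsilon>"
    from ex[OF this] show "\<exists>F J \<psi> \<phi>. decomposable_system A 0 \<F> \<epsilon> F J \<psi> \<phi>" by blast
  qed
  thus "dim_nuc A = 0" by (simp add: zero_enat_def[symmetric])
  have "decomposition_rank A \<le> enat 0"
    unfolding decomposition_rank_def
    by (intro Inf_lower CollectI exI[of _ 0] conjI refl allI impI, elim conjE) (rule ex)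
  thus "decomposition_rank A = 0" by (simp add: zero_enat_def[symmetric])
qed

lemma entropies_eq:
  "ht_nuc A \<alpha> = growth_entropy (r_nuc A 0) A \<alpha>" "ht_dr A \<alpha> = growth_entropy (r_dr A 0) A \<alpha>"
  by (simp_all add: ht_nuc_def ht_dr_def dims zero_enat_def)

lemma log_enat_mono: "a \<le> b \<Longrightarrow> log_enat a \<le> log_enat b"
  by (cases a; cases b) auto

lemma growth_entropy_mono:
  assumes "\<And>\<F> \<epsilon>. r \<F> \<epsilon> \<le> r' \<F> \<epsilon>"
  shows "growth_entropy r A \<alpha> \<le> growth_entropy r' A \<alpha>"
  unfolding growth_entropy_def
proof (intro SUP_mono')
  fix \<F> \<epsilon>
  show "limsup (\<lambda>n. log_enat (r (orbit_union \<alpha> \<F> n) \<epsilon>) / ereal (real n))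
      \<le> limsup (\<lambda>n. log_enat (r' (orbit_union \<alpha> \<F> n) \<epsilon>) / ereal (real n))"
  proof (rule Limsup_mono)
    show "\<forall>\<^sub>F n in sequentially. log_enat (r (orbit_union \<alpha> \<F> n) \<epsilon>) / ereal (real n)
        \<le> log_enat (r' (orbit_union \<alpha> \<F> n) \<epsilon>) / ereal (real n)"
      using eventually_gt_at_top[of 0]
      by eventually_elim (intro ereal_divide_right_mono log_enat_mono assms, simp)
  qed
qed

end

section \<open>Entropies of the tensor shift\<close>

lemma rcp_le_r_nuc: "rcp A \<F> \<epsilon> \<le> r_nuc A 0 \<F> \<epsilon>"
  unfolding rcp_def r_nuc_def by (rule Inf_superset_mono) (use decomposable_system_0 in blast)

lemma r_nuc_le_r_dr: "r_nuc A d \<F> \<epsilon> \<le> r_dr A d \<F> \<epsilon>"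
  unfolding r_nuc_def r_dr_def by (rule Inf_superset_mono) blast

text \<open>A nonempty set of extended naturals has a least element, so the infimum is a rank unless
  there is no approximation at all.\<close>

lemma rcp_attained:
  assumes "rcp A \<F> \<epsilon> \<noteq> \<infinity>"
  obtains F \<psi> \<phi> where "cpc_approximation A \<F> \<epsilon> F \<psi> \<phi>" "rcp A \<F> \<epsilon> = enat (cstar_rank F)"
proof -
  define X where "X = {enat (cstar_rank F) | F \<psi> \<phi>. cpc_approximation A \<F> \<epsilon> F \<psi> \<phi>}"
  have r: "rcp A \<F> \<epsilon> = Inf X" by (simp add: rcp_def X_def)
  have ne: "X \<noteq> {}" using assms unfolding r by (auto simp: Inf_enat_def)
  have "Inf X \<in> X"
    using ne LeastI_ex[of "\<lambda>x. x \<in> X"] by (auto simp: Inf_enat_def)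
  then obtain F \<psi> \<phi> where "cpc_approximation A \<F> \<epsilon> F \<psi> \<phi>" "Inf X = enat (cstar_rank F)"
    unfolding X_def by blast
  thus ?thesis using that r by simp
qed

context uhf_tensor_shift
begin

lemma k_pos: "k n > 0"
  using matrix_units.card_W_pos[OF units, of n] by simp

lemma ht_le_ht_nuc: "ht A \<alpha> \<le> ht_nuc A \<alpha>"
  unfolding entropies_eq ht_def by (intro growth_entropy_mono rcp_le_r_nuc)

lemma ht_nuc_le_ht_dr: "ht_nuc A \<alpha> \<le> ht_dr A \<alpha>"
  unfolding entropies_eq by (intro growth_entropy_mono r_nuc_le_r_dr)

text \<open>Letter projections at position 0 are moved by the shift to positions 0, ..., n - 1,
  where \<open>rank_lower_bound\<close> applies with x = \<epsilon>. Dividing the logarithm by n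
  leaves ln K up to errors vanishing as n grows and then \<epsilon> tends to 0.\<close>

lemma ht_lower:
  fixes m :: nat
  defines "K \<equiv> real (k m)"
  shows "ereal (ln K) \<le> ht A \<alpha>"
proof -
  define \<F> where "\<F> = (\<lambda>s. \<iota> 0 (e m s s)) ` {..<k m}"
  have K: "K \<ge> 1" using k_pos[of m] by (simp add: K_def)
  have ec: "e m s s \<in> carrier B" if "s < k m" for s using that e_S S_closed by blast
  have \<F>: "finite \<F>" "\<F> \<subseteq> carrier A" using ec by (auto simp: \<F>_def)
  have le: "ereal (ln K + 2 * K * \<epsilon> * ln \<epsilon> - ln (1 + (K - 1) * \<epsilon>)) \<le> ht A \<alpha>"
    if \<epsilon>: "0 < \<epsilon>" "\<epsilon> \<le> 1/2" for \<epsilon>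
  proof -
    let ?c = "ln K + 2 * K * \<epsilon> * ln \<epsilon> - ln (1 + (K - 1) * \<epsilon>)"
    let ?f = "\<lambda>n. log_enat (rcp A (orbit_union \<alpha> \<F> n) \<epsilon>) / ereal (real n)"
    have bound: "ereal (?c - ln 2 / real n) \<le> ?f n" if n: "n > 0" for n
    proof (cases "rcp A (orbit_union \<alpha> \<F> n) \<epsilon> = \<infinity>")
      case True
      thus ?thesis using n by simp
    next
      case False
      obtain F \<psi> \<phi> where F: "cpc_approximation A (orbit_union \<alpha> \<F> n) \<epsilon> F \<psi> \<phi>"
        "rcp A (orbit_union \<alpha> \<F> n) \<epsilon> = enat (cstar_rank F)"
        using rcp_attained[OF False] by blast
      have mem: "\<iota> (int i) (e m s s) \<in> orbit_union \<alpha> \<F> n" if "i < n" "s < k m" for i s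
      proof -
        have "\<iota> (int i) (e m s s) = (\<alpha> ^^ i) (\<iota> 0 (e m s s))" using ec[OF that(2)] by (simp add: \<alpha>_pow_\<iota>)
        thus ?thesis using that by (auto simp: orbit_union_def \<F>_def)
      qed
      define q where "q = 1 + (K - 1) * \<epsilon>"
      have q: "q > 0" using K \<epsilon> by (simp add: q_def add_pos_nonneg)
      have main: "K ^ n * \<epsilon> powr (2 * K * \<epsilon> * real n) / 2 \<le> real (cstar_rank F) * q ^ n"
        unfolding K_def q_def
      proof (rule tensor_units.rank_lower_bound[OF tu seq.tracial_state_tau n \<epsilon>(1) _ \<epsilon>])
        show "nrm A (\<phi> (\<psi> (\<iota> (int i) (e m s s))) \<ominus> \<iota> (int i) (e m s s)) \<le> \<epsilon>" if "i < n" "s < k m" for i s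
          using F(1) mem[OF that] by (simp add: cpc_approximation_def)
      qed (use F(1) \<epsilon> in \<open>auto simp: cpc_approximation_def\<close>)
      have pos: "0 < K ^ n * \<epsilon> powr (2 * K * \<epsilon> * real n) / 2" using K \<epsilon> by simp
      \<comment> \<open>A zero rank would have logarithm minus infinity in \<open>log_enat\<close>;
        the positive lower bound excludes it.\<close>
      hence r0: "real (cstar_rank F) > 0"
        using main q by (metis less_le_trans zero_less_mult_iff zero_less_power not_less_iff_gr_or_eq)
      have "ln (K ^ n * \<epsilon> powr (2 * K * \<epsilon> * real n) / 2) \<le> ln (real (cstar_rank F) * q ^ n)"
        using main pos by (rule_tac ln_mono) auto
      also have "ln (real (cstar_rank F) * q ^ n) = ln (real (cstar_rank F)) + real n * ln q"
        using r0 q by (simp add: ln_mult ln_realpow)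
      also have "ln (K ^ n * \<epsilon> powr (2 * K * \<epsilon> * real n) / 2)
          = real n * ln K + real n * (2 * K * \<epsilon> * ln \<epsilon>) - ln 2"
        using K \<epsilon> by (simp add: ln_mult ln_div ln_realpow ln_powr)
      finally have "real n * ?c - ln 2 \<le> ln (real (cstar_rank F))"
        by (simp add: q_def algebra_simps)
      hence "(real n * ?c - ln 2) / real n \<le> ln (real (cstar_rank F)) / real n"
        by (rule divide_right_mono) simp
      moreover have "(real n * ?c - ln 2) / real n = ?c - ln 2 / real n"
        using n by (simp add: diff_divide_distrib)
      ultimately have "?c - ln 2 / real n \<le> ln (real (cstar_rank F)) / real n"
        by simp
      thus ?thesis using r0 n by (simp add: F(2))
    qed
    \<comment> \<open>The factor 1/2 of the rank bound contributes ln 2 / n.\<close>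
    have "(\<lambda>n. ereal (?c - ln 2 / real n)) \<longlonglongrightarrow> ereal (?c - 0)"
      unfolding lim_ereal by (intro tendsto_intros lim_const_over_n)
    hence "limsup (\<lambda>n. ereal (?c - ln 2 / real n)) = ereal (?c - 0)"
      by (rule lim_imp_Limsup[OF trivial_limit_sequentially])
    hence "ereal ?c = limsup (\<lambda>n. ereal (?c - ln 2 / real n))"
      by simp
    also have "\<dots> \<le> limsup ?f"
      by (rule Limsup_mono, rule eventually_mono[OF eventually_gt_at_top[of 0]]) (rule bound)
    also have "\<dots> \<le> ht A \<alpha>"
      unfolding ht_def growth_entropy_def
      by (rule SUP_upper2[of \<F>], use \<F> in simp, rule SUP_upper2[of \<epsilon>]) (use \<epsilon> in auto)
    finally show ?thesis .
  qed
  \<comment> \<open>The offset 2 keeps \<epsilon> = 1 / (j + 2) within the admissible range up to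
    1/2.\<close>
  have "(\<lambda>j. ln K + 2 * K * (1 / real (j + 2)) * ln (1 / real (j + 2)) - ln (1 + (K - 1) * (1 / real (j + 2))))
      \<longlonglongrightarrow> ln K"
    by real_asymp
  hence "(\<lambda>j. ereal (ln K + 2 * K * (1 / real (j + 2)) * ln (1 / real (j + 2))
      - ln (1 + (K - 1) * (1 / real (j + 2))))) \<longlonglongrightarrow> ereal (ln K)"
    by simp
  thus ?thesis
  proof (rule Lim_bounded[where M = 0], intro allI impI)
    fix j :: nat
    show "ereal (ln K + 2 * K * (1 / real (j + 2)) * ln (1 / real (j + 2))
        - ln (1 + (K - 1) * (1 / real (j + 2)))) \<le> ht A \<alpha>"
      by (rule le) (simp_all add: field_simps)
  qed
qed

text \<open>The level m depends on \<open>\<F>\<close> and \<epsilon>, but for a constant size only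
  the exponent feels it: the extra 2m + 1 positions vanish after division by n.\<close>

lemma ht_dr_upper:
  assumes const: "\<And>n. k n = K"
  shows "ht_dr A \<alpha> \<le> ereal (ln (real K))"
  unfolding entropies_eq growth_entropy_def
proof (intro SUP_least)
  fix \<F> and \<epsilon> :: real assume "\<F> \<in> {\<F>. finite \<F> \<and> \<F> \<subseteq> carrier A}" "\<epsilon> \<in> {0<..}"
  then obtain m where m: "\<And>n. \<exists>F J \<psi> \<phi>. decomposable_system A 0 (orbit_union \<alpha> \<F> n) \<epsilon> F J \<psi> \<phi> \<and>
      contractive F A \<phi> \<and> cstar_rank F \<le> k m ^ (2 * m + 1 + n)"
    using systems_exist[of \<F> \<epsilon>] by auto
  have K: "K > 0" using k_pos[of 0] const by simp
  let ?f = "\<lambda>n. log_enat (r_dr A 0 (orbit_union \<alpha> \<F> n) \<epsilon>) / ereal (real n)"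
  have bound: "?f n \<le> ereal ((real (2 * m + 1) / real n + 1) * ln (real K))" if n: "n > 0" for n
  proof -
    obtain F J \<psi> \<phi> where F: "decomposable_system A 0 (orbit_union \<alpha> \<F> n) \<epsilon> F J \<psi> \<phi>" "contractive F A \<phi>"
      "cstar_rank F \<le> K ^ (2 * m + 1 + n)"
      using m[of n] const by metis
    have "r_dr A 0 (orbit_union \<alpha> \<F> n) \<epsilon> \<le> enat (cstar_rank F)"
      unfolding r_dr_def using F by (intro Inf_lower) blast
    also have "\<dots> \<le> enat (K ^ (2 * m + 1 + n))" using F(3) by simp
    finally have "log_enat (r_dr A 0 (orbit_union \<alpha> \<F> n) \<epsilon>) \<le> log_enat (enat (K ^ (2 * m + 1 + n)))"
      by (rule log_enat_mono)
    also have "\<dots> = ereal (real (2 * m + 1 + n) * ln (real K))"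
    proof -
      have "ln (real (K ^ N)) = real N * ln (real K)" for N using K by (simp add: ln_realpow)
      moreover have "K ^ (2 * m + 1 + n) \<noteq> 0" using K by simp
      ultimately show ?thesis by (simp only: log_enat.simps if_False)
    qed
    finally have "?f n \<le> ereal (real (2 * m + 1 + n) * ln (real K)) / ereal (real n)"
      using n by (intro ereal_divide_right_mono) auto
    also have "\<dots> = ereal ((real (2 * m + 1) / real n + 1) * ln (real K))"
      using n by (simp add: field_simps)
    finally show ?thesis .
  qed
  have "limsup ?f \<le> limsup (\<lambda>n. ereal ((real (2 * m + 1) / real n + 1) * ln (real K)))"
    by (rule Limsup_mono, rule eventually_mono[OF eventually_gt_at_top[of 0]]) (rule bound)
  also have "\<dots> = ereal ((0 + 1) * ln (real K))"
    by (intro lim_imp_Limsup trivial_limit_sequentially, unfold lim_ereal)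
      (intro tendsto_intros lim_const_over_n)
  finally show "limsup ?f \<le> ereal (ln (real K))" by simp
qed

lemma entropies_const:
  assumes "\<And>n. k n = K"
  shows "ht_dr A \<alpha> = ereal (ln (real K))" "ht_nuc A \<alpha> = ereal (ln (real K))" "ht A \<alpha> = ereal (ln (real K))"
  using ht_dr_upper[of K] ht_lower[of 0] ht_le_ht_nuc ht_nuc_le_ht_dr assms by auto

lemma entropies_unbounded:
  assumes unb: "\<And>N. \<exists>n. N < k n"
  shows "ht_dr A \<alpha> = \<infinity>" "ht_nuc A \<alpha> = \<infinity>" "ht A \<alpha> = \<infinity>"
proof -
  have "ereal x \<le> ht A \<alpha>" for x :: real
  proof -
    obtain n where n: "nat \<lceil>exp x\<rceil> < k n" using unb by blast
    have "exp x \<le> real (k n)" using n by linarith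
    hence "x \<le> ln (real (k n))" using k_pos[of n] by (simp add: ln_ge_iff)
    thus ?thesis using ht_lower[of n] order_trans[of "ereal x" "ereal (ln (real (k n)))"] by simp
  qed
  thus ht: "ht A \<alpha> = \<infinity>" using ereal_top by blast
  show nuc: "ht_nuc A \<alpha> = \<infinity>" using ht_le_ht_nuc ht by simp
  show "ht_dr A \<alpha> = \<infinity>" using ht_nuc_le_ht_dr nuc by simp
qed

end

theorem proposition2p5:
  fixes B :: "'b cstar_alg" and A :: "'a cstar_alg"
    and \<iota> :: "int \<Rightarrow> 'b \<Rightarrow> 'a" and \<alpha> :: "'a \<Rightarrow> 'a"
  assumes "uhf_algebra B"
    and "infinite_tensor_power B A \<iota>"
    and "tensor_shift B A \<iota> \<alpha>"
  shows "(\<exists>k::nat. 1 \<le> k \<and> cstar_isomorphic B (matrix_algebra k) \<and>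
            ht_dr A \<alpha> = ereal (ln (real k)) \<and>
            ht_nuc A \<alpha> = ereal (ln (real k)) \<and>
            ht A \<alpha> = ereal (ln (real k)))
       \<or> (\<not> finite_dimensional B \<and> ht_dr A \<alpha> = \<infinity> \<and> ht_nuc A \<alpha> = \<infinity> \<and> ht A \<alpha> = \<infinity>)"
proof -
  have "unital_cstar_algebra A" "unital_cstar_algebra B"
    using assms(2) by (auto simp: infinite_tensor_power_def unital_cstar_algebra_iff)
  then interpret tensor_power A B \<iota>
    by (intro tensor_power.intro tensor_power_axioms.intro assms(2))
  obtain S k where inc: "incseq S"
    and S: "\<And>n. cstar_subalgebra (S n) B" "\<And>n. \<one>\<^bsub>B\<^esub> \<in> S n" "\<And>n. (1::nat) \<le> k n"
      "\<And>n. cstar_isomorphic (B\<lparr>carrier := S n\<rparr>) (matrix_algebra (k n))"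
    and cl: "cstar_topology B closure_of (\<Union>n::nat. S n) = carrier B"
    using assms(1) unfolding uhf_algebra_def by blast
  have "\<exists>e. matrix_units B {..<k n} e \<and> matrix_units.mspan B {..<k n} e = S n" for n
    using matrix_units_of_iso[OF B.unital_cstar_algebra_axioms B_nontrivial S(1,2,4)] by blast
  then obtain e where e: "\<And>n. matrix_units B {..<k n} (e n)"
    "\<And>n. matrix_units.mspan B {..<k n} (e n) = S n" by metis
  have dense: "\<exists>n. \<exists>y\<in>S n. nrm B (y \<ominus>\<^bsub>B\<^esub> b) < r" if b: "b \<in> carrier B" "0 < r" for b r
  proof -
    have "b \<in> cstar_topology B closure_of (\<Union>n. S n)" using cl b by simp
    then obtain y where y: "y \<in> (\<Union>n. S n)" "y \<in> carrier B" "nrm B (b \<ominus>\<^bsub>B\<^esub> y) < r"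
      unfolding B.cs_closure_iff using b(2) by blast
    thus ?thesis using B.nrm_minus_commute[of b y] b by auto
  qed
  have mono: "S i \<subseteq> S j" if "i \<le> j" for i j using inc that by (auto simp: incseq_def)
  \<comment> \<open>The diagonal units of the smaller algebra are orthogonal projections in the
    larger one.\<close>
  have k_mono: "k i \<le> k j" if "i \<le> j" for i j
  proof -
    interpret i: matrix_units B "{..<k i}" "e i" by (rule e)
    interpret j: matrix_units B "{..<k j}" "e j" by (rule e)
    have "card ((\<lambda>s. e i s s) ` {..<k i}) \<le> card {..<k j}"
      using mono[OF that] i.e_mspan e by (intro j.card_orth_projs_le i.orth_projs_diag) auto
    thus ?thesis by (simp add: i.orth_projs_diag(2))
  qed
  show ?thesis
  proof (cases "\<exists>N. \<forall>n. k n \<le> N")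
    case True
    \<comment> \<open>Bounded sizes attain a maximum, from which on the algebras stop
      growing.\<close>
    then obtain m where m: "\<And>n. k n \<le> k m"
      using ex_has_greatest_nat[of "\<lambda>_. True" 0 k] by (metis le_imp_less_Suc)
    \<comment> \<open>Beyond m the sizes are equal by monotonicity and maximality, and nested matrix
      algebras of equal size coincide.\<close>
    have Sm: "S n \<subseteq> S m" for n
    proof (cases "n \<le> m")
      case False
      hence "m \<le> n" by simp
      hence kn: "k n = k m" using k_mono[of m n] m[of n] by simp
      have "matrix_units.mspan B {..<k m} (e m) = matrix_units.mspan B {..<k m} (e n)"
        using e[of n] e[of m] mono[OF \<open>m \<le> n\<close>] unfolding kn by (intro mspan_eq_if_card_eq) auto
      thus ?thesis using e(2)[of n] e(2)[of m] unfolding kn by simp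
    qed (rule mono)
    have full: "S m = carrier B"
    proof
      show "S m \<subseteq> carrier B" using B.cstar_subalgebraD(1)[OF S(1)] .
      show "carrier B \<subseteq> S m"
      proof
        fix b assume b: "b \<in> carrier B"
        have "\<exists>y\<in>S m. nrm B (y \<ominus>\<^bsub>B\<^esub> b) < inverse (real (Suc n))" for n
          using dense[OF b, of "inverse (real (Suc n))"] Sm by fastforce
        then obtain f where f: "\<And>n. f n \<in> S m" "\<And>n. nrm B (f n \<ominus>\<^bsub>B\<^esub> b) < inverse (real (Suc n))"
          by metis
        have fc: "f n \<in> carrier B" for n using f(1) B.cstar_subalgebraD(1)[OF S(1)] by blast
        have "B.tends f b"
          by (rule Lim_null_comparison[OF _ LIMSEQ_inverse_real_of_nat])
            (use f(2) fc b B.nrm_nonneg in \<open>auto intro!: always_eventually less_imp_le\<close>)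
        thus "b \<in> S m" by (rule B.cstar_subalgebraD(8)[OF S(1) f(1) b])
      qed
    qed
    \<comment> \<open>The whole algebra is already \<open>S m\<close>, so the constant sequence at m
      is dense.\<close>
    interpret uhf_tensor_shift A B \<iota> \<alpha> "\<lambda>_. k m" "\<lambda>_. e m" "\<lambda>_. S m"
    proof (intro uhf_tensor_shift.intro uhf_tensor_shift_axioms.intro tensor_power_axioms assms(3)
        e(1) e(2)[symmetric] subset_refl)
      fix b and r :: real assume "b \<in> carrier B" "0 < r"
      thus "\<exists>n::nat. \<exists>y\<in>S m. nrm B (y \<ominus>\<^bsub>B\<^esub> b) < r"
        using full by (intro exI[of _ 0] bexI[of _ b]) auto
    qed
    have "cstar_isomorphic B (matrix_algebra (k m))" using S(4)[of m] by (simp add: full)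
    thus ?thesis using entropies_const[OF refl] S(3)[of m] by blast
  next
    case False
    interpret uhf_tensor_shift A B \<iota> \<alpha> k e S
      by (intro uhf_tensor_shift.intro uhf_tensor_shift_axioms.intro tensor_power_axioms assms(3)
          e(1) e(2)[symmetric] mono dense) auto
    have unb: "\<exists>n. N < k n" for N using False by (meson not_le)
    \<comment> \<open>The diagonal units form families of orthogonal projections of unbounded
      size.\<close>
    have "\<not> finite_dimensional B"
    proof
      assume "finite_dimensional B"
      then obtain N where N: "\<And>P. B.orth_projs P \<Longrightarrow> finite P \<and> card P \<le> N"
        using B.orth_projs_bound by blast
      obtain n where "N < k n" using unb by blast
      thus False
        using N[OF matrix_units.orth_projs_diag(1)[OF e(1)[of n]]]
          matrix_units.orth_projs_diag(2)[OF e(1)[of n]] by simp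
    qed
    thus ?thesis using entropies_unbounded[OF unb] by blast
  qed
qed

end
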